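(* Let $\mathbf{C}^-:=\inf_{F\in\mathcal{H}_{\pi\Delta},F\ne0}\|F\|_{L^2(\mathbb{R},W)}/\|F\|_{L^2(\mathbb{R})}$ and $\mathbf{C}^+:=\sup_{F\in\mathcal{H}_{\pi\Delta},F\ne0}\|F\|_{L^2(\mathbb{R},W)}/\|F\|_{L^2(\mathbb{R})}$, where $W(x)=1-\frac{\sin 2\pi x}{2\pi x}$. (i) For $0<\Delta\le1$: $\mathbf{C}^-=\sqrt{1-\frac{\Delta}{2}}$ and $\mathbf{C}^+=1$. (ii) For $1<\Delta\le2$, let $\eta^+$ and $\eta^-$ be the largest and the smallest real solutions $\eta$ of \[ \left(\tfrac{1}{2}+\tfrac{2-\Delta}{4\eta}\right)\cos\left(\tfrac{\Delta-1}{2\eta}\right)+\sin\left(\tfrac{\Delta-1}{2\eta}\right) = 1. \] Then $\mathbf{C}^-=\sqrt{1-\eta^+}$ and $\mathbf{C}^+=\sqrt{1-\eta^-}$.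
   Context: $\mathcal{H}_{\pi\Delta}$ is the space of entire functions of exponential type at most $\pi\Delta$ that are square-integrable on $\mathbb{R}$; $\|F\|^2_{L^2(\mathbb{R},W)}=\int_{\mathbb{R}}|F(x)|^2W(x)\,dx$. *)

theory Defs
  imports "HOL-Analysis.Analysis"
begin

definition exp_type_le :: "real \<Rightarrow> (complex \<Rightarrow> complex) \<Rightarrow> bool" where
  "exp_type_le tau F \<longleftrightarrow>
     (\<forall>eps>0. \<exists>C. \<forall>z. norm (F z) \<le> C * exp ((tau + eps) * norm z))"

definition PW :: "real \<Rightarrow> (complex \<Rightarrow> complex) set" where
  "PW Delta = {F. F holomorphic_on UNIV \<and> exp_type_le (pi * Delta) F
                 \<and> integrable lborel (\<lambda>x::real. (norm (F (complex_of_real x)))\<^sup>2)}"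

definition W :: "real \<Rightarrow> real" where
  "W x = 1 - sin (2 * pi * x) / (2 * pi * x)"

definition L2norm :: "(complex \<Rightarrow> complex) \<Rightarrow> real" where
  "L2norm F = sqrt (\<integral>x. (norm (F (complex_of_real x)))\<^sup>2 \<partial>lborel)"

definition L2Wnorm :: "(complex \<Rightarrow> complex) \<Rightarrow> real" where
  "L2Wnorm F = sqrt (\<integral>x. (norm (F (complex_of_real x)))\<^sup>2 * W x \<partial>lborel)"

definition ratios :: "real \<Rightarrow> real set" where
  "ratios Delta = {L2Wnorm F / L2norm F | F. F \<in> PW Delta \<and> F \<noteq> (\<lambda>_. 0)}"

definition Cminus :: "real \<Rightarrow> real" where "Cminus Delta = Inf (ratios Delta)"
definition Cplus :: "real \<Rightarrow> real" where "Cplus Delta = Sup (ratios Delta)"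

definition eta_eq :: "real \<Rightarrow> real \<Rightarrow> bool" where
  "eta_eq Delta eta \<longleftrightarrow> eta \<noteq> 0 \<and>
     (1/2 + (2 - Delta) / (4 * eta)) * cos ((Delta - 1) / (2 * eta))
       + sin ((Delta - 1) / (2 * eta)) = 1"

end

theory Submission
  imports Defs "HOL-Probability.Probability" "HOL-Complex_Analysis.Complex_Analysis"
begin

text \<open>
  On the Fourier side an element of the Paley--Wiener space is a function \<open>g\<close> on
  \<open>I = [-\<Delta>/2, \<Delta>/2]\<close>, and since \<open>sin (2\<pi>x) / (2\<pi>x)\<close> is the transform of half the indicator of
  \<open>[-1, 1]\<close>, the squared ratio of norms becomes \<open>1 - \<langle>T g, g\<rangle> / \<langle>g, g\<rangle>\<close> with
  \<open>T g s = 1/2 \<integral> g\<close> over \<open>I \<inter> [s - 1, s + 1]\<close>. So the extremal constants are governed by the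
  largest and smallest values of the quadratic form of \<open>T\<close>.

  For \<open>\<Delta> \<le> 1\<close> the operator has rank one. For \<open>1 < \<Delta> \<le> 2\<close> it is compact and self-adjoint with
  both positive and negative values, so both extremes are eigenvalues. With \<open>\<lambda> = 1/(2\<eta>)\<close> and \<open>p\<close>, \<open>q\<close>
  the restrictions of an eigenfunction to the first and last subintervals of length \<open>\<Delta> - 1\<close>, the
  eigenvalue equation reads \<open>p' = \<lambda> q\<close>, \<open>q' = - \<lambda> p\<close>, and the eigenfunction is constant in between; the
  matching conditions are a homogeneous \<open>2 \<times> 2\<close> system whose determinant is the equation for \<open>\<eta>\<close>.

  That an integrable function of exponential type \<open>\<pi>\<Delta>\<close> has a Fourier transform supported in \<open>I\<close>
  follows by comparing its one-sided Laplace transforms with the Borel transform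
  \<open>\<Sum>n. F\<^bsup>(n)\<^esup>(0) / w\<^bsup>n+1\<^esup>\<close>, which continues both of them across the imaginary axis. The general
  case is reduced to the integrable one by a dilation and a multiplier.
\<close>

section \<open>Fourier transform and Gaussian summation\<close>

text \<open>No Fourier transform on L^2 is built: everything runs on functions continuous on a
  closed interval and zero outside it. This class is large enough because the eigenfunctions are
  continuous and because an integrable \<open>F\<close> has a continuous transform; an arbitrary
  \<open>F\<close> enters only through an inequality between quadratic forms, which survives a
  limit. Sharpness needs no such limit, since an eigenfunction yields an extremal \<open>F\<close>
  by an explicit integral.

  For 1 < \<Delta> the equation for \<eta> has infinitely many solutions accumulating at 0, so the
  existence of a largest and a smallest one is part of the claim. It is not studied as an equation.
  Its solutions are exactly the nonzero eigenvalues of T: the extreme values of the form are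
  attained and hence solve it, while every solution has an eigenfunction and so cannot lie beyond
  the extremes. That the form takes both signs is seen from solutions at which the cosine vanishes
  and the sine is 1.\<close>

definition fourier :: "(real \<Rightarrow> complex) \<Rightarrow> real \<Rightarrow> complex" where
  "fourier f y = (\<integral>x. f x * cis (2 * pi * x * y) \<partial>lborel)"

lemma measurable_cis [measurable]: "cis \<in> borel_measurable borel"
  by (intro borel_measurable_continuous_onI continuous_intros)

lemma measurable_cnj [measurable]: "cnj \<in> borel_measurable borel"
  by (intro borel_measurable_continuous_onI continuous_intros)

lemma integrable_mult_bounded:
  fixes f g :: "'a \<Rightarrow> complex"
  assumes "integrable M f" "g \<in> borel_measurable M" "\<And>x. norm (g x) \<le> B"
  shows "integrable M (\<lambda>x. f x * g x)"
proof (rule Bochner_Integration.integrable_bound)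
  show "integrable M (\<lambda>x. B * norm (f x))" using assms(1) by auto
  show "(\<lambda>x. f x * g x) \<in> borel_measurable M" using assms(1,2) by measurable
  have "norm (f x) * norm (g x) \<le> \<bar>B\<bar> * norm (f x)" for x
  proof -
    have "norm (g x) \<le> \<bar>B\<bar>" using assms(3)[of x] by linarith
    then have "norm (f x) * norm (g x) \<le> norm (f x) * \<bar>B\<bar>" by (intro mult_left_mono) auto
    then show ?thesis by (simp add: mult.commute)
  qed
  then show "AE x in M. norm (f x * g x) \<le> norm (B * norm (f x))"
    by (auto simp: norm_mult abs_mult)
qed

lemma integrable_mult_cis:
  assumes "integrable lborel f"
  shows "integrable lborel (\<lambda>x. f x * cis (2 * pi * x * y))"
  by (rule integrable_mult_bounded[OF assms, where B = 1]) auto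

lemma norm_fourier_le: "norm (fourier f y) \<le> (\<integral>x. norm (f x) \<partial>lborel)"
proof -
  have "norm (fourier f y) \<le> (\<integral>x. norm (f x * cis (2 * pi * x * y)) \<partial>lborel)"
    unfolding fourier_def by (rule integral_norm_bound)
  then show ?thesis by (simp add: norm_mult)
qed

lemma continuous_fourier:
  assumes "integrable lborel f"
  shows "continuous_on UNIV (fourier f)"
  unfolding continuous_on_eq_continuous_within
proof
  fix y
  have "isCont (fourier f) y"
    unfolding fourier_def isCont_def
  proof (rule tendsto_at_iff_sequentially[THEN iffD2], safe)
    fix X :: "nat \<Rightarrow> real" assume X: "X \<longlonglongrightarrow> y"
    have [measurable]: "f \<in> borel_measurable borel" using assms by auto
    show "((\<lambda>y. \<integral>x. f x * cis (2 * pi * x * y) \<partial>lborel) \<circ> X) \<longlonglongrightarrow> (\<integral>x. f x * cis (2 * pi * x * y) \<partial>lborel)"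
      unfolding o_def
    proof (rule integral_dominated_convergence[where w = "\<lambda>x. norm (f x)"])
      show "AE x in lborel. (\<lambda>i. f x * cis (2 * pi * x * X i)) \<longlonglongrightarrow> f x * cis (2 * pi * x * y)"
        by (intro AE_I2 tendsto_intros X)
    qed (use assms in \<open>auto simp: norm_mult\<close>)
  qed
  then show "continuous (at y within UNIV) (fourier f)" by simp
qed

lemma measurable_fourier [measurable]:
  assumes "integrable lborel f"
  shows "fourier f \<in> borel_measurable borel"
  by (rule borel_measurable_continuous_onI[OF continuous_fourier[OF assms]])

text \<open>The multiplication formula. Modulated Gaussians in it yield inversion and Plancherel;
  the indicator of an interval yields the weighted norm.\<close>

lemma integral_fourier_swap:
  assumes f: "integrable lborel f" and h: "integrable lborel h"
  shows "(\<integral>x. h x * fourier f x \<partial>lborel) = (\<integral>t. fourier h t * f t \<partial>lborel)"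
proof -
  have [measurable]: "f \<in> borel_measurable borel" "h \<in> borel_measurable borel"
    using f h by auto
  let ?k = "\<lambda>x t. h x * (f t * cis (2 * pi * t * x))"
  have int: "integrable (lborel \<Otimes>\<^sub>M lborel) (case_prod ?k)"
  proof (rule lborel_pair.Fubini_integrable)
    show "case_prod ?k \<in> borel_measurable (lborel \<Otimes>\<^sub>M lborel)" by measurable
    have "integrable lborel (\<lambda>x. norm (h x) * (\<integral>t. norm (f t) \<partial>lborel))" using h by auto
    then show "integrable lborel (\<lambda>x. \<integral>y. norm (case_prod ?k (x, y)) \<partial>lborel)"
      by (simp add: norm_mult)
    show "AE x in lborel. integrable lborel (\<lambda>y. case_prod ?k (x, y))"
      using integrable_mult_cis[OF f] by auto
  qed
  have "(\<integral>x. h x * fourier f x \<partial>lborel) = (\<integral>x. (\<integral>t. ?k x t \<partial>lborel) \<partial>lborel)"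
    unfolding fourier_def by (simp only: integral_mult_right_zero)
  also have "\<dots> = (\<integral>t. (\<integral>x. ?k x t \<partial>lborel) \<partial>lborel)"
    by (rule lborel_pair.Fubini_integral[OF int, symmetric])
  also have "\<dots> = (\<integral>t. (\<integral>x. h x * cis (2 * pi * x * t) * f t \<partial>lborel) \<partial>lborel)"
    by (intro Bochner_Integration.integral_cong refl) (simp add: mult_ac)
  also have "\<dots> = (\<integral>t. fourier h t * f t \<partial>lborel)"
    unfolding fourier_def by (simp only: integral_mult_left_zero)
  finally show ?thesis .
qed

lemma fourier_modulation:
  "fourier (\<lambda>x. h x * cis (2 * pi * x * u)) y = fourier h (y + u)"
  unfolding fourier_def
  by (intro Bochner_Integration.integral_cong refl)
     (simp add: mult.assoc cis_mult algebra_simps)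

lemma fourier_reflect: "fourier (\<lambda>x. f (- x)) y = fourier f (- y)"
  unfolding fourier_def
  by (subst lborel_integral_real_affine[where c = "-1" and t = 0]) auto

lemma cnj_fourier: "cnj (fourier f y) = fourier (\<lambda>x. cnj (f (- x))) y"
proof -
  have "cnj (fourier f y) = (\<integral>x. cnj (f x) * cis (2 * pi * x * (- y)) \<partial>lborel)"
    unfolding fourier_def Bochner_Integration.integral_cnj[symmetric]
    by (intro Bochner_Integration.integral_cong refl) (simp add: cis_cnj)
  also have "\<dots> = fourier (\<lambda>x. cnj (f (- x))) y"
    using fourier_reflect[of "\<lambda>x. cnj (f x)" y] by (simp add: fourier_def)
  finally show ?thesis .
qed

text \<open>Scaled so that its transform is the standard normal density dilated by \<open>k\<close>,
  of total mass 1. As \<open>k\<close> grows, \<open>gauss k\<close> increases to 1 while its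
  transform concentrates at 0.\<close>

definition gauss :: "real \<Rightarrow> real \<Rightarrow> real" where
  "gauss k x = exp (- (2 * pi\<^sup>2 * x\<^sup>2 / k\<^sup>2))"

lemma measurable_gauss [measurable]: "gauss k \<in> borel_measurable borel"
  unfolding gauss_def[abs_def] by measurable

lemma gauss_bounds: "0 < gauss k x" "gauss k x \<le> 1"
  by (auto simp: gauss_def)

lemma gauss_eq_normal:
  assumes "k > 0"
  shows "gauss k x = sqrt (2 * pi) * std_normal_density (0 + (2 * pi / k) * x)"
  by (simp add: gauss_def std_normal_density_def power_mult_distrib power_divide)

lemma integrable_gauss:
  assumes "k > 0" shows "integrable lborel (\<lambda>x. complex_of_real (gauss k x))"
proof -
  have "integrable lborel std_normal_density"
    using integrable_std_normal_moment[of 0] by simp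
  from lborel_integrable_real_affine[OF this, of "2 * pi / k" 0]
  have "integrable lborel (gauss k)"
    unfolding gauss_eq_normal[OF assms, abs_def] using assms by auto
  then show ?thesis by simp
qed

text \<open>The characteristic function of the standard normal distribution is this transform up to
  the change of variable by the factor \<open>2 * pi / k\<close>.\<close>

lemma fourier_gauss:
  assumes "k > 0"
  shows "fourier (\<lambda>x. complex_of_real (gauss k x)) v = k * std_normal_density (k * v)"
proof -
  have "(\<integral>x. complex_of_real (std_normal_density x) * cis (k * v * x) \<partial>lborel)
        = char std_normal_distribution (k * v)"
    unfolding char_def
    by (subst integral_density) (auto simp: scaleR_conv_of_real cis_conv_exp mult_ac)
  also have "\<dots> = complex_of_real (exp (- ((k * v)\<^sup>2) / 2))"
    by (simp add: char_std_normal_distribution)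
  finally have *: "(\<integral>x. complex_of_real (std_normal_density x) * cis (k * v * x) \<partial>lborel)
    = complex_of_real (exp (- ((k * v)\<^sup>2) / 2))" .
  have "\<dots> = complex_of_real (2 * pi / k) * (\<integral>x. complex_of_real (std_normal_density (0 + 2 * pi / k * x)) * cis (k * v * (0 + 2 * pi / k * x)) \<partial>lborel)"
    using assms unfolding *[symmetric]
    by (subst lborel_integral_real_affine[where c = "2 * pi / k" and t = 0]) (auto simp: scaleR_conv_of_real)
  also have "(\<integral>x. complex_of_real (std_normal_density (0 + 2 * pi / k * x)) * cis (k * v * (0 + 2 * pi / k * x)) \<partial>lborel)
     = complex_of_real (1 / sqrt (2 * pi)) * fourier (\<lambda>x. complex_of_real (gauss k x)) v"
    unfolding fourier_def integral_mult_right_zero[symmetric] gauss_eq_normal[OF assms]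
    using assms by (intro Bochner_Integration.integral_cong refl) (auto simp: field_simps)
  finally have "fourier (\<lambda>x. complex_of_real (gauss k x)) v
      = complex_of_real (exp (- ((k * v)\<^sup>2) / 2)) * complex_of_real (k * sqrt (2 * pi) / (2 * pi))"
    using assms by (simp add: field_simps)
  also have "k * sqrt (2 * pi) / (2 * pi) = k * (1 / sqrt (2 * pi))"
    using sqrt_divide_self_eq[of "2 * pi"] by (metis inverse_eq_divide pi_ge_zero times_divide_eq_right zero_le_mult_iff zero_le_numeral)
  also have "complex_of_real (exp (- ((k * v)\<^sup>2) / 2)) * complex_of_real (k * (1 / sqrt (2 * pi)))
      = complex_of_real (k * std_normal_density (k * v))"
    unfolding std_normal_density_def of_real_mult[symmetric] by (simp add: mult_ac)
  finally show ?thesis .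
qed

section \<open>Gaussian averages as an approximate identity\<close>

lemma integral_std_normal: "(\<integral>z. std_normal_density z \<partial>lborel) = 1"
  using integral_std_normal_moment_even[of 0] by simp

lemma integrable_std_normal: "integrable lborel std_normal_density"
  using integrable_std_normal_moment[of 0] by simp

lemma gauss_scaled_subst:
  assumes "k > 0"
  shows "(\<integral>t. complex_of_real (k * std_normal_density (k * (y - t))) * g t \<partial>lborel)
    = (\<integral>z. complex_of_real (std_normal_density z) * g (y - z / k) \<partial>lborel)"
  using assms
  by (subst lborel_integral_real_affine[where c = "- (1 / k)" and t = y])
     (auto simp: scaleR_conv_of_real integral_mult_right_zero[symmetric] simp del: integral_mult_right_zero)

text \<open>After \<open>gauss_scaled_subst\<close> the scale sits in the argument of
  \<open>g\<close> and no longer in the kernel, so \<open>B\<close> times the normal density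
  dominates for all \<open>n\<close>.\<close>

lemma gauss_approx_identity_bounded:
  fixes g :: "real \<Rightarrow> complex"
  assumes [measurable]: "g \<in> borel_measurable borel" and B: "\<And>x. norm (g x) \<le> B"
    and cont: "isCont g y"
  shows "(\<lambda>n. \<integral>t. complex_of_real (real (Suc n) * std_normal_density (real (Suc n) * (y - t))) * g t \<partial>lborel)
         \<longlonglongrightarrow> g y"
proof -
  have "(\<lambda>n. \<integral>z. complex_of_real (std_normal_density z) * g (y - z / real (Suc n)) \<partial>lborel)
      \<longlonglongrightarrow> (\<integral>z. complex_of_real (std_normal_density z) * g y \<partial>lborel)"
  proof (rule integral_dominated_convergence[where w = "\<lambda>z. B * std_normal_density z"])
    show "integrable lborel (\<lambda>z. B * std_normal_density z)" using integrable_std_normal by auto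
    show "AE z in lborel. norm (complex_of_real (std_normal_density z) * g (y - z / real (Suc n))) \<le> B * std_normal_density z" for n
    proof (rule AE_I2)
      fix z
      show "norm (complex_of_real (std_normal_density z) * g (y - z / real (Suc n))) \<le> B * std_normal_density z"
        using mult_right_mono[OF B[of "y - z / real (Suc n)"], of "std_normal_density z"]
        by (simp add: norm_mult mult.commute)
    qed
    show "AE z in lborel. (\<lambda>n. complex_of_real (std_normal_density z) * g (y - z / real (Suc n)))
        \<longlonglongrightarrow> complex_of_real (std_normal_density z) * g y"
    proof (intro AE_I2 tendsto_mult tendsto_const)
      fix z
      have "(\<lambda>n. y - z / real (Suc n)) \<longlonglongrightarrow> y - 0"
        by (intro tendsto_intros LIMSEQ_Suc lim_const_over_n)
      then have "(\<lambda>n. y - z / real (Suc n)) \<longlonglongrightarrow> y" by simp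
      then show "(\<lambda>n. g (y - z / real (Suc n))) \<longlonglongrightarrow> g y"
        using isCont_tendsto_compose[OF cont] by blast
    qed
  qed auto
  moreover have "(\<integral>z. complex_of_real (std_normal_density z) * g y \<partial>lborel) = g y"
    by (simp only: integral_mult_left_zero integral_complex_of_real integral_std_normal) simp
  ultimately show ?thesis by (subst gauss_scaled_subst) auto
qed

text \<open>An integrable continuous \<open>f\<close> may be unbounded, so it is cut at distance 1
  from \<open>y\<close>: the near part falls under the bounded case, and on the far part the kernel
  is at most 1/k, because k^2 exp(-k^2/2) is at most 2.\<close>

lemma gauss_approx_identity_integrable:
  fixes f :: "real \<Rightarrow> complex"
  assumes f: "integrable lborel f" and cont: "continuous_on UNIV f"
  shows "(\<lambda>n. \<integral>t. complex_of_real (real (Suc n) * std_normal_density (real (Suc n) * (y - t))) * f t \<partial>lborel)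
         \<longlonglongrightarrow> f y"
proof -
  let ?I = "{y - 1..y + 1}"
  let ?K = "\<lambda>n t. complex_of_real (real (Suc n) * std_normal_density (real (Suc n) * (y - t)))"
  define g where "g t = (if t \<in> ?I then f t else 0)" for t
  define h where "h t = (if t \<in> ?I then 0 else f t)" for t
  have [measurable]: "f \<in> borel_measurable borel" using f by auto
  have [measurable]: "g \<in> borel_measurable borel" "h \<in> borel_measurable borel"
    unfolding g_def h_def by measurable
  have "compact (f ` ?I)"
    by (intro compact_continuous_image continuous_on_subset[OF cont]) auto
  then obtain B0 where B0: "\<And>t. t \<in> ?I \<Longrightarrow> norm (f t) \<le> B0"
    using bounded_iff compact_imp_bounded by (metis imageI)
  then have B: "norm (g t) \<le> max B0 0" for t
    unfolding g_def using le_max_iff_disj by auto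
  have "isCont g y"
  proof -
    have "eventually (\<lambda>t. t \<in> {y - 1<..<y + 1}) (nhds y)"
      by (rule eventually_nhds_in_open) auto
    then have "eventually (\<lambda>t. g t = f t) (nhds y)"
      by eventually_elim (auto simp: g_def)
    moreover have "isCont f y" using cont by (simp add: continuous_on_eq_continuous_at)
    ultimately show ?thesis using isCont_cong by blast
  qed
  from gauss_approx_identity_bounded[OF _ B this]
  have 1: "(\<lambda>n. \<integral>t. ?K n t * g t \<partial>lborel) \<longlonglongrightarrow> f y" by (simp add: g_def)
  have bnd: "norm (?K n t * h t) \<le> 1 / real (Suc n) * norm (f t)" for n t
  proof (cases "t \<in> ?I")
    case True then show ?thesis by (simp add: h_def)
  next
    case False
    define k where "k = real (Suc n)"
    have k: "k \<ge> 1" by (simp add: k_def)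
    have "1 \<le> (y - t)\<^sup>2"
    proof -
      have "1 \<le> \<bar>y - t\<bar>" using False by auto
      from power_mono[OF this, of 2] show ?thesis by simp
    qed
    then have "k\<^sup>2 * 1 \<le> k\<^sup>2 * (y - t)\<^sup>2" by (intro mult_left_mono) auto
    then have 2: "exp (- (k * (y - t))\<^sup>2 / 2) \<le> exp (- k\<^sup>2 / 2)"
      by (simp add: power_mult_distrib)
    have "1 / sqrt (2 * pi) \<le> 1 / 2"
      by (rule divide_left_mono) (use pi_ge_two real_le_rsqrt[of 2 "2 * pi"] in auto)
    with 2 have 3: "std_normal_density (k * (y - t)) \<le> 1 / 2 * exp (- k\<^sup>2 / 2)"
      unfolding std_normal_density_def by (intro mult_mono) auto
    have "k\<^sup>2 / 2 \<le> exp (k\<^sup>2 / 2)" using exp_ge_add_one_self[of "k\<^sup>2 / 2"] by linarith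
    then have "k\<^sup>2 * exp (- k\<^sup>2 / 2) \<le> 2"
      by (simp add: exp_minus field_simps)
    then have "k * (1 / 2 * exp (- k\<^sup>2 / 2)) \<le> 1 / k"
      using k by (simp add: field_simps power2_eq_square)
    then have "k * std_normal_density (k * (y - t)) \<le> 1 / k"
      using 3 k by (smt (verit) mult_left_mono)
    then have "k * std_normal_density (k * (y - t)) * norm (f t) \<le> 1 / k * norm (f t)"
      by (intro mult_right_mono) auto
    moreover have "norm (?K n t * h t) = k * std_normal_density (k * (y - t)) * norm (f t)"
    proof -
      have "h t = f t" using False unfolding h_def by (rule if_not_P)
      then show ?thesis using k unfolding k_def[symmetric] by (simp add: norm_mult)
    qed
    ultimately show ?thesis by (simp add: k_def)
  qed
  have inth: "integrable lborel (\<lambda>t. ?K n t * h t)" for n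
    by (rule Bochner_Integration.integrable_bound[of _ "\<lambda>t. 1 / real (Suc n) * norm (f t)"])
       (use f bnd[of n] in \<open>auto simp del: of_nat_Suc\<close>)
  have intg: "integrable lborel (\<lambda>t. ?K n t * g t)" for n
  proof -
    have 0: "integrable lborel (\<lambda>t. std_normal_density (real (Suc n) * y + (- real (Suc n)) * t))"
      by (rule lborel_integrable_real_affine[OF integrable_std_normal]) auto
    have "integrable lborel (\<lambda>t. complex_of_real (real (Suc n) * std_normal_density (real (Suc n) * y + (- real (Suc n)) * t)))"
      by (intro integrable_of_real integrable_mult_right 0)
    moreover have "real (Suc n) * y + (- real (Suc n)) * t = real (Suc n) * (y - t)" for t
      by (simp add: algebra_simps)
    ultimately have "integrable lborel (?K n)" by (simp only:)
    then show ?thesis by (rule integrable_mult_bounded[OF _ _ B]) auto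
  qed
  have 2: "(\<lambda>n. \<integral>t. ?K n t * h t \<partial>lborel) \<longlonglongrightarrow> 0"
  proof (rule Lim_null_comparison)
    show "eventually (\<lambda>n. norm (\<integral>t. ?K n t * h t \<partial>lborel) \<le> (\<integral>t. norm (f t) \<partial>lborel) / real (Suc n)) sequentially"
    proof (rule always_eventually, rule allI)
      fix n
      have "norm (\<integral>t. ?K n t * h t \<partial>lborel) \<le> (\<integral>t. 1 / real (Suc n) * norm (f t) \<partial>lborel)"
        by (rule Bochner_Integration.integral_norm_bound_integral) (use f inth bnd in auto)
      then show "norm (\<integral>t. ?K n t * h t \<partial>lborel) \<le> (\<integral>t. norm (f t) \<partial>lborel) / real (Suc n)"
        by (simp only: integral_mult_right_zero) simp
    qed
    show "(\<lambda>n. (\<integral>t. norm (f t) \<partial>lborel) / real (Suc n)) \<longlonglongrightarrow> 0"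
      by (rule LIMSEQ_Suc[OF lim_const_over_n])
  qed
  have "(\<integral>t. ?K n t * f t \<partial>lborel) = (\<integral>t. ?K n t * g t \<partial>lborel) + (\<integral>t. ?K n t * h t \<partial>lborel)" for n
    by (subst Bochner_Integration.integral_add[OF intg inth, symmetric])
       (intro Bochner_Integration.integral_cong refl, auto simp: g_def h_def)
  then show ?thesis using tendsto_add[OF 1 2] by simp
qed

lemma gauss_tendsto_1: "(\<lambda>n. gauss (real (Suc n)) x) \<longlonglongrightarrow> 1"
proof -
  have "(\<lambda>n. exp (- (2 * pi\<^sup>2 * x\<^sup>2 * (inverse (real (Suc n)))\<^sup>2))) \<longlonglongrightarrow> exp (- (2 * pi\<^sup>2 * x\<^sup>2 * 0\<^sup>2))"
    by (intro tendsto_intros LIMSEQ_inverse_real_of_nat)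
  then show ?thesis by (simp add: gauss_def field_simps)
qed

lemma gauss_mono: "k > 0 \<Longrightarrow> k \<le> k' \<Longrightarrow> gauss k x \<le> gauss k' x"
  unfolding gauss_def
  by (auto intro!: divide_left_mono power_mono mult_pos_pos)

lemma integral_gauss_cis_fourier:
  assumes f: "integrable lborel f" and k: "k > 0"
  shows "(\<integral>x. complex_of_real (gauss k x) * cis (2 * pi * x * u) * fourier f x \<partial>lborel)
     = (\<integral>t. complex_of_real (k * std_normal_density (k * (t + u))) * f t \<partial>lborel)"
  by (subst integral_fourier_swap[OF f integrable_mult_cis[OF integrable_gauss[OF k]]])
     (simp only: fourier_modulation fourier_gauss[OF k])

text \<open>The exponent has the same sign in both directions, so the inverse appears as the
  transform of the reflected transform. The Gaussian-damped integral has two limits: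
  \<open>f x\<close> by the approximate identity, and the undamped integral by dominated
  convergence.\<close>

theorem fourier_inversion:
  assumes f: "integrable lborel f" and cont: "continuous_on UNIV f"
    and int: "integrable lborel (\<lambda>t. fourier f (- t))"
  shows "fourier (\<lambda>t. fourier f (- t)) x = f x"
proof (rule LIMSEQ_unique)
  have f': "integrable lborel (\<lambda>x. f (- x))"
    using lborel_integrable_real_affine[OF f, of "-1" 0] by simp
  have refl: "fourier f (- t) = fourier (\<lambda>x. f (- x)) t" for t
    by (simp add: fourier_reflect)
  let ?a = "\<lambda>n. \<integral>t. complex_of_real (gauss (real (Suc n)) t) * cis (2 * pi * t * x) * fourier f (- t) \<partial>lborel"
  have "?a n = (\<integral>t. complex_of_real (real (Suc n) * std_normal_density (real (Suc n) * (x - t))) * f t \<partial>lborel)" for n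
    unfolding refl
    apply (subst integral_gauss_cis_fourier[OF f'])
     apply simp
    apply (subst lborel_integral_real_affine[where c = "-1" and t = 0])
     apply simp
    apply simp
    done
  then show "?a \<longlonglongrightarrow> f x"
    using gauss_approx_identity_integrable[OF f cont, of x] by simp
  show "?a \<longlonglongrightarrow> fourier (\<lambda>t. fourier f (- t)) x"
    unfolding fourier_def[of "\<lambda>t. fourier f (- t)"]
  proof (rule integral_dominated_convergence[where w = "\<lambda>t. norm (fourier f (- t))"])
    show "integrable lborel (\<lambda>t. norm (fourier f (- t)))" using int by auto
    have [measurable]: "fourier f \<in> borel_measurable borel" by (rule measurable_fourier[OF f])
    show "(\<lambda>t. fourier f (- t) * cis (2 * pi * t * x)) \<in> borel_measurable lborel" by measurable
    show "(\<lambda>t. complex_of_real (gauss (real (Suc n)) t) * cis (2 * pi * t * x) * fourier f (- t)) \<in> borel_measurable lborel" for n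
      by measurable
    show "AE t in lborel. norm (complex_of_real (gauss (real (Suc n)) t) * cis (2 * pi * t * x) * fourier f (- t)) \<le> norm (fourier f (- t))" for n
      using gauss_bounds[of "real (Suc n)"]
      by (intro AE_I2) (simp add: norm_mult abs_of_pos mult_left_le_one_le less_imp_le del: of_nat_Suc)
    show "AE t in lborel. (\<lambda>n. complex_of_real (gauss (real (Suc n)) t) * cis (2 * pi * t * x) * fourier f (- t))
            \<longlonglongrightarrow> fourier f (- t) * cis (2 * pi * t * x)"
    proof (rule AE_I2)
      fix t
      have "(\<lambda>n. complex_of_real (gauss (real (Suc n)) t) * cis (2 * pi * t * x) * fourier f (- t))
          \<longlonglongrightarrow> complex_of_real 1 * cis (2 * pi * t * x) * fourier f (- t)"
        by (intro tendsto_intros gauss_tendsto_1)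
      then show "(\<lambda>n. complex_of_real (gauss (real (Suc n)) t) * cis (2 * pi * t * x) * fourier f (- t))
            \<longlonglongrightarrow> fourier f (- t) * cis (2 * pi * t * x)" by (simp add: mult.commute)
    qed
  qed
qed

section \<open>Plancherel's theorem for compactly supported functions\<close>

text \<open>Continuity is asked only within the closed interval. Jumps at \<open>-A\<close> and
  \<open>A\<close> are allowed, since constants and eigenfunctions need not vanish there.\<close>

definition cpt_fun :: "real \<Rightarrow> (real \<Rightarrow> 'a::{real_normed_vector}) \<Rightarrow> bool" where
  "cpt_fun A g \<longleftrightarrow> continuous_on {-A..A} g \<and> (\<forall>x. x \<notin> {-A..A} \<longrightarrow> g x = 0)"

lemma cpt_fun_borel:
  fixes g :: "real \<Rightarrow> 'a::{second_countable_topology, real_normed_vector}"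
  assumes "cpt_fun A g" shows "g \<in> borel_measurable borel"
proof -
  have "(\<lambda>x. indicator {-A..A} x *\<^sub>R g x) \<in> borel_measurable borel"
    by (rule borel_measurable_continuous_on_indicator) (use assms in \<open>auto simp: cpt_fun_def\<close>)
  also have "(\<lambda>x. indicator {-A..A} x *\<^sub>R g x) = g"
    using assms by (auto simp: cpt_fun_def indicator_def)
  finally show ?thesis .
qed

lemma cpt_fun_bounded:
  fixes g :: "real \<Rightarrow> 'a::{real_normed_vector}"
  assumes "cpt_fun A g" obtains B where "B > 0" "\<And>x. norm (g x) \<le> B"
proof -
  have "compact (g ` {-A..A})"
    by (intro compact_continuous_image) (use assms in \<open>auto simp: cpt_fun_def\<close>)
  then obtain B0 where B0: "\<And>t. t \<in> {-A..A} \<Longrightarrow> norm (g t) \<le> B0"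
    using bounded_iff compact_imp_bounded by (metis imageI)
  have "norm (g t) \<le> max B0 1" for t
    using assms B0[of t] unfolding cpt_fun_def by (cases "t \<in> {-A..A}") auto
  then show ?thesis by (intro that[of "max B0 1"]) auto
qed

lemma cpt_fun_integrable:
  fixes g :: "real \<Rightarrow> 'a::{second_countable_topology, banach}"
  assumes "cpt_fun A g" shows "integrable lborel g"
proof -
  have "set_integrable lborel {-A..A} g"
    by (rule borel_integrable_atLeastAtMost') (use assms in \<open>auto simp: cpt_fun_def\<close>)
  then have "integrable lborel (\<lambda>x. indicator {-A..A} x *\<^sub>R g x)"
    by (simp add: set_integrable_def)
  also have "(\<lambda>x. indicator {-A..A} x *\<^sub>R g x) = g"
    using assms by (auto simp: cpt_fun_def indicator_def)
  finally show ?thesis .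
qed

lemma cpt_fun_isCont:
  assumes "cpt_fun A g" "x \<noteq> A" "x \<noteq> -A" shows "isCont g x"
proof (cases "x \<in> {-A<..<A}")
  case True
  then have "x \<in> interior {-A..A}" by auto
  then show ?thesis
    using assms(1) unfolding cpt_fun_def by (metis continuous_on_interior)
next
  case False
  have "open (- {-A..A})" "x \<in> - {-A..A}" using False assms by auto
  then have "eventually (\<lambda>t. t \<in> - {-A..A}) (nhds x)"
    by (rule eventually_nhds_in_open)
  then have "eventually (\<lambda>t. g t = 0) (nhds x)"
    by eventually_elim (use assms in \<open>auto simp: cpt_fun_def\<close>)
  then show ?thesis using isCont_cong[of g "\<lambda>_. 0"] by auto
qed

text \<open>One factor of the squared modulus is moved off the frequency side by
  \<open>integral_fourier_swap\<close>; the transform of what remains is a Gaussian average of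
  \<open>cnj g\<close>. The shift \<open>u\<close> serves Plancherel (\<open>u = 0\<close>) and the
  autocorrelation at once.\<close>

lemma integral_norm2_fourier_gauss_cis:
  assumes g: "integrable lborel g" and k: "k > 0"
  shows "(\<integral>x. complex_of_real (gauss k x * (norm (fourier g x))\<^sup>2) * cis (2 * pi * x * u) \<partial>lborel)
    = (\<integral>s. (\<integral>t. complex_of_real (k * std_normal_density (k * (s + u - t))) * cnj (g t) \<partial>lborel) * g s \<partial>lborel)"
proof -
  let ?h = "\<lambda>x. complex_of_real (gauss k x) * cnj (fourier g x) * cis (2 * pi * x * u)"
  have g': "integrable lborel (\<lambda>x. cnj (g (- x)))"
    using lborel_integrable_real_affine[OF g, of "-1" 0] by simp
  have [measurable]: "fourier g \<in> borel_measurable borel"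
    by (rule measurable_fourier[OF g])
  have h0: "integrable lborel (\<lambda>x. complex_of_real (gauss k x) * cnj (fourier g x))"
    by (rule integrable_mult_bounded[OF integrable_gauss[OF k], where B = "\<integral>x. norm (g x) \<partial>lborel"])
       (use norm_fourier_le[of g] in auto)
  have h: "integrable lborel ?h" by (rule integrable_mult_cis[OF h0])
  have "(\<integral>x. complex_of_real (gauss k x * (norm (fourier g x))\<^sup>2) * cis (2 * pi * x * u) \<partial>lborel)
      = (\<integral>x. ?h x * fourier g x \<partial>lborel)"
    by (intro Bochner_Integration.integral_cong refl)
       (simp add: mult_ac complex_norm_square[symmetric] del: of_real_power)
  also have "\<dots> = (\<integral>s. fourier ?h s * g s \<partial>lborel)"
    by (rule integral_fourier_swap[OF g h])
  also have "\<dots> = (\<integral>s. (\<integral>t. complex_of_real (k * std_normal_density (k * (s + u - t))) * cnj (g t) \<partial>lborel) * g s \<partial>lborel)"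
  proof (intro Bochner_Integration.integral_cong refl arg_cong2[where f = "(*)"])
    fix s
    have "fourier ?h s = (\<integral>x. complex_of_real (gauss k x) * cis (2 * pi * x * (s + u)) * fourier (\<lambda>x. cnj (g (- x))) x \<partial>lborel)"
      unfolding fourier_modulation cnj_fourier unfolding fourier_def[of "\<lambda>x. complex_of_real (gauss k x) * _ x"]
      by (intro Bochner_Integration.integral_cong refl) (simp add: mult_ac)
    also have "\<dots> = (\<integral>t. complex_of_real (k * std_normal_density (k * (t + (s + u)))) * cnj (g (- t)) \<partial>lborel)"
      by (rule integral_gauss_cis_fourier[OF g' k])
    also have "\<dots> = (\<integral>t. complex_of_real (k * std_normal_density (k * (s + u - t))) * cnj (g t) \<partial>lborel)"
      by (subst lborel_integral_real_affine[where c = "-1" and t = 0]) auto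
    finally show "fourier ?h s = (\<integral>t. complex_of_real (k * std_normal_density (k * (s + u - t))) * cnj (g t) \<partial>lborel)" .
  qed
  finally show ?thesis .
qed

lemma norm_gauss_convolution_le:
  assumes [measurable]: "g \<in> borel_measurable borel" and B: "\<And>x. norm (g x) \<le> B" and k: "k > 0"
  shows "norm (\<integral>t. complex_of_real (k * std_normal_density (k * (y - t))) * g t \<partial>lborel) \<le> B"
proof -
  have b: "norm (complex_of_real (std_normal_density z) * g (y - z / k)) \<le> B * std_normal_density z" for z
    using mult_right_mono[OF B[of "y - z / k"], of "std_normal_density z"]
    by (simp add: norm_mult mult.commute)
  have "norm (\<integral>z. complex_of_real (std_normal_density z) * g (y - z / k) \<partial>lborel) \<le> (\<integral>z. B * std_normal_density z \<partial>lborel)"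
  proof (rule Bochner_Integration.integral_norm_bound_integral)
    show "integrable lborel (\<lambda>z. complex_of_real (std_normal_density z) * g (y - z / k))"
      by (rule integrable_mult_bounded[where B = B]) (use integrable_std_normal B in auto)
  qed (use integrable_std_normal b in auto)
  then show ?thesis unfolding gauss_scaled_subst[OF k] by (simp add: integral_std_normal)
qed

lemma tendsto_integral_norm2_fourier_gauss_cis:
  fixes g :: "real \<Rightarrow> complex"
  assumes g: "cpt_fun A g"
  shows "(\<lambda>n. \<integral>x. complex_of_real (gauss (real (Suc n)) x * (norm (fourier g x))\<^sup>2) * cis (2 * pi * x * u) \<partial>lborel)
     \<longlonglongrightarrow> (\<integral>s. cnj (g (s + u)) * g s \<partial>lborel)"
proof -
  have gi: "integrable lborel g" by (rule cpt_fun_integrable[OF g])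
  have [measurable]: "g \<in> borel_measurable borel" using gi by auto
  obtain B where B: "B > 0" "\<And>x. norm (g x) \<le> B" using cpt_fun_bounded[OF g] by blast
  let ?c = "\<lambda>n s. \<integral>t. complex_of_real (real (Suc n) * std_normal_density (real (Suc n) * (s + u - t))) * cnj (g t) \<partial>lborel"
  have "(\<lambda>n. \<integral>s. ?c n s * g s \<partial>lborel) \<longlonglongrightarrow> (\<integral>s. cnj (g (s + u)) * g s \<partial>lborel)"
  proof (rule integral_dominated_convergence[where w = "\<lambda>s. B * norm (g s)"])
    show "(\<lambda>s. cnj (g (s + u)) * g s) \<in> borel_measurable lborel" by measurable
    show "(\<lambda>s. ?c n s * g s) \<in> borel_measurable lborel" for n by measurable
    show "integrable lborel (\<lambda>s. B * norm (g s))" using gi by auto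
    show "AE s in lborel. norm (?c n s * g s) \<le> B * norm (g s)" for n
      unfolding norm_mult
      by (intro AE_I2 mult_right_mono norm_gauss_convolution_le) (use B in auto)
    \<comment> \<open>The shifted jumps are left out: there the averages tend to the mean of the
      one-sided limits, which need not be the value.\<close>
    have "AE s in lborel. s \<noteq> A - u \<and> s \<noteq> - A - u"
      by (intro AE_conjI AE_lborel_singleton)
    then show "AE s in lborel. (\<lambda>n. ?c n s * g s) \<longlonglongrightarrow> cnj (g (s + u)) * g s"
    proof eventually_elim
      case (elim s)
      have "isCont g (s + u)" by (rule cpt_fun_isCont[OF g]) (use elim in auto)
      then have "isCont (\<lambda>t. cnj (g t)) (s + u)" by (intro continuous_intros)
      then have "(\<lambda>n. ?c n s) \<longlonglongrightarrow> cnj (g (s + u))"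
        by (intro gauss_approx_identity_bounded[where B = B]) (use B in auto)
      then show ?case by (intro tendsto_mult tendsto_const)
    qed
  qed
  moreover have "(\<integral>x. complex_of_real (gauss (real (Suc n)) x * (norm (fourier g x))\<^sup>2) * cis (2 * pi * x * u) \<partial>lborel)
      = (\<integral>s. ?c n s * g s \<partial>lborel)" for n
    by (rule integral_norm2_fourier_gauss_cis[OF gi]) simp
  ultimately show ?thesis by simp
qed

text \<open>Square-integrability of the transform is not known beforehand. Since the damping factors
  increase to 1, monotone convergence delivers integrability and the value of the integral
  together.\<close>

lemma plancherel:
  fixes g :: "real \<Rightarrow> complex"
  assumes g: "cpt_fun A g"
  shows "integrable lborel (\<lambda>x. (norm (fourier g x))\<^sup>2)" (is ?I)
    and "(\<integral>x. (norm (fourier g x))\<^sup>2 \<partial>lborel) = (\<integral>x. (norm (g x))\<^sup>2 \<partial>lborel)"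
proof -
  have gi: "integrable lborel g" by (rule cpt_fun_integrable[OF g])
  have [measurable]: "fourier g \<in> borel_measurable borel"
    by (rule measurable_fourier[OF gi])
  let ?f = "\<lambda>n x. gauss (real (Suc n)) x * (norm (fourier g x))\<^sup>2"
  have "(\<lambda>n. complex_of_real (\<integral>x. ?f n x \<partial>lborel)) \<longlonglongrightarrow> complex_of_real (\<integral>x. (norm (g x))\<^sup>2 \<partial>lborel)"
  proof -
    have "(\<lambda>n. \<integral>x. complex_of_real (?f n x) \<partial>lborel) \<longlonglongrightarrow> (\<integral>x. complex_of_real ((norm (g x))\<^sup>2) \<partial>lborel)"
      using tendsto_integral_norm2_fourier_gauss_cis[OF g, of 0]
      by (simp only: complex_norm_square mult.commute[of _ "cnj _"] mult_zero_right cis_zero mult_1_right add_0_right)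
    then show ?thesis by (simp only: integral_complex_of_real)
  qed
  then have lim: "(\<lambda>n. \<integral>x. ?f n x \<partial>lborel) \<longlonglongrightarrow> (\<integral>x. (norm (g x))\<^sup>2 \<partial>lborel)"
    by (simp only: tendsto_of_real_iff)
  have fi: "integrable lborel (?f n)" for n
  proof -
    have "integrable lborel (\<lambda>x. complex_of_real (gauss (real (Suc n)) x) * complex_of_real ((norm (fourier g x))\<^sup>2))"
      by (rule integrable_mult_bounded[OF integrable_gauss, where B = "(\<integral>x. norm (g x) \<partial>lborel)\<^sup>2"])
         (use norm_fourier_le[of g] in \<open>auto intro!: power_mono simp: norm_power\<close>)
    then show ?thesis by (simp only: of_real_mult[symmetric] complex_of_real_integrable_eq)
  qed
  have mono: "AE x in lborel. mono (\<lambda>n. ?f n x)"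
    by (auto simp: mono_def intro!: mult_right_mono gauss_mono)
  have ptw: "AE x in lborel. (\<lambda>n. ?f n x) \<longlonglongrightarrow> (norm (fourier g x))\<^sup>2"
  proof (rule AE_I2)
    fix x
    have "(\<lambda>n. ?f n x) \<longlonglongrightarrow> 1 * (norm (fourier g x))\<^sup>2"
      by (intro tendsto_intros gauss_tendsto_1)
    then show "(\<lambda>n. ?f n x) \<longlonglongrightarrow> (norm (fourier g x))\<^sup>2" by simp
  qed
  have m: "(\<lambda>x. (norm (fourier g x))\<^sup>2) \<in> borel_measurable lborel" by measurable
  show ?I by (rule integrable_monotone_convergence[OF fi mono ptw lim m])
  show "(\<integral>x. (norm (fourier g x))\<^sup>2 \<partial>lborel) = (\<integral>x. (norm (g x))\<^sup>2 \<partial>lborel)"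
    by (rule integral_monotone_convergence[OF fi mono ptw lim m])
qed

text \<open>The transform of the energy density is the autocorrelation. \<open>plancherel\<close>
  supplies the majorant under which the Gaussian factor can be removed.\<close>

lemma fourier_norm2_fourier:
  fixes g :: "real \<Rightarrow> complex"
  assumes g: "cpt_fun A g"
  shows "fourier (\<lambda>x. complex_of_real ((norm (fourier g x))\<^sup>2)) u = (\<integral>s. cnj (g (s + u)) * g s \<partial>lborel)"
proof (rule LIMSEQ_unique[OF _ tendsto_integral_norm2_fourier_gauss_cis[OF g]])
  have gi: "integrable lborel g" by (rule cpt_fun_integrable[OF g])
  have [measurable]: "fourier g \<in> borel_measurable borel"
    by (rule measurable_fourier[OF gi])
  let ?f = "\<lambda>n x. complex_of_real (gauss (real (Suc n)) x * (norm (fourier g x))\<^sup>2) * cis (2 * pi * x * u)"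
  show "(\<lambda>n. \<integral>x. ?f n x \<partial>lborel) \<longlonglongrightarrow> fourier (\<lambda>x. complex_of_real ((norm (fourier g x))\<^sup>2)) u"
    unfolding fourier_def[of "\<lambda>x. complex_of_real ((norm (fourier g x))\<^sup>2)"]
  proof (rule integral_dominated_convergence[where w = "\<lambda>x. (norm (fourier g x))\<^sup>2"])
    show "integrable lborel (\<lambda>x. (norm (fourier g x))\<^sup>2)" by (rule plancherel[OF g])
    show "AE x in lborel. norm (?f n x) \<le> (norm (fourier g x))\<^sup>2" for n
      using gauss_bounds[of "real (Suc n)"]
      by (intro AE_I2) (simp add: norm_mult norm_power abs_of_pos mult_left_le_one_le less_imp_le del: of_nat_Suc)
    show "AE x in lborel. (\<lambda>n. ?f n x) \<longlonglongrightarrow> complex_of_real ((norm (fourier g x))\<^sup>2) * cis (2 * pi * x * u)"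
    proof (rule AE_I2)
      fix x
      have "(\<lambda>n. ?f n x) \<longlonglongrightarrow> complex_of_real (1 * (norm (fourier g x))\<^sup>2) * cis (2 * pi * x * u)"
        by (intro tendsto_intros gauss_tendsto_1)
      then show "(\<lambda>n. ?f n x) \<longlonglongrightarrow> complex_of_real ((norm (fourier g x))\<^sup>2) * cis (2 * pi * x * u)" by simp
    qed
  qed measurable
qed

text \<open>At \<open>x = 0\<close> the quotient is 0 by the convention for division while the
  transform is 1, so the identity is applied off a null set.\<close>

lemma fourier_box:
  assumes "x \<noteq> 0"
  shows "fourier (\<lambda>u. indicator {-1..1} u / 2) x = complex_of_real (sin (2 * pi * x) / (2 * pi * x))"
proof -
  have nz: "2 * pi * x \<noteq> 0" using assms by simp
  have "((\<lambda>u. cis (2 * pi * u * x) / 2) has_integral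
      (cis (2 * pi * 1 * x) / (2 * \<i> * complex_of_real (2 * pi * x)) - cis (2 * pi * (-1) * x) / (2 * \<i> * complex_of_real (2 * pi * x)))) {-1..1}"
  proof (rule fundamental_theorem_of_calculus)
    fix u :: real assume "u \<in> {-1..1}"
    have "((\<lambda>z. exp (\<i> * (2 * pi * x) * z) / (2 * \<i> * complex_of_real (2 * pi * x))) has_field_derivative
        exp (\<i> * (2 * pi * x) * complex_of_real u) / 2) (at (complex_of_real u))"
      using nz by (auto intro!: derivative_eq_intros)
    from has_vector_derivative_real_field[OF this, of "{-1..1}"]
    show "((\<lambda>u. cis (2 * pi * u * x) / (2 * \<i> * complex_of_real (2 * pi * x))) has_vector_derivative
        cis (2 * pi * u * x) / 2) (at u within {-1..1})"
      by (simp add: cis_conv_exp o_def mult_ac)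
  qed simp
  moreover have "set_integrable lborel {-1..1} (\<lambda>u. cis (2 * pi * u * x) / 2)"
    by (intro borel_integrable_atLeastAtMost' continuous_intros) auto
  ultimately have "(LBINT u:{-1..1}. cis (2 * pi * u * x) / 2) =
     (cis (2 * pi * 1 * x) / (2 * \<i> * complex_of_real (2 * pi * x)) - cis (2 * pi * (-1) * x) / (2 * \<i> * complex_of_real (2 * pi * x)))"
    using set_borel_integral_eq_integral(2) by (metis integral_unique)
  moreover have "fourier (\<lambda>u. indicator {-1..1} u / 2) x = (LBINT u:{-1..1}. cis (2 * pi * u * x) / 2)"
    unfolding fourier_def set_lebesgue_integral_def
    by (intro Bochner_Integration.integral_cong refl) (auto simp: indicator_def)
  ultimately show ?thesis using nz by (auto simp: complex_eq_iff Re_divide Im_divide power2_eq_square)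
qed

section \<open>The quadratic form on the Fourier side\<close>

definition box_op :: "(real \<Rightarrow> real) \<Rightarrow> real \<Rightarrow> real" where
  "box_op g s = (\<integral>t. indicator {s-1..s+1} t * g t \<partial>lborel) / 2"

definition box_form :: "(real \<Rightarrow> real) \<Rightarrow> real" where
  "box_form g = (\<integral>s. g s * box_op g s \<partial>lborel)"

definition sqnorm :: "(real \<Rightarrow> real) \<Rightarrow> real" where
  "sqnorm g = (\<integral>s. (g s)\<^sup>2 \<partial>lborel)"

text \<open>The value at 0 is 0, exactly as for the quotient in \<open>W\<close>, so
  \<open>W x = 1 - sinc2 x\<close> holds at every \<open>x\<close>; the price is a discontinuity at
  0.\<close>

definition sinc2 :: "real \<Rightarrow> real" where
  "sinc2 x = sin (2 * pi * x) / (2 * pi * x)"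

lemma measurable_sinc2 [measurable]: "sinc2 \<in> borel_measurable borel"
  unfolding sinc2_def[abs_def] by measurable

lemma abs_sinc2_le: "\<bar>sinc2 x\<bar> \<le> 1"
  using abs_sin_le_one abs_sin_x_le_abs_x[of "2 * pi * x"]
  by (cases "x = 0") (auto simp: sinc2_def abs_mult divide_le_eq)

lemma integrable_mult_sinc2:
  assumes "integrable lborel f" shows "integrable lborel (\<lambda>x. f x * sinc2 x)"
proof (rule Bochner_Integration.integrable_bound[OF assms])
  show "(\<lambda>x. f x * sinc2 x) \<in> borel_measurable lborel" using assms by measurable
  show "AE x in lborel. norm (f x * sinc2 x) \<le> norm (f x)"
    using abs_sinc2_le by (intro AE_I2) (simp add: abs_mult mult_left_le)
qed

lemma cpt_fun_integrable_mult_bounded: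
  fixes g h :: "real \<Rightarrow> real"
  assumes "cpt_fun A g" and [measurable]: "h \<in> borel_measurable borel" and B: "\<And>x. \<bar>h x\<bar> \<le> B"
  shows "integrable lborel (\<lambda>x. g x * h x)"
proof (rule Bochner_Integration.integrable_bound)
  have gi: "integrable lborel g" by (rule cpt_fun_integrable[OF assms(1)])
  then show "integrable lborel (\<lambda>x. B * g x)" by auto
  show "(\<lambda>x. g x * h x) \<in> borel_measurable lborel" using gi by measurable
  have "\<bar>h x\<bar> * \<bar>g x\<bar> \<le> \<bar>B\<bar> * \<bar>g x\<bar>" for x
    using B[of x] by (intro mult_right_mono) auto
  then show "AE x in lborel. norm (g x * h x) \<le> norm (B * g x)"
    by (auto simp: abs_mult mult.commute)
qed

lemma box_op_measurable [measurable]: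
  assumes "cpt_fun A g" shows "box_op g \<in> borel_measurable borel"
proof -
  have [measurable]: "g \<in> borel_measurable borel" using cpt_fun_borel[OF assms] .
  have "(\<lambda>s. (\<integral>t. (if s - 1 \<le> t \<and> t \<le> s + 1 then g t else 0) \<partial>lborel) / 2) \<in> borel_measurable borel"
    by measurable
  moreover have "box_op g = (\<lambda>s. (\<integral>t. (if s - 1 \<le> t \<and> t \<le> s + 1 then g t else 0) \<partial>lborel) / 2)"
    unfolding box_op_def
    by (intro ext arg_cong2[where f = "(/)"] Bochner_Integration.integral_cong refl) (auto simp: indicator_def)
  ultimately show ?thesis by simp
qed

lemma integrable_indicator_mult:
  fixes g :: "real \<Rightarrow> real"
  assumes "integrable lborel g"
  shows "integrable lborel (\<lambda>t. indicator {a..b} t * g t)"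
  using integrable_mult_indicator[OF _ assms, of "{a..b}"] by simp

lemma box_op_bounded:
  assumes "cpt_fun A g" shows "\<bar>box_op g s\<bar> \<le> (\<integral>t. \<bar>g t\<bar> \<partial>lborel) / 2"
proof -
  have gi: "integrable lborel g" by (rule cpt_fun_integrable[OF assms(1)])
  have "norm (\<integral>t. indicator {s-1..s+1} t * g t \<partial>lborel) \<le> (\<integral>t. \<bar>g t\<bar> \<partial>lborel)"
    by (rule Bochner_Integration.integral_norm_bound_integral)
       (use gi integrable_indicator_mult[OF gi] in \<open>auto simp: abs_mult indicator_def\<close>)
  then show ?thesis by (simp add: box_op_def)
qed

lemma cpt_fun_Re: "cpt_fun A g \<Longrightarrow> cpt_fun A (\<lambda>x. Re (g x))"
  and cpt_fun_Im: "cpt_fun A g \<Longrightarrow> cpt_fun A (\<lambda>x. Im (g x))"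
  by (auto simp: cpt_fun_def intro!: continuous_intros)

lemma cpt_fun_of_real: "cpt_fun A g \<Longrightarrow> cpt_fun A (\<lambda>x. complex_of_real (g x))"
  by (auto simp: cpt_fun_def intro!: continuous_intros)

text \<open>With \<open>sinc2\<close> written as a transform, the swap formula produces the
  autocorrelation of \<open>g\<close> averaged over shifts in \<open>{-1..1}\<close>, and Fubini
  collects the shifts into \<open>box_op\<close>. The kernel is real, so the terms mixing real and
  imaginary parts of \<open>g\<close> are purely imaginary and vanish on taking real parts. From
  here on real functions suffice.\<close>

lemma integral_sinc2_norm2_fourier:
  fixes g :: "real \<Rightarrow> complex"
  assumes g: "cpt_fun A g"
  shows "(\<integral>x. (norm (fourier g x))\<^sup>2 * sinc2 x \<partial>lborel) = box_form (\<lambda>x. Re (g x)) + box_form (\<lambda>x. Im (g x))"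
proof -
  have gi: "integrable lborel g" by (rule cpt_fun_integrable[OF g])
  have [measurable]: "g \<in> borel_measurable borel" using gi by auto
  obtain B where B: "B > 0" "\<And>x. norm (g x) \<le> B" using cpt_fun_bounded[OF g] by blast
  let ?b = "\<lambda>u::real. (indicator {-1..1} u / 2 :: complex)"
  let ?P = "\<lambda>x. complex_of_real ((norm (fourier g x))\<^sup>2)"
  have "integrable lborel (\<lambda>u::real. complex_of_real (indicator {-1..1} u / 2))"
    by (intro integrable_of_real) simp
  moreover have "(\<lambda>u::real. complex_of_real (indicator {-1..1} u / 2)) = ?b"
    by (auto simp: indicator_def)
  ultimately have bi: "integrable lborel ?b" by (simp only:)
  have Pi: "integrable lborel ?P" using plancherel(1)[OF g] by (rule integrable_of_real)
  have [measurable]: "fourier g \<in> borel_measurable borel" "fourier ?b \<in> borel_measurable borel"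
    by (rule measurable_fourier[OF gi], rule measurable_fourier[OF bi])
  have "complex_of_real (\<integral>x. (norm (fourier g x))\<^sup>2 * sinc2 x \<partial>lborel)
       = (\<integral>x. ?P x * complex_of_real (sinc2 x) \<partial>lborel)"
    by (simp only: integral_complex_of_real[symmetric] of_real_mult)
  also have "\<dots> = (\<integral>x. ?P x * fourier ?b x \<partial>lborel)"
  proof (rule integral_cong_AE)
    have "AE x in lborel. x \<noteq> (0::real)" by (rule AE_lborel_singleton)
    then show "AE x in lborel. ?P x * complex_of_real (sinc2 x) = ?P x * fourier ?b x"
      by eventually_elim (simp add: fourier_box sinc2_def)
  qed measurable
  also have "\<dots> = (\<integral>u. fourier ?P u * ?b u \<partial>lborel)"
    by (rule integral_fourier_swap[OF bi Pi])
  also have "\<dots> = (\<integral>u. (\<integral>s. cnj (g (s + u)) * g s * ?b u \<partial>lborel) \<partial>lborel)"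
    unfolding fourier_norm2_fourier[OF g] by (simp only: integral_mult_left_zero)
  also have "\<dots> = (\<integral>s. (\<integral>u. cnj (g (s + u)) * g s * ?b u \<partial>lborel) \<partial>lborel)"
  proof (rule lborel_pair.Fubini_integral[symmetric], rule lborel_pair.Fubini_integrable)
    let ?k = "\<lambda>(u, s). cnj (g (s + u)) * g s * ?b u"
    show m: "?k \<in> borel_measurable (lborel \<Otimes>\<^sub>M lborel)" by measurable
    have i: "integrable lborel (\<lambda>s. ?k (u, s))" for u
    proof -
      have "integrable lborel (\<lambda>s. g s * (cnj (g (s + u)) * ?b u))"
        by (rule integrable_mult_bounded[OF gi, where B = "B * (1/2)"])
           (use B in \<open>auto simp: norm_mult indicator_def intro!: mult_mono\<close>)
      then show ?thesis by (simp add: mult_ac)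
    qed
    then show "AE u in lborel. integrable lborel (\<lambda>s. ?k (u, s))" by auto
    show "integrable lborel (\<lambda>u. \<integral>s. norm (?k (u, s)) \<partial>lborel)"
    proof (rule Bochner_Integration.integrable_bound)
      let ?w = "\<lambda>u::real. indicator {-1..1} u * (B * (\<integral>s. norm (g s) \<partial>lborel))"
      show "integrable lborel ?w" by simp
      show "(\<lambda>u. \<integral>s. norm (?k (u, s)) \<partial>lborel) \<in> borel_measurable lborel" by measurable
      show "AE u in lborel. norm (\<integral>s. norm (?k (u, s)) \<partial>lborel) \<le> norm (?w u)"
      proof (rule AE_I2)
        fix u :: real
        have "norm (?k (u, s)) \<le> indicator {-1..1} u * (B * norm (g s))" for s
        proof -
          have "norm (cnj (g (s + u))) * norm (g s) \<le> B * norm (g s)"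
            using B by (intro mult_right_mono) auto
          moreover have "0 \<le> B * norm (g s)" using B by simp
          ultimately show ?thesis by (auto simp: norm_mult indicator_def)
        qed
        then have "(\<integral>s. norm (?k (u, s)) \<partial>lborel) \<le> (\<integral>s. indicator {-1..1} u * (B * norm (g s)) \<partial>lborel)"
          by (intro integral_mono integrable_norm[OF i]) (use gi in auto)
        also have "\<dots> = ?w u" by simp
        finally show "norm (\<integral>s. norm (?k (u, s)) \<partial>lborel) \<le> norm (?w u)"
          by (simp add: abs_of_nonneg)
      qed
    qed
  qed
  finally have eq: "complex_of_real (\<integral>x. (norm (fourier g x))\<^sup>2 * sinc2 x \<partial>lborel)
     = (\<integral>s. (\<integral>u. cnj (g (s + u)) * g s * ?b u \<partial>lborel) \<partial>lborel)" .
  let ?r = "\<lambda>x. Re (g x)" and ?i = "\<lambda>x. Im (g x)"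
  have inner: "(\<integral>u. cnj (g (s + u)) * g s * ?b u \<partial>lborel)
     = g s * (complex_of_real (box_op ?r s) - \<i> * complex_of_real (box_op ?i s))" for s
  proof -
    have "(\<integral>u. cnj (g (s + u)) * g s * ?b u \<partial>lborel) = g s * (\<integral>u. ?b u * cnj (g (s + u)) \<partial>lborel)"
      unfolding integral_mult_right_zero[symmetric] by (intro Bochner_Integration.integral_cong refl) (simp add: mult_ac)
    also have "(\<integral>u. ?b u * cnj (g (s + u)) \<partial>lborel) = (\<integral>t. indicator {s-1..s+1} t / 2 * cnj (g t) \<partial>lborel)"
      by (subst lborel_integral_real_affine[where c = 1 and t = "-s"])
         (auto intro!: Bochner_Integration.integral_cong simp: indicator_def)
    also have "\<dots> = (\<integral>t. complex_of_real (indicator {s-1..s+1} t * ?r t / 2) - \<i> * complex_of_real (indicator {s-1..s+1} t * ?i t / 2) \<partial>lborel)"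
      by (intro Bochner_Integration.integral_cong refl) (auto simp: indicator_def complex_eq_iff)
    also have "\<dots> = complex_of_real (box_op ?r s) - \<i> * complex_of_real (box_op ?i s)"
    proof -
      have r: "integrable lborel (\<lambda>t. indicator {s-1..s+1} t * ?r t / 2)"
        using integrable_indicator_mult[OF cpt_fun_integrable[OF cpt_fun_Re[OF g]]] by simp
      have i: "integrable lborel (\<lambda>t. indicator {s-1..s+1} t * ?i t / 2)"
        using integrable_indicator_mult[OF cpt_fun_integrable[OF cpt_fun_Im[OF g]]] by simp
      show ?thesis
        apply (subst Bochner_Integration.integral_diff)
          apply (rule integrable_of_real[OF r])
         apply (rule integrable_mult_right[OF integrable_of_real[OF i]])
        apply (simp only: integral_complex_of_real integral_mult_right_zero box_op_def integral_divide_zero)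
        done
    qed
    finally show ?thesis .
  qed
  let ?h = "\<lambda>s. g s * (complex_of_real (box_op ?r s) - \<i> * complex_of_real (box_op ?i s))"
  note [measurable] = box_op_measurable[OF cpt_fun_Re[OF g]] box_op_measurable[OF cpt_fun_Im[OF g]]
  have hi: "integrable lborel ?h"
  proof (rule integrable_mult_bounded[OF gi])
    fix s
    have "norm (complex_of_real (box_op ?r s) - \<i> * complex_of_real (box_op ?i s)) \<le> \<bar>box_op ?r s\<bar> + \<bar>box_op ?i s\<bar>"
      by (rule order_trans[OF norm_triangle_ineq4]) (simp add: norm_mult)
    also have "\<dots> \<le> (\<integral>t. \<bar>?r t\<bar> \<partial>lborel) / 2 + (\<integral>t. \<bar>?i t\<bar> \<partial>lborel) / 2"
      by (intro add_mono box_op_bounded[OF cpt_fun_Re[OF g]] box_op_bounded[OF cpt_fun_Im[OF g]])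
    finally show "norm (complex_of_real (box_op ?r s) - \<i> * complex_of_real (box_op ?i s)) \<le> (\<integral>t. \<bar>?r t\<bar> \<partial>lborel) / 2 + (\<integral>t. \<bar>?i t\<bar> \<partial>lborel) / 2" .
  qed measurable
  have "(\<integral>x. (norm (fourier g x))\<^sup>2 * sinc2 x \<partial>lborel) = Re (\<integral>s. ?h s \<partial>lborel)"
    unfolding inner[symmetric] eq[symmetric] by simp
  also have "\<dots> = (\<integral>s. Re (?h s) \<partial>lborel)"
    by (rule integral_Re[OF hi, symmetric])
  also have "\<dots> = (\<integral>s. ?r s * box_op ?r s + ?i s * box_op ?i s \<partial>lborel)"
    by (intro Bochner_Integration.integral_cong refl) simp
  also have "\<dots> = box_form ?r + box_form ?i"
    unfolding box_form_def
    by (intro Bochner_Integration.integral_add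
        cpt_fun_integrable_mult_bounded[OF cpt_fun_Re[OF g] _ box_op_bounded[OF cpt_fun_Re[OF g]]]
        cpt_fun_integrable_mult_bounded[OF cpt_fun_Im[OF g] _ box_op_bounded[OF cpt_fun_Im[OF g]]]) measurable
  finally show ?thesis .
qed

lemma cpt_fun_square_integrable:
  fixes g h :: "real \<Rightarrow> real"
  assumes g: "cpt_fun A g" and h: "cpt_fun A' h"
  shows "integrable lborel (\<lambda>x. g x * h x)"
proof -
  obtain B where "\<And>x. norm (h x) \<le> B" using cpt_fun_bounded[OF h] by blast
  then show ?thesis
    by (intro cpt_fun_integrable_mult_bounded[OF g, where B = B] cpt_fun_borel[OF h]) auto
qed

lemma integral_norm2_fourier:
  fixes g :: "real \<Rightarrow> complex"
  assumes g: "cpt_fun A g"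
  shows "(\<integral>x. (norm (fourier g x))\<^sup>2 \<partial>lborel) = sqnorm (\<lambda>x. Re (g x)) + sqnorm (\<lambda>x. Im (g x))"
  unfolding plancherel(2)[OF g] unfolding sqnorm_def cmod_power2
  using cpt_fun_square_integrable[OF cpt_fun_Re[OF g] cpt_fun_Re[OF g]]
    cpt_fun_square_integrable[OF cpt_fun_Im[OF g] cpt_fun_Im[OF g]]
  by (intro Bochner_Integration.integral_add) (auto simp: power2_eq_square)

section \<open>Entire extensions: the easy half of Paley-Wiener\<close>

definition fourier_ext :: "(real \<Rightarrow> complex) \<Rightarrow> complex \<Rightarrow> complex" where
  "fourier_ext g z = (\<integral>t. g t * exp (2 * pi * \<i> * z * t) \<partial>lborel)"

lemma fourier_ext_of_real: "fourier_ext g (complex_of_real x) = fourier g x"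
  unfolding fourier_ext_def fourier_def by (simp add: cis_conv_exp mult_ac)

lemma fourier_ext_norm_le:
  assumes g: "cpt_fun A g"
  shows "norm (fourier_ext g z) \<le> (\<integral>t. norm (g t) \<partial>lborel) * exp (pi * (2 * A) * norm z)"
proof -
  have gi: "integrable lborel g" by (rule cpt_fun_integrable[OF g])
  have cg: "continuous_on {-A..A} g" and zg: "\<And>x. x \<notin> {-A..A} \<Longrightarrow> g x = 0"
    using g by (auto simp: cpt_fun_def)
  have si: "set_integrable lborel {-A..A} (\<lambda>t. g t * exp (2 * pi * \<i> * z * t))"
    by (intro borel_integrable_atLeastAtMost' continuous_intros cg)
  have si_eq: "(\<lambda>t. indicator {-A..A} t *\<^sub>R (g t * exp (2 * pi * \<i> * z * t))) = (\<lambda>t. g t * exp (2 * pi * \<i> * z * t))"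
    using zg by (auto simp: indicator_def)
  have i: "integrable lborel (\<lambda>t. g t * exp (2 * pi * \<i> * z * t))"
    using si unfolding set_integrable_def si_eq .
  have "norm (g t * exp (2 * pi * \<i> * z * t)) \<le> norm (g t) * exp (pi * (2 * A) * norm z)" for t
  proof (cases "t \<in> {-A..A}")
    case True
    have "norm (exp (2 * pi * \<i> * z * t)) \<le> exp (norm (2 * pi * \<i> * z * t))"
      by (rule norm_exp)
    also have "\<dots> \<le> exp (pi * (2 * A) * norm z)"
    proof -
      have "2 * pi * norm z * \<bar>t\<bar> \<le> 2 * pi * norm z * A" using True by (intro mult_left_mono) auto
      moreover have "norm (2 * pi * \<i> * z * t) = 2 * pi * norm z * \<bar>t\<bar>"
        by (simp add: norm_mult)
      ultimately have "norm (2 * pi * \<i> * z * t) \<le> pi * (2 * A) * norm z" by (simp only: mult_ac)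
      then show ?thesis by (rule exp_le_cancel_iff[THEN iffD2])
    qed
    finally show ?thesis unfolding norm_mult[of "g t"] by (intro mult_left_mono) auto
  qed (simp add: zg)
  then have "norm (fourier_ext g z) \<le> (\<integral>t. norm (g t) * exp (pi * (2 * A) * norm z) \<partial>lborel)"
    unfolding fourier_ext_def by (intro Bochner_Integration.integral_norm_bound_integral) (use i gi in auto)
  then show ?thesis by simp
qed

text \<open>Source of the trial functions. Holomorphy comes from differentiating under an integral
  over a compact interval, the type from its half-length.\<close>

lemma fourier_ext_PW:
  assumes g: "cpt_fun A g" and A: "A > 0"
  shows "fourier_ext g \<in> PW (2 * A)"
proof -
  have gi: "integrable lborel g" by (rule cpt_fun_integrable[OF g])
  have cg: "continuous_on {-A..A} g" and zg: "\<And>x. x \<notin> {-A..A} \<Longrightarrow> g x = 0"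
    using g by (auto simp: cpt_fun_def)
  have si: "set_integrable lborel {-A..A} (\<lambda>t. g t * exp (2 * pi * \<i> * z * t))" for z
    by (intro borel_integrable_atLeastAtMost' continuous_intros cg)
  have si_eq: "(\<lambda>t. indicator {-A..A} t *\<^sub>R (g t * exp (2 * pi * \<i> * z * t))) = (\<lambda>t. g t * exp (2 * pi * \<i> * z * t))" for z
    using zg by (auto simp: indicator_def)
  have eq: "fourier_ext g z = integral (cbox (-A) A) (\<lambda>t. g t * exp (2 * pi * \<i> * z * t))" for z
    using set_borel_integral_eq_integral(2)[OF si[of z]]
    unfolding fourier_ext_def set_lebesgue_integral_def si_eq by simp
  have "(\<lambda>z. integral (cbox (-A) A) (\<lambda>t. g t * exp (2 * pi * \<i> * z * t))) holomorphic_on UNIV"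
  proof (rule leibniz_rule_holomorphic[where fx = "\<lambda>z t. g t * (exp (2 * pi * \<i> * z * t) * (2 * pi * \<i> * t))"])
    show "((\<lambda>z. g t * exp (2 * pi * \<i> * z * t)) has_field_derivative
        g t * (exp (2 * pi * \<i> * z * t) * (2 * pi * \<i> * t))) (at z within UNIV)" for z t
      by (auto intro!: derivative_eq_intros)
    show "(\<lambda>t. g t * exp (2 * pi * \<i> * z * t)) integrable_on cbox (-A) A" for z
      using set_borel_integral_eq_integral(1)[OF si[of z]] by simp
    have "continuous_on (UNIV \<times> {-A..A}) (\<lambda>p::complex \<times> real. g (snd p))"
      by (intro continuous_on_compose2[OF cg] continuous_intros) auto
    then show "continuous_on (UNIV \<times> cbox (-A) A) (\<lambda>(z, t). g t * (exp (2 * pi * \<i> * z * t) * (2 * pi * \<i> * t)))"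
      unfolding case_prod_beta by (intro continuous_intros) auto
  qed auto
  moreover have "fourier_ext g = (\<lambda>z. integral (cbox (-A) A) (\<lambda>t. g t * exp (2 * pi * \<i> * z * t)))"
    by (rule ext) (rule eq)
  ultimately have hol: "fourier_ext g holomorphic_on UNIV" by (simp only:)
  note bnd = fourier_ext_norm_le[OF g]
  have "exp_type_le (pi * (2 * A)) (fourier_ext g)"
    unfolding exp_type_le_def
  proof (intro allI impI exI)
    fix eps :: real and z :: complex assume "eps > 0"
    have "exp (pi * (2 * A) * norm z) \<le> exp ((pi * (2 * A) + eps) * norm z)"
      using \<open>eps > 0\<close> by (simp add: mult_right_mono)
    then have "(\<integral>t. norm (g t) \<partial>lborel) * exp (pi * (2 * A) * norm z) \<le> (\<integral>t. norm (g t) \<partial>lborel) * exp ((pi * (2 * A) + eps) * norm z)"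
      by (intro mult_left_mono) auto
    then show "norm (fourier_ext g z) \<le> (\<integral>t. norm (g t) \<partial>lborel) * exp ((pi * (2 * A) + eps) * norm z)"
      using bnd[of z] by linarith
  qed
  then show ?thesis
    using hol plancherel(1)[OF g] by (simp add: PW_def fourier_ext_of_real)
qed

section \<open>Borel and Laplace transforms of functions of exponential type\<close>

lemma has_bochner_integral_power_exp:
  fixes c :: real
  assumes c: "c > 0"
  shows "has_bochner_integral lborel (\<lambda>x. indicator {0<..} x * (x ^ n * exp (- (c * x)))) (fact n / c ^ Suc n)"
proof -
  let ?f = "\<lambda>x::real. x ^ n * exp (- x) * indicator {0<..} x"
  have f: "integrable lborel ?f" "(\<integral>x. ?f x \<partial>lborel) = fact n"
    using has_bochner_integral_I0i_power_exp_m[of n] by (auto simp: has_bochner_integral_iff)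
  have eq: "?f (0 + c * x) = c ^ n * (indicator {0<..} x * (x ^ n * exp (- (c * x))))" for x
    using c by (auto simp: indicator_def power_mult_distrib zero_less_mult_iff)
  have "integrable lborel (\<lambda>x. ?f (0 + c * x))"
    by (rule lborel_integrable_real_affine[OF f(1)]) (use c in auto)
  then have "integrable lborel (\<lambda>x. (1 / c ^ n) * ?f (0 + c * x))" by (rule integrable_mult_right)
  then have 1: "integrable lborel (\<lambda>x. indicator {0<..} x * (x ^ n * exp (- (c * x))))"
    unfolding eq using c by simp
  have "fact n = c * (\<integral>x. ?f (0 + c * x) \<partial>lborel)"
    using lborel_integral_real_affine[of c ?f 0] c f(2) by simp
  also have "\<dots> = c * (c ^ n * (\<integral>x. indicator {0<..} x * (x ^ n * exp (- (c * x))) \<partial>lborel))"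
    unfolding eq by (simp only: integral_mult_right_zero)
  finally show ?thesis using 1 c by (simp add: has_bochner_integral_iff field_simps)
qed

text \<open>Integrating Cauchy's estimate on the circle of radius \<open>r\<close> against \<open>exp (- R r)\<close> bounds the
  derivatives geometrically, without Stirling's formula.\<close>

lemma exp_type_deriv_bound:
  assumes hol: "F holomorphic_on UNIV" and bnd: "\<And>z. norm (F z) \<le> C * exp (\<tau> * norm z)"
    and R: "\<tau> < R" "0 < R"
  shows "norm ((deriv ^^ n) F 0) \<le> C * R ^ Suc n / (R - \<tau>)"
proof -
  let ?D = "norm ((deriv ^^ n) F 0)"
  have c: "?D * r ^ n \<le> fact n * (C * exp (\<tau> * r))" if "r > 0" for r
  proof -
    have "?D \<le> fact n * (C * exp (\<tau> * r)) / r ^ n"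
    proof (rule Cauchy_inequality)
      show "F holomorphic_on ball 0 r" using hol holomorphic_on_subset by blast
      show "continuous_on (cball 0 r) F"
        using holomorphic_on_imp_continuous_on[OF hol] continuous_on_subset by blast
      show "norm (F x) \<le> C * exp (\<tau> * r)" if "norm (0 - x) = r" for x
        using bnd[of x] that by simp
    qed (use that in auto)
    then show ?thesis using that by (simp add: field_simps)
  qed
  note h1 = has_bochner_integral_power_exp[OF R(2), of n]
  have h2: "has_bochner_integral lborel (\<lambda>x. indicator {0<..} x * exp (- ((R - \<tau>) * x))) (1 / (R - \<tau>))"
    using has_bochner_integral_power_exp[of "R - \<tau>" 0] R by simp
  have "(\<integral>x. ?D * (indicator {0<..} x * (x ^ n * exp (- (R * x)))) \<partial>lborel)
      \<le> (\<integral>x. fact n * C * (indicator {0<..} x * exp (- ((R - \<tau>) * x))) \<partial>lborel)"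
  proof (rule integral_mono)
    show "integrable lborel (\<lambda>x. ?D * (indicator {0<..} x * (x ^ n * exp (- (R * x)))))"
      using h1 by (intro integrable_mult_right) (auto simp: has_bochner_integral_iff)
    show "integrable lborel (\<lambda>x. fact n * C * (indicator {0<..} x * exp (- ((R - \<tau>) * x))))"
      using h2 by (intro integrable_mult_right) (auto simp: has_bochner_integral_iff)
    show "?D * (indicator {0<..} x * (x ^ n * exp (- (R * x)))) \<le> fact n * C * (indicator {0<..} x * exp (- ((R - \<tau>) * x)))" for x
    proof (cases "x > 0")
      case True
      from mult_right_mono[OF c[OF this], of "exp (- (R * x))"]
      have "?D * x ^ n * exp (- (R * x)) \<le> fact n * C * (exp (\<tau> * x) * exp (- (R * x)))" by (simp add: mult_ac)
      also have "exp (\<tau> * x) * exp (- (R * x)) = exp (- ((R - \<tau>) * x))"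
        by (simp add: exp_add[symmetric] algebra_simps)
      finally show ?thesis using True by (simp add: mult_ac)
    qed auto
  qed
  then have "?D * (fact n / R ^ Suc n) \<le> fact n * C * (1 / (R - \<tau>))"
    using h1 h2 by (simp only: integral_mult_right_zero has_bochner_integral_iff)
  then have "fact n * (?D / R ^ Suc n) \<le> fact n * (C / (R - \<tau>))" by (simp add: mult_ac)
  then have "?D / R ^ Suc n \<le> C / (R - \<tau>)" by (simp only: mult_le_cancel_left) simp
  then have "?D \<le> C / (R - \<tau>) * R ^ Suc n" using R by (simp only: pos_divide_le_eq zero_less_power)
  then show ?thesis by simp
qed

definition borel_transform :: "(complex \<Rightarrow> complex) \<Rightarrow> complex \<Rightarrow> complex" where
  "borel_transform F w = (\<Sum>n. (deriv ^^ n) F 0 / w ^ Suc n)"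

text \<open>One ray is enough: the negative ray is reached by applying this to
  \<open>\<lambda>z. F (- z)\<close> at \<open>- w\<close>.\<close>

definition half_laplace :: "(complex \<Rightarrow> complex) \<Rightarrow> complex \<Rightarrow> complex" where
  "half_laplace F w = (\<integral>x. indicator {0<..} x *\<^sub>R (F (of_real x) * exp (- (w * of_real x))) \<partial>lborel)"

lemma half_laplace_dom:
  assumes "Re w \<ge> 0"
  shows "norm (indicator {0<..} x *\<^sub>R (F (of_real x) * exp (- (w * of_real x)))) \<le> norm (F (of_real x))"
proof (cases "x > 0")
  case True
  then have "norm (exp (- (w * of_real x))) \<le> 1" using assms by simp
  then show ?thesis using True by (simp add: norm_mult mult_left_le)
qed auto

lemma half_laplace_integrable:
  assumes int: "integrable lborel (\<lambda>x. F (of_real x))" and w: "Re w \<ge> 0"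
  shows "integrable lborel (\<lambda>x. indicator {0<..} x *\<^sub>R (F (of_real x) * exp (- (w * of_real x))))"
proof (rule Bochner_Integration.integrable_bound[OF int])
  have [measurable]: "(\<lambda>x. F (of_real x)) \<in> borel_measurable borel" using int by auto
  show "(\<lambda>x. indicator {0<..} x *\<^sub>R (F (of_real x) * exp (- (w * of_real x)))) \<in> borel_measurable lborel"
    by measurable
qed (use half_laplace_dom[OF w] in auto)

context
  fixes F :: "complex \<Rightarrow> complex" and C \<tau> :: real
  assumes hol: "F holomorphic_on UNIV" and bnd: "\<And>z. norm (F z) \<le> C * exp (\<tau> * norm z)"
    and tau: "\<tau> > 0"
begin

lemma borel_transform_norm_summable:
  assumes "\<tau> < c"
  shows "summable (\<lambda>n. norm ((deriv ^^ n) F 0) / c ^ Suc n)"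
proof -
  \<comment> \<open>Any radius strictly between \<tau> and \<open>c\<close> turns the derivative
    bound into a geometric series of ratio \<open>R / c\<close>.\<close>
  define R where "R = (\<tau> + c) / 2"
  have R: "\<tau> < R" "R < c" "0 < R" using assms tau by (auto simp: R_def)
  show ?thesis
  proof (rule summable_comparison_test')
    show "summable (\<lambda>n. C / (R - \<tau>) * (R / c * (R / c) ^ n))"
      using R by (intro summable_mult summable_geometric) auto
    show "norm (norm ((deriv ^^ n) F 0) / c ^ Suc n) \<le> C / (R - \<tau>) * (R / c * (R / c) ^ n)" if "n \<ge> 0" for n
    proof -
      have "norm ((deriv ^^ n) F 0) / c ^ Suc n \<le> C * R ^ Suc n / (R - \<tau>) / c ^ Suc n"
        using exp_type_deriv_bound[OF hol bnd R(1,3), of n] R by (intro divide_right_mono) auto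
      also have "\<dots> = C / (R - \<tau>) * (R / c * (R / c) ^ n)" by (simp add: power_divide)
      finally show ?thesis using R by (simp add: abs_of_nonneg)
    qed
  qed
qed

lemma borel_transform_sums:
  assumes "\<tau> < norm w"
  shows "(\<lambda>n. (deriv ^^ n) F 0 / w ^ Suc n) sums borel_transform F w"
  unfolding borel_transform_def
proof (rule summable_sums, rule summable_norm_cancel)
  show "summable (\<lambda>n. norm ((deriv ^^ n) F 0 / w ^ Suc n))"
    using borel_transform_norm_summable[OF assms] by (simp only: norm_divide norm_power)
qed

lemma borel_transform_holomorphic: "borel_transform F holomorphic_on {w. \<tau> < norm w}"
proof -
  \<comment> \<open>In \<open>v\<close>, the inverse of \<open>w\<close>, the series is a power
    series that starts with \<open>v ^ 1\<close>; hence the shifted coefficients \<open>a\<close>.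
    At \<open>v = 0\<close> the conventions \<open>inverse 0 = 0\<close> and division by 0 give
    \<open>P 0 = 0\<close>, the correct value at infinity.\<close>
  define P where "P v = borel_transform F (inverse v)" for v
  define a where "a n = (case n of 0 \<Rightarrow> 0 | Suc m \<Rightarrow> (deriv ^^ m) F 0)" for n
  have "P holomorphic_on ball 0 (1 / \<tau>)"
  proof (rule power_series_holomorphic)
    fix v :: complex assume v: "v \<in> ball 0 (1 / \<tau>)"
    have "(\<lambda>n. a (Suc n) * v ^ Suc n) sums P v"
    proof (cases "v = 0")
      case True
      then show ?thesis by (simp add: P_def borel_transform_def)
    next
      case False
      then have "\<tau> < norm (inverse v)"
        unfolding norm_inverse using v tau by (simp add: field_simps)
      from borel_transform_sums[OF this] show ?thesis
        by (simp add: P_def a_def divide_inverse power_inverse)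
    qed
    then have "(\<lambda>n. a n * v ^ n) sums (P v + a 0 * v ^ 0)"
      by (subst (asm) sums_Suc_iff) simp
    then show "(\<lambda>n. a n * (v - 0) ^ n) sums P v" by (simp add: a_def)
  qed
  then have "(P \<circ> inverse) holomorphic_on {w. \<tau> < norm w}"
  proof (rule holomorphic_on_compose_gen[rotated])
    show "inverse holomorphic_on {w::complex. \<tau> < norm w}"
      using tau by (auto intro!: holomorphic_intros)
    show "inverse ` {w::complex. \<tau> < norm w} \<subseteq> ball 0 (1 / \<tau>)"
    proof safe
      fix w :: complex assume "\<tau> < norm w"
      then have "inverse (norm w) < inverse \<tau>" using tau by (intro less_imp_inverse_less)
      then show "inverse w \<in> ball 0 (1 / \<tau>)" using norm_inverse[of w] by (simp add: inverse_eq_divide[of \<tau>])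
    qed
  qed
  then show ?thesis by (simp add: P_def o_def)
qed

text \<open>The Taylor series of \<open>F\<close> is integrated term by term. The integrals of the
  absolute values of the terms sum to the series of \<open>borel_transform_norm_summable\<close>,
  which converges because \<tau> < \<open>c\<close>.\<close>

lemma half_laplace_eq_borel_real:
  assumes c: "\<tau> < c"
  shows "half_laplace F (of_real c) = borel_transform F (of_real c)"
proof -
  have c0: "c > 0" using c tau by simp
  let ?a = "\<lambda>n. (deriv ^^ n) F 0 / fact n"
  let ?f = "\<lambda>n x. ?a n * complex_of_real (indicator {0<..} x * (x ^ n * exp (- (c * x))))"
  note h = has_bochner_integral_power_exp[OF c0]
  have fi: "integrable lborel (?f n)" for n
    using h[of n] by (intro integrable_mult_right integrable_of_real) (auto simp: has_bochner_integral_iff)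
  have Fsums: "(\<lambda>n. ?a n * z ^ n) sums F z" for z
    using holomorphic_power_series[of F 0 "norm z + 1" z] hol holomorphic_on_subset by fastforce
  have sum1: "summable (\<lambda>n. norm (?f n x))" for x
  proof -
    have "summable (\<lambda>n. norm (?a n * complex_of_real x ^ n))"
    proof (rule powser_insidea)
      show "summable (\<lambda>n. ?a n * complex_of_real (\<bar>x\<bar> + 1) ^ n)" using Fsums sums_summable by blast
    qed auto
    then have "summable (\<lambda>n. norm (?a n * complex_of_real x ^ n) * (indicator {0<..} x * exp (- (c * x))))"
      by (rule summable_mult2)
    then show ?thesis by (simp add: norm_mult norm_divide abs_mult mult_ac norm_power)
  qed
  have int: "(\<integral>x. norm (?f n x) \<partial>lborel) = norm ((deriv ^^ n) F 0) / c ^ Suc n" for n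
  proof -
    have "(\<integral>x. norm (?f n x) \<partial>lborel) = (\<integral>x. norm (?a n) * (indicator {0<..} x * (x ^ n * exp (- (c * x)))) \<partial>lborel)"
      by (intro Bochner_Integration.integral_cong refl) (auto simp: norm_mult indicator_def abs_mult norm_divide norm_power)
    also have "\<dots> = norm (?a n) * (fact n / c ^ Suc n)"
      using h[of n] by (simp only: integral_mult_right_zero has_bochner_integral_iff)
    finally show ?thesis by (simp add: norm_divide)
  qed
  have S: "(\<lambda>n. \<integral>x. ?f n x \<partial>lborel) sums (\<integral>x. (\<Sum>n. ?f n x) \<partial>lborel)"
    by (rule sums_integral[OF fi]) (use sum1 borel_transform_norm_summable[OF c] int in auto)
  have S1: "(\<integral>x. ?f n x \<partial>lborel) = (deriv ^^ n) F 0 / of_real c ^ Suc n" for n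
  proof -
    have "(\<integral>x. ?f n x \<partial>lborel) = ?a n * complex_of_real (fact n / c ^ Suc n)"
      using h[of n] by (simp only: integral_mult_right_zero integral_complex_of_real has_bochner_integral_iff)
    then show ?thesis by simp
  qed
  have S2: "(\<integral>x. (\<Sum>n. ?f n x) \<partial>lborel) = half_laplace F (of_real c)"
    unfolding half_laplace_def
  proof (intro Bochner_Integration.integral_cong refl)
    fix x :: real
    have "(\<lambda>n. ?a n * of_real x ^ n * complex_of_real (indicator {0<..} x * exp (- (c * x)))) sums
        (F (of_real x) * complex_of_real (indicator {0<..} x * exp (- (c * x))))"
      by (rule sums_mult2[OF Fsums])
    then have "(\<lambda>n. ?f n x) sums (F (of_real x) * complex_of_real (indicator {0<..} x * exp (- (c * x))))"
      by (simp add: mult_ac)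
    then show "(\<Sum>n. ?f n x) = indicator {0<..} x *\<^sub>R (F (of_real x) * exp (- (of_real c * of_real x)))"
      by (simp add: sums_unique[symmetric] scaleR_conv_of_real exp_of_real[symmetric] mult_ac)
  qed
  have "(\<lambda>n. (deriv ^^ n) F 0 / of_real c ^ Suc n) sums borel_transform F (of_real c)"
    by (rule borel_transform_sums) (use c c0 in auto)
  moreover have "(\<lambda>n. (deriv ^^ n) F 0 / of_real c ^ Suc n) sums half_laplace F (of_real c)"
    using S unfolding S1 S2 .
  ultimately show ?thesis by (rule sums_unique2[symmetric])
qed

context
  assumes int: "integrable lborel (\<lambda>x. F (of_real x))"
begin

lemma half_laplace_truncated_holomorphic:
  "(\<lambda>w. integral (cbox 0 (real N)) (\<lambda>x. F (of_real x) * exp (- (w * of_real x)))) holomorphic_on UNIV"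
proof (rule leibniz_rule_holomorphic[where fx = "\<lambda>w x. F (of_real x) * (exp (- (w * of_real x)) * (- of_real x))"])
  have c: "continuous_on S (\<lambda>x. F (f x))" if "continuous_on S f" for S and f :: "'b::t2_space \<Rightarrow> complex"
    using continuous_on_compose2[OF holomorphic_on_imp_continuous_on[OF hol] that] by auto
  show "((\<lambda>w. F (of_real x) * exp (- (w * of_real x))) has_field_derivative
      F (of_real x) * (exp (- (w * of_real x)) * (- of_real x))) (at w within UNIV)" for w and x :: real
    by (auto intro!: derivative_eq_intros)
  show "(\<lambda>x. F (of_real x) * exp (- (w * of_real x))) integrable_on cbox 0 (real N)" for w
    by (intro integrable_continuous continuous_intros c)
  show "continuous_on (UNIV \<times> cbox 0 (real N)) (\<lambda>(w, x). F (of_real x) * (exp (- (w * of_real x)) * (- of_real x)))"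
    unfolding case_prod_beta by (intro continuous_intros c)
qed auto

text \<open>The truncated integrals are entire, and by the integrability of \<open>F\<close> on the
  real line their error is at most a tail of the integral of its modulus, uniformly on the closed
  half-plane.\<close>

lemma half_laplace_holomorphic: "half_laplace F holomorphic_on {w. Re w > 0}"
proof (rule holomorphic_uniform_sequence)
  let ?f = "\<lambda>N w. integral (cbox 0 (real N)) (\<lambda>x. F (of_real x) * exp (- (w * of_real x)))"
  let ?g = "\<lambda>w x. indicator {0<..} x *\<^sub>R (F (of_real x) * exp (- (w * of_real x)))"
  show "open {w. Re w > 0}" by (rule open_halfspace_Re_gt)
  show "?f N holomorphic_on {w. Re w > 0}" for N
    using half_laplace_truncated_holomorphic holomorphic_on_subset by blast
  have [measurable]: "(\<lambda>x. F (of_real x)) \<in> borel_measurable borel" using int by auto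
  have tail: "(\<lambda>N. \<integral>x. indicator {real N<..} x * norm (F (of_real x)) \<partial>lborel) \<longlonglongrightarrow> (\<integral>x. 0 \<partial>(lborel :: real measure))"
  proof (rule integral_dominated_convergence[where w = "\<lambda>x. norm (F (of_real x))"])
    show "AE x in lborel. (\<lambda>N. indicator {real N<..} x * norm (F (of_real x))) \<longlonglongrightarrow> 0"
    proof (rule AE_I2)
      fix x :: real
      obtain M where "x < real M" using reals_Archimedean2 by blast
      then have "indicator {real N<..} x * norm (F (of_real x)) = 0" if "N \<ge> M" for N
        using that by (simp add: indicator_def)
      then have "eventually (\<lambda>N. indicator {real N<..} x * norm (F (of_real x)) = 0) sequentially"
        by (rule eventually_sequentiallyI)
      then show "(\<lambda>N. indicator {real N<..} x * norm (F (of_real x))) \<longlonglongrightarrow> 0"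
        by (rule tendsto_eventually)
    qed
  qed (use int in \<open>auto simp: indicator_def\<close>)
  have bd: "norm (?f N w - half_laplace F w) \<le> (\<integral>x. indicator {real N<..} x * norm (F (of_real x)) \<partial>lborel)"
    if w: "Re w \<ge> 0" for N w
  proof -
    have cF: "continuous_on {0..real N} (\<lambda>x. F (of_real x))"
      by (rule continuous_on_compose2[OF holomorphic_on_imp_continuous_on[OF hol]]) (auto intro!: continuous_intros)
    have si: "set_integrable lborel {0..real N} (\<lambda>x. F (of_real x) * exp (- (w * of_real x)))"
      by (intro borel_integrable_atLeastAtMost' continuous_intros cF)
    have "?f N w = (\<integral>x. indicator {0..real N} x *\<^sub>R (F (of_real x) * exp (- (w * of_real x))) \<partial>lborel)"
      using set_borel_integral_eq_integral(2)[OF si] by (simp add: set_lebesgue_integral_def)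
    also have "\<dots> = (\<integral>x. indicator {0<..real N} x *\<^sub>R (F (of_real x) * exp (- (w * of_real x))) \<partial>lborel)"
    proof (rule integral_cong_AE)
      have "AE x in lborel. x \<noteq> (0::real)" by (rule AE_lborel_singleton)
      then show "AE x in lborel. indicator {0..real N} x *\<^sub>R (F (of_real x) * exp (- (w * of_real x))) =
          indicator {0<..real N} x *\<^sub>R (F (of_real x) * exp (- (w * of_real x)))"
        by eventually_elim (auto simp: indicator_def)
    qed measurable
    finally have fe: "?f N w = (\<integral>x. indicator {0<..real N} x *\<^sub>R (F (of_real x) * exp (- (w * of_real x))) \<partial>lborel)" .
    have i1: "integrable lborel (\<lambda>x. indicator {0<..real N} x *\<^sub>R (F (of_real x) * exp (- (w * of_real x))))"
    proof (rule Bochner_Integration.integrable_bound[OF half_laplace_integrable[OF int w]])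
      show "AE x in lborel. norm (indicator {0<..real N} x *\<^sub>R (F (of_real x) * exp (- (w * of_real x)))) \<le> norm (?g w x)"
        by (auto simp: indicator_def)
    qed measurable
    have "norm (?f N w - half_laplace F w) = norm (\<integral>x. indicator {0<..real N} x *\<^sub>R (F (of_real x) * exp (- (w * of_real x))) - ?g w x \<partial>lborel)"
      unfolding fe half_laplace_def
      by (subst Bochner_Integration.integral_diff[OF i1 half_laplace_integrable[OF int w]]) simp
    also have "\<dots> \<le> (\<integral>x. indicator {real N<..} x * norm (F (of_real x)) \<partial>lborel)"
    proof (rule Bochner_Integration.integral_norm_bound_integral)
      show "integrable lborel (\<lambda>x. indicator {0<..real N} x *\<^sub>R (F (of_real x) * exp (- (w * of_real x))) - ?g w x)"
        by (rule Bochner_Integration.integrable_diff[OF i1 half_laplace_integrable[OF int w]])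
      show "integrable lborel (\<lambda>x. indicator {real N<..} x * norm (F (of_real x)))"
        using integrable_mult_indicator[OF _ integrable_norm[OF int], of "{real N<..}"] by simp
      show "norm (indicator {0<..real N} x *\<^sub>R (F (of_real x) * exp (- (w * of_real x))) - ?g w x)
          \<le> indicator {real N<..} x * norm (F (of_real x))" for x
        using half_laplace_dom[OF w, of x] by (cases "x > real N") (auto simp: indicator_def)
    qed
    finally show ?thesis .
  qed
  fix w assume "w \<in> {w. Re w > 0}"
  then have w: "Re w > 0" by simp
  obtain d where d: "d > 0" "cball w d \<subseteq> {w. Re w > 0}"
    using open_contains_cball[of "{w. Re w > 0}"] open_halfspace_Re_gt[of 0] w by auto
  have "uniform_limit (cball w d) ?f (half_laplace F) sequentially"
  proof (rule uniform_limitI)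
    fix e :: real assume "e > 0"
    have "(\<lambda>N. \<integral>x. indicator {real N<..} x * norm (F (of_real x)) \<partial>lborel) \<longlonglongrightarrow> 0" using tail by simp
    then have "eventually (\<lambda>N. (\<integral>x. indicator {real N<..} x * norm (F (of_real x)) \<partial>lborel) < e) sequentially"
      using \<open>e > 0\<close> by (rule order_tendstoD)
    then show "eventually (\<lambda>N. \<forall>z\<in>cball w d. dist (?f N z) (half_laplace F z) < e) sequentially"
    proof eventually_elim
      case (elim N)
      show ?case
      proof
        fix z assume "z \<in> cball w d"
        then have "Re z \<ge> 0" using d by auto
        from bd[OF this, of N] elim show "dist (?f N z) (half_laplace F z) < e" by (simp add: dist_norm)
      qed
    qed
  qed
  then show "\<exists>d>0. cball w d \<subseteq> {w. Re w > 0} \<and> uniform_limit (cball w d) ?f (half_laplace F) sequentially"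
    using d by auto
qed

text \<open>Identity theorem. The real ray beyond \<tau>, where the two functions agree, is joined
  to \<open>w\<close> inside a region where both are holomorphic. That region \<open>H\<close> is a
  union of two convex sets that meet, which makes connectedness immediate; \<open>s\<close> selects
  the upper or the lower side.\<close>

lemma half_laplace_eq_borel:
  assumes s: "s = 1 \<or> s = -1" and w: "Re w > 0" "s * Im w > \<tau>"
  shows "half_laplace F w = borel_transform F w"
proof -
  define H where "H = {w. Re w > \<tau>} \<union> ({w. Re w > 0} \<inter> {w. s * Im w > \<tau>})"
  have cv: "convex {w. s * Im w > \<tau>}" "open {w. s * Im w > \<tau>}"
    using s convex_halfspace_Im_gt[of \<tau>] convex_halfspace_Im_lt[of "-\<tau>"]
      open_halfspace_Im_gt[of \<tau>] open_halfspace_Im_lt[of "-\<tau>"] by (auto simp: minus_less_iff less_minus_iff)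
  have op: "open H" unfolding H_def
    by (intro open_Un open_Int open_halfspace_Re_gt cv)
  have "Complex (\<tau> + 1) (s * (\<tau> + 1)) \<in> {w. Re w > \<tau>} \<inter> ({w. Re w > 0} \<inter> {w. s * Im w > \<tau>})"
    using tau s by auto
  then have con: "connected H" unfolding H_def
    by (intro connected_Un convex_connected convex_Int convex_halfspace_Re_gt cv) blast
  have sub1: "H \<subseteq> {w. Re w > 0}" using tau by (auto simp: H_def)
  have sub2: "H \<subseteq> {w. \<tau> < norm w}"
  proof
    fix v assume "v \<in> H"
    then show "v \<in> {w. \<tau> < norm w}"
      using complex_Re_le_cmod[of v] abs_Im_le_cmod[of v] s by (auto simp: H_def)
  qed
  have "half_laplace F w - borel_transform F w = 0"
  proof (rule analytic_continuation[of "\<lambda>w. half_laplace F w - borel_transform F w" H "complex_of_real ` {\<tau><..}" "of_real (\<tau> + 1)"])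
    show "(\<lambda>w. half_laplace F w - borel_transform F w) holomorphic_on H"
      by (intro holomorphic_intros holomorphic_on_subset[OF half_laplace_holomorphic sub1]
          holomorphic_on_subset[OF borel_transform_holomorphic sub2])
    show "complex_of_real ` {\<tau><..} \<subseteq> H" by (auto simp: H_def)
    show "of_real (\<tau> + 1) \<in> H" by (simp add: H_def)
    show "complex_of_real (\<tau> + 1) islimpt complex_of_real ` {\<tau><..}"
    proof -
      have "(\<tau> + 1) islimpt {\<tau><..}"
        using islimpt_greaterThanLessThan1[of "\<tau> + 1" "\<tau> + 2"]
        by (rule islimpt_subset) auto
      then show ?thesis
      proof (rule islimpt_isCont_image)
        show "eventually (\<lambda>y. complex_of_real y \<noteq> complex_of_real (\<tau> + 1)) (at (\<tau> + 1))"
          unfolding eventually_at by (intro exI[of _ 1]) (simp only: of_real_eq_iff, simp)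
      qed auto
    qed
    show "half_laplace F z - borel_transform F z = 0" if "z \<in> complex_of_real ` {\<tau><..}" for z
      using that half_laplace_eq_borel_real by auto
  qed (use w op con in \<open>auto simp: H_def\<close>)
  then show ?thesis by simp
qed

text \<open>The boundary is approached from the right: the Laplace side converges by dominated
  convergence because \<open>F\<close> is integrable on the real line, the Borel side because it is
  holomorphic across the axis beyond \<tau>.\<close>

lemma half_laplace_eq_borel_imag:
  assumes "\<bar>v\<bar> > \<tau>"
  shows "half_laplace F (\<i> * of_real v) = borel_transform F (\<i> * of_real v)"
proof -
  define s :: real where "s = (if v > 0 then 1 else -1)"
  have s: "s = 1 \<or> s = -1" "s * v > \<tau>" using assms tau by (auto simp: s_def)
  define X where "X n = of_real (inverse (real (Suc n))) + \<i> * of_real v" for n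
  have X: "X \<longlonglongrightarrow> \<i> * of_real v"
  proof -
    have "X \<longlonglongrightarrow> of_real 0 + \<i> * of_real v"
      unfolding X_def by (intro tendsto_intros LIMSEQ_inverse_real_of_nat)
    then show ?thesis by simp
  qed
  have "(\<lambda>n. half_laplace F (X n)) \<longlonglongrightarrow> half_laplace F (\<i> * of_real v)"
    unfolding half_laplace_def
  proof (rule integral_dominated_convergence[where w = "\<lambda>x. norm (F (of_real x))"])
    have [measurable]: "(\<lambda>x. F (of_real x)) \<in> borel_measurable borel" using int by auto
    show "(\<lambda>x. indicator {0<..} x *\<^sub>R (F (of_real x) * exp (- (X n * of_real x)))) \<in> borel_measurable lborel" for n by measurable
    show "(\<lambda>x. indicator {0<..} x *\<^sub>R (F (of_real x) * exp (- (\<i> * of_real v * of_real x)))) \<in> borel_measurable lborel" by measurable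
    show "AE x in lborel. (\<lambda>n. indicator {0<..} x *\<^sub>R (F (of_real x) * exp (- (X n * of_real x)))) \<longlonglongrightarrow>
        indicator {0<..} x *\<^sub>R (F (of_real x) * exp (- (\<i> * of_real v * of_real x)))"
      by (intro AE_I2 tendsto_intros X)
    show "AE x in lborel. norm (indicator {0<..} x *\<^sub>R (F (of_real x) * exp (- (X n * of_real x)))) \<le> norm (F (of_real x))" for n
      by (intro AE_I2 half_laplace_dom) (simp add: X_def)
  qed (use int in auto)
  moreover have "(\<lambda>n. half_laplace F (X n)) = (\<lambda>n. borel_transform F (X n))"
    by (intro ext half_laplace_eq_borel[OF s(1)]) (use s in \<open>auto simp: X_def\<close>)
  moreover have "(\<lambda>n. borel_transform F (X n)) \<longlonglongrightarrow> borel_transform F (\<i> * of_real v)"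
  proof -
    have "open {w::complex. \<tau> < norm w}" by (intro open_Collect_less continuous_intros)
    moreover have "\<i> * of_real v \<in> {w. \<tau> < norm w}" using assms by (simp add: norm_mult)
    ultimately have "isCont (borel_transform F) (\<i> * of_real v)"
      using holomorphic_on_imp_continuous_on[OF borel_transform_holomorphic] continuous_on_eq_continuous_at by blast
    then show ?thesis using X isCont_tendsto_compose by blast
  qed
  ultimately show ?thesis by (simp only:) (rule LIMSEQ_unique)
qed

end

end

section \<open>Support of the Fourier transform and reduction to the quadratic form\<close>

lemma PW_D:
  assumes "F \<in> PW D"
  shows "F holomorphic_on UNIV" "exp_type_le (pi * D) F" "integrable lborel (\<lambda>x::real. (norm (F (of_real x)))\<^sup>2)"
  using assms by (auto simp: PW_def)

lemma PW_continuous: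
  assumes "F \<in> PW D"
  shows "continuous_on UNIV (\<lambda>x::real. F (of_real x))"
  by (rule continuous_on_compose2[OF holomorphic_on_imp_continuous_on[OF PW_D(1)[OF assms]]])
     (auto intro!: continuous_intros)

text \<open>This sign is what makes the contributions of the two half-lines cancel in
  \<open>paley_wiener_support\<close>.\<close>

lemma borel_transform_reflect:
  assumes "F holomorphic_on UNIV"
    and "(\<lambda>n. (deriv ^^ n) F 0 / w ^ Suc n) sums borel_transform F w"
  shows "borel_transform (\<lambda>z. F (- z)) (- w) = - borel_transform F w"
proof -
  have "(deriv ^^ n) (\<lambda>z. F (- z)) 0 / (- w) ^ Suc n = - ((deriv ^^ n) F 0 / w ^ Suc n)" for n
  proof -
    have "(deriv ^^ n) (\<lambda>z. F ((-1) * z)) 0 = (-1) ^ n * (deriv ^^ n) F ((-1) * 0)"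
      by (rule higher_deriv_compose_linear[OF assms(1), of UNIV]) auto
    then have "(deriv ^^ n) (\<lambda>z. F (- z)) 0 = (-1) ^ n * (deriv ^^ n) F 0" by simp
    moreover have "(- w) ^ Suc n = - ((-1) ^ n * w ^ Suc n)"
      by (simp add: power_minus[of w n])
    ultimately show ?thesis by (simp only:) (simp del: power_Suc)
  qed
  then have "borel_transform (\<lambda>z. F (- z)) (- w) = (\<Sum>n. - ((deriv ^^ n) F 0 / w ^ Suc n))"
    unfolding borel_transform_def by (simp only:)
  then show ?thesis using sums_unique[OF sums_minus[OF assms(2)]] by simp
qed

text \<open>The Fourier integral is split at 0. Each half is a one-sided Laplace transform at a
  point of the imaginary axis where it equals a Borel transform, and the two Borel values are
  opposite.\<close>

theorem paley_wiener_support: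
  assumes F: "F \<in> PW D" and D: "D > 0" and int: "integrable lborel (\<lambda>x. F (of_real x))"
    and t: "\<bar>t\<bar> > D / 2"
  shows "fourier (\<lambda>x. F (of_real x)) t = 0"
proof -
  \<comment> \<open>With this \<open>v\<close> the Laplace kernel at \<open>\<i> * of_real v\<close>
    is \<open>cis (2 * pi * x * t)\<close>.\<close>
  define v where "v = - (2 * pi * t)"
  have "pi * D < 2 * pi * \<bar>t\<bar>" using t by simp
  then have vgt: "pi * D < \<bar>v\<bar>" by (simp add: v_def abs_mult)
  \<comment> \<open>The growth bound holds only with a positive excess over \<open>pi * D\<close>;
    the strict inequality for \<open>t\<close> leaves room for half of the gap.\<close>
  define eps where "eps = (\<bar>v\<bar> - pi * D) / 2"
  have eps: "eps > 0" "pi * D + eps < \<bar>v\<bar>" using vgt by (auto simp: eps_def field_simps)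
  define \<tau> where "\<tau> = pi * D + eps"
  have tau: "\<tau> > 0" "\<tau> < \<bar>v\<bar>" using eps D by (auto simp: \<tau>_def add_pos_pos)
  note hol = PW_D(1)[OF F]
  obtain C where C: "\<And>z. norm (F z) \<le> C * exp (\<tau> * norm z)"
    using PW_D(2)[OF F] eps(1) unfolding exp_type_le_def \<tau>_def by blast
  let ?G = "\<lambda>z. F (- z)"
  have holG: "?G holomorphic_on UNIV"
    using holomorphic_on_compose_gen[OF holomorphic_on_minus[OF holomorphic_on_ident] hol] by (simp add: o_def)
  have CG: "norm (?G z) \<le> C * exp (\<tau> * norm z)" for z using C[of "- z"] by simp
  have intG: "integrable lborel (\<lambda>x. ?G (of_real x))"
    using lborel_integrable_real_affine[OF int, of "-1" 0] by simp
  have 1: "half_laplace F (\<i> * of_real v) = borel_transform F (\<i> * of_real v)"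
    by (rule half_laplace_eq_borel_imag[OF hol C tau(1) int tau(2)])
  have 2: "half_laplace ?G (\<i> * of_real (- v)) = borel_transform ?G (\<i> * of_real (- v))"
    by (rule half_laplace_eq_borel_imag[OF holG CG tau(1) intG]) (use tau in simp)
  have "(\<lambda>n. (deriv ^^ n) F 0 / (\<i> * of_real v) ^ Suc n) sums borel_transform F (\<i> * of_real v)"
    by (rule borel_transform_sums[OF hol C tau(1)]) (use tau in \<open>simp add: norm_mult\<close>)
  from borel_transform_reflect[OF hol this]
  have 3: "half_laplace F (\<i> * of_real v) + half_laplace ?G (\<i> * of_real (- v)) = 0"
    unfolding 1 2 by simp
  let ?p = "\<lambda>x. indicator {0<..} x *\<^sub>R (F (of_real x) * exp (- (\<i> * of_real v * of_real x)))"
  let ?q = "\<lambda>x. indicator {0<..} x *\<^sub>R (?G (of_real x) * exp (- (\<i> * of_real (- v) * of_real x)))"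
  have pi: "integrable lborel ?p" by (rule half_laplace_integrable[OF int]) simp
  have qi: "integrable lborel ?q" by (rule half_laplace_integrable[OF intG]) simp
  have qi': "integrable lborel (\<lambda>x. ?q (0 + (-1) * x))"
    by (rule lborel_integrable_real_affine[OF qi]) simp
  have "half_laplace ?G (\<i> * of_real (- v)) = (\<integral>x. ?q (0 + (-1) * x) \<partial>lborel)"
    unfolding half_laplace_def by (subst lborel_integral_real_affine[of "-1" _ 0]) simp_all
  then have "half_laplace F (\<i> * of_real v) + half_laplace ?G (\<i> * of_real (- v))
     = (\<integral>x. ?p x + ?q (0 + (-1) * x) \<partial>lborel)"
    by (subst Bochner_Integration.integral_add[OF pi qi']) (simp only: half_laplace_def)
  also have "\<dots> = fourier (\<lambda>x. F (of_real x)) t"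
    unfolding fourier_def
  proof (rule integral_cong_AE)
    have "AE x in lborel. x \<noteq> (0::real)" by (rule AE_lborel_singleton)
    then show "AE x in lborel. ?p x + ?q (0 + (-1) * x) = F (of_real x) * cis (2 * pi * x * t)"
      by eventually_elim (auto simp: indicator_def v_def cis_conv_exp mult_ac)
    show "(\<lambda>x. ?p x + ?q (0 + (-1) * x)) \<in> borel_measurable lborel"
      using pi qi' by (intro borel_measurable_add) auto
    show "(\<lambda>x. F (of_real x) * cis (2 * pi * x * t)) \<in> borel_measurable lborel"
      using integrable_mult_cis[OF int, of t] by auto
  qed
  finally show ?thesis using 3 by simp
qed

text \<open>With free coefficients one statement serves both extremes: \<open>(m, -1)\<close> bounds
  the form from above and \<open>(-m, 1)\<close> from below. Integrability of \<open>F\<close> makes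
  its transform continuous, hence a \<open>cpt_fun\<close>, and inversion recovers \<open>F\<close>
  from it.\<close>

lemma PW_integrable_form:
  assumes F: "F \<in> PW D" and D: "D > 0" and int: "integrable lborel (\<lambda>x. F (of_real x))"
    and pos: "\<And>g. cpt_fun (D/2) g \<Longrightarrow> 0 \<le> a * sqnorm g + b * box_form g"
  shows "0 \<le> a * (\<integral>x. (norm (F (of_real x)))\<^sup>2 \<partial>lborel) + b * (\<integral>x. (norm (F (of_real x)))\<^sup>2 * sinc2 x \<partial>lborel)"
proof -
  define g where "g t = fourier (\<lambda>x. F (of_real x)) (- t)" for t
  have g: "cpt_fun (D/2) g"
    unfolding cpt_fun_def
  proof (intro conjI allI impI)
    show "continuous_on {- (D / 2)..D / 2} g"
      unfolding g_def by (rule continuous_on_compose2[OF continuous_fourier[OF int]]) (auto intro!: continuous_intros)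
    fix x assume "x \<notin> {- (D / 2)..D / 2}"
    then have "\<bar>- x\<bar> > D / 2" by auto
    then show "g x = 0" unfolding g_def by (rule paley_wiener_support[OF F D int])
  qed
  have inv: "fourier g x = F (of_real x)" for x
    unfolding g_def
    by (rule fourier_inversion[OF int PW_continuous[OF F]]) (use cpt_fun_integrable[OF g] in \<open>simp add: g_def[abs_def]\<close>)
  have "0 \<le> (a * sqnorm (\<lambda>x. Re (g x)) + b * box_form (\<lambda>x. Re (g x))) + (a * sqnorm (\<lambda>x. Im (g x)) + b * box_form (\<lambda>x. Im (g x)))"
    by (intro add_nonneg_nonneg pos cpt_fun_Re cpt_fun_Im g)
  then show ?thesis
    using integral_norm2_fourier[OF g] integral_sinc2_norm2_fourier[OF g]
    by (simp add: inv algebra_simps)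
qed

text \<open>\<open>S\<close> is sin(pi D z)/(pi D z), the extension of the normalised indicator. It
  is only square-integrable, but its product with a square-integrable function is
  integrable.\<close>

lemma PW_mollifier:
  assumes D: "D > 0"
  obtains S where "S \<in> PW D" "\<And>x::real. norm (S (of_real x)) \<le> 1" "S 0 = 1"
    "\<And>z. norm (S z) \<le> exp (pi * D * norm z)"
proof -
  define g where "g t = (if t \<in> {-(D/2)..D/2} then complex_of_real (1 / D) else 0)" for t
  have "continuous_on {-(D/2)..D/2} g \<longleftrightarrow> continuous_on {-(D/2)..D/2} (\<lambda>_. complex_of_real (1 / D))"
    by (rule continuous_on_cong) (auto simp: g_def)
  then have g: "cpt_fun (D/2) g"
    unfolding cpt_fun_def by (auto simp: g_def)
  have ge: "g t = indicator {-(D/2)..D/2} t *\<^sub>R complex_of_real (1 / D)" for t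
    by (simp add: g_def indicator_def)
  have ne: "norm (g t) = indicator {-(D/2)..D/2} t * (1 / D)" for t
    using D by (simp add: g_def indicator_def norm_divide)
  have int1: "(\<integral>t. norm (g t) \<partial>lborel) = 1"
    unfolding ne using D by simp
  show thesis
  proof (rule that[of "fourier_ext g"])
    show "fourier_ext g \<in> PW D" using fourier_ext_PW[OF g] D by simp
    show "norm (fourier_ext g (of_real x)) \<le> 1" for x
      using norm_fourier_le[of g x] by (simp add: fourier_ext_of_real int1)
    have "fourier_ext g 0 = (\<integral>t. indicator {-(D/2)..D/2} t *\<^sub>R complex_of_real (1 / D) \<partial>lborel)"
      unfolding fourier_ext_def ge by simp
    also have "\<dots> = 1" using D by (simp add: scaleR_conv_of_real)
    finally show "fourier_ext g 0 = 1" .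
    show "norm (fourier_ext g z) \<le> exp (pi * D * norm z)" for z
      using fourier_ext_norm_le[OF g, of z] by (simp add: int1)
  qed
qed

lemma integral_rescale:
  fixes f :: "real \<Rightarrow> real"
  assumes "c > 0" shows "(\<integral>x. f x \<partial>lborel) = c * (\<integral>y. f (c * y) \<partial>lborel)"
  using lborel_integral_real_affine[of c f 0] assms by simp

text \<open>Dilating \<open>F\<close> by \<open>1 / c\<close> lowers its type to
  \<open>pi * D / c\<close>, and the factor \<open>S\<close> dilated by \<open>1 - 1 / c\<close>
  restores exactly the missing amount. So \<open>G n\<close> stays in \<open>PW D\<close> while
  becoming integrable, and both integrals converge as \<open>c n\<close> tends to 1.\<close>

lemma PW_form:
  assumes F: "F \<in> PW D" and D: "D > 0"
    and pos: "\<And>g. cpt_fun (D/2) g \<Longrightarrow> 0 \<le> a * sqnorm g + b * box_form g"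
  shows "0 \<le> a * (\<integral>x. (norm (F (of_real x)))\<^sup>2 \<partial>lborel) + b * (\<integral>x. (norm (F (of_real x)))\<^sup>2 * sinc2 x \<partial>lborel)"
proof -
  obtain S where S: "S \<in> PW D" "\<And>x::real. norm (S (of_real x)) \<le> 1" "S 0 = 1"
    "\<And>z. norm (S z) \<le> exp (pi * D * norm z)" using PW_mollifier[OF D] by blast
  define c where "c n = 1 + inverse (real (Suc n))" for n
  have c: "c n > 1" for n by (simp add: c_def)
  have clim: "c \<longlonglongrightarrow> 1"
    unfolding c_def using tendsto_add[OF tendsto_const[of 1] LIMSEQ_inverse_real_of_nat] by simp
  define G where "G n z = F (of_real (1 / c n) * z) * S (of_real (1 - 1 / c n) * z)" for n z
  let ?f = "\<lambda>x::real. (norm (F (of_real x)))\<^sup>2"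
  let ?g = "\<lambda>n (x::real). (norm (G n (of_real x)))\<^sup>2"
  note Fi = PW_D(3)[OF F]
  have comp_hol: "(\<lambda>z. H (k * z)) holomorphic_on UNIV" if "H holomorphic_on UNIV" for H k
    using holomorphic_on_compose_gen[OF _ that, of "\<lambda>z. k * z" UNIV] by (auto simp: o_def intro!: holomorphic_intros)
  have holG: "G n holomorphic_on UNIV" for n
    unfolding G_def[abs_def] by (intro holomorphic_intros comp_hol PW_D(1)[OF F] PW_D(1)[OF S(1)])
  have [measurable]: "(\<lambda>x::real. F (of_real x)) \<in> borel_measurable borel" "(\<lambda>x::real. S (of_real x)) \<in> borel_measurable borel"
    by (intro borel_measurable_continuous_onI PW_continuous[OF F], intro borel_measurable_continuous_onI PW_continuous[OF S(1)])
  have [measurable]: "(\<lambda>x::real. G n (of_real x)) \<in> borel_measurable borel" for n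
    by (intro borel_measurable_continuous_onI continuous_on_compose2[OF holomorphic_on_imp_continuous_on[OF holG]])
       (auto intro!: continuous_intros)
  have Fci: "integrable lborel (\<lambda>x. ?f (0 + (1 / c n) * x))" for n
    by (rule lborel_integrable_real_affine[OF Fi]) (use c[of n] in auto)
  have Sci: "integrable lborel (\<lambda>x. (norm (S (of_real (0 + (1 - 1 / c n) * x))))\<^sup>2)" for n
    by (rule lborel_integrable_real_affine[OF PW_D(3)[OF S(1)]]) (use c[of n] in auto)
  have G_real: "G n (of_real x) = F (of_real (0 + (1 / c n) * x)) * S (of_real (0 + (1 - 1 / c n) * x))" for n x
    by (simp add: G_def)
  have G2: "?g n x \<le> ?f (0 + (1 / c n) * x)" for n x
    unfolding G_real norm_mult power_mult_distrib
    by (intro mult_left_le power_le_one S(2)) auto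
  have Gi: "integrable lborel (?g n)" for n
    by (rule Bochner_Integration.integrable_bound[OF Fci[of n]]) (use G2[of n] in auto)
  have G1: "integrable lborel (\<lambda>x. G n (of_real x))" for n
  proof (rule Bochner_Integration.integrable_bound)
    show "integrable lborel (\<lambda>x. ?f (0 + (1 / c n) * x) + (norm (S (of_real (0 + (1 - 1 / c n) * x))))\<^sup>2)"
      by (rule Bochner_Integration.integrable_add[OF Fci Sci])
    have am: "p * q \<le> p\<^sup>2 + q\<^sup>2" if "p \<ge> 0" "q \<ge> 0" for p q :: real
      using sum_squares_bound[of p q] mult_nonneg_nonneg[OF that] by linarith
    show "AE x in lborel. norm (G n (of_real x)) \<le> norm (?f (0 + (1 / c n) * x) + (norm (S (of_real (0 + (1 - 1 / c n) * x))))\<^sup>2)"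
      unfolding G_real norm_mult
      by (intro AE_I2 order_trans[OF am]) auto
  qed measurable
  have GPW: "G n \<in> PW D" for n
  proof -
    have "exp_type_le (pi * D) (G n)"
      unfolding exp_type_le_def
    proof (intro allI impI)
      fix eps :: real assume eps: "eps > 0"
      obtain C where C: "\<And>z. norm (F z) \<le> C * exp ((pi * D + eps) * norm z)"
        using PW_D(2)[OF F] eps unfolding exp_type_le_def by blast
      have C0: "C \<ge> 0" using C[of 0] norm_ge_zero[of "F 0"] by (simp del: norm_ge_zero)
      have "norm (G n z) \<le> C * exp ((pi * D + eps) * norm z)" for z
      proof -
        let ?k = "1 / c n"
        have k: "0 < ?k" "?k < 1" using c[of n] by auto
        have "norm (G n z) \<le> (C * exp ((pi * D + eps) * (?k * norm z))) * exp (pi * D * ((1 - ?k) * norm z))"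
          unfolding G_def norm_mult
        proof (rule mult_mono)
          show "norm (F (of_real ?k * z)) \<le> C * exp ((pi * D + eps) * (?k * norm z))"
            using C[of "of_real ?k * z"] k unfolding norm_mult norm_of_real by (simp only: abs_of_pos)
          show "norm (S (of_real (1 - ?k) * z)) \<le> exp (pi * D * ((1 - ?k) * norm z))"
            using S(4)[of "of_real (1 - ?k) * z"] k unfolding norm_mult norm_of_real by simp
        qed (use C0 in auto)
        also have "\<dots> = C * exp ((pi * D + eps) * (?k * norm z) + pi * D * ((1 - ?k) * norm z))"
          by (simp only: exp_add mult.assoc)
        also have "\<dots> \<le> C * exp ((pi * D + eps) * norm z)"
        proof -
          have "eps * (?k * norm z) \<le> eps * norm z"
            using eps k by (intro mult_left_mono mult_left_le_one_le) auto
          moreover have "(pi * D + eps) * (?k * norm z) + pi * D * ((1 - ?k) * norm z) = pi * D * norm z + eps * (?k * norm z)"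
            by (simp only: ring_distribs mult_1)
          moreover have "(pi * D + eps) * norm z = pi * D * norm z + eps * norm z" by (simp only: ring_distribs)
          ultimately have "(pi * D + eps) * (?k * norm z) + pi * D * ((1 - ?k) * norm z) \<le> (pi * D + eps) * norm z"
            by (simp only: add_le_cancel_left)
          then show ?thesis using C0 by (intro mult_left_mono) auto
        qed
        finally show ?thesis .
      qed
      then show "\<exists>C. \<forall>z. norm (G n z) \<le> C * exp ((pi * D + eps) * norm z)" by blast
    qed
    then show ?thesis using holG Gi by (simp add: PW_def)
  qed
  \<comment> \<open>Used for the constant weight 1 and for \<open>sinc2\<close>; continuity is asked
    only off 0 because of the value of \<open>sinc2\<close> there.\<close>
  have lim: "(\<lambda>n. \<integral>x. ?g n x * w x \<partial>lborel) \<longlonglongrightarrow> (\<integral>x. ?f x * w x \<partial>lborel)"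
    if [measurable]: "w \<in> borel_measurable borel" and w1: "\<And>x. \<bar>w x\<bar> \<le> 1" and wc: "\<And>x. x \<noteq> 0 \<Longrightarrow> isCont w x" for w :: "real \<Rightarrow> real"
  proof -
    \<comment> \<open>Rescaling by \<open>c n\<close> leaves \<open>F\<close> undilated, so its
      squared modulus is a majorant independent of \<open>n\<close>.\<close>
    have eq: "(\<integral>x. ?g n x * w x \<partial>lborel) = c n * (\<integral>y. ?f y * (norm (S (of_real ((c n - 1) * y))))\<^sup>2 * w (c n * y) \<partial>lborel)" for n
    proof -
      have cn: "c n > 0" using c[of n] by simp
      have *: "of_real (1 - 1 / c n) * of_real (c n * y) = complex_of_real ((c n - 1) * y)" for y
        unfolding of_real_mult[symmetric] using cn by (simp add: field_simps)
      have **: "of_real (1 / c n) * of_real (c n * y) = complex_of_real y" for y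
        unfolding of_real_mult[symmetric] using cn by simp
      show ?thesis
        by (subst integral_rescale[OF cn]) (simp only: G_def * ** norm_mult power_mult_distrib)
    qed
    have "(\<lambda>n. \<integral>y. ?f y * (norm (S (of_real ((c n - 1) * y))))\<^sup>2 * w (c n * y) \<partial>lborel) \<longlonglongrightarrow> (\<integral>y. ?f y * w y \<partial>lborel)"
    proof (rule integral_dominated_convergence[OF _ _ Fi])
      show "(\<lambda>y. ?f y * (norm (S (of_real ((c n - 1) * y))))\<^sup>2 * w (c n * y)) \<in> borel_measurable lborel" for n by measurable
      show "AE y in lborel. norm (?f y * (norm (S (of_real ((c n - 1) * y))))\<^sup>2 * w (c n * y)) \<le> ?f y" for n
      proof (rule AE_I2)
        fix y
        have "(norm (S (of_real ((c n - 1) * y))))\<^sup>2 * \<bar>w (c n * y)\<bar> \<le> 1 * 1"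
          by (intro mult_mono power_le_one S(2) w1) auto
        then have "?f y * ((norm (S (of_real ((c n - 1) * y))))\<^sup>2 * \<bar>w (c n * y)\<bar>) \<le> ?f y"
          by (intro mult_left_le) auto
        then show "norm (?f y * (norm (S (of_real ((c n - 1) * y))))\<^sup>2 * w (c n * y)) \<le> ?f y"
          by (simp only: real_norm_def abs_mult abs_power2 mult.assoc)
      qed
      have "AE y in lborel. y \<noteq> (0::real)" by (rule AE_lborel_singleton)
      then show "AE y in lborel. (\<lambda>n. ?f y * (norm (S (of_real ((c n - 1) * y))))\<^sup>2 * w (c n * y)) \<longlonglongrightarrow> ?f y * w y"
      proof eventually_elim
        case (elim y)
        have "(\<lambda>n. (c n - 1) * y) \<longlonglongrightarrow> (1 - 1) * y" by (intro tendsto_intros clim)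
        then have 1: "(\<lambda>n. complex_of_real ((c n - 1) * y)) \<longlonglongrightarrow> 0"
          using tendsto_of_real by fastforce
        have "isCont S 0" using holomorphic_on_imp_continuous_on[OF PW_D(1)[OF S(1)]]
          by (simp add: continuous_on_eq_continuous_at)
        from isCont_tendsto_compose[OF this 1] have S1: "(\<lambda>n. S (of_real ((c n - 1) * y))) \<longlonglongrightarrow> 1" using S(3) by simp
        have "(\<lambda>n. c n * y) \<longlonglongrightarrow> 1 * y" by (intro tendsto_intros clim)
        then have w2: "(\<lambda>n. w (c n * y)) \<longlonglongrightarrow> w y" using isCont_tendsto_compose[OF wc[OF elim]] by simp
        have "(\<lambda>n. ?f y * (norm (S (of_real ((c n - 1) * y))))\<^sup>2 * w (c n * y)) \<longlonglongrightarrow> ?f y * (norm (1::complex))\<^sup>2 * w y"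
          by (intro tendsto_intros S1 w2)
        then show ?case by simp
      qed
    qed measurable
    from tendsto_mult[OF clim this] show ?thesis by (simp only: eq mult_1)
  qed
  have l1: "(\<lambda>n. \<integral>x. ?g n x \<partial>lborel) \<longlonglongrightarrow> (\<integral>x. ?f x \<partial>lborel)"
    using lim[of "\<lambda>_. 1"] by simp
  have l2: "(\<lambda>n. \<integral>x. ?g n x * sinc2 x \<partial>lborel) \<longlonglongrightarrow> (\<integral>x. ?f x * sinc2 x \<partial>lborel)"
    by (rule lim[OF measurable_sinc2 abs_sinc2_le])
       (auto simp: sinc2_def[abs_def] intro!: continuous_intros)
  have "(\<lambda>n. a * (\<integral>x. ?g n x \<partial>lborel) + b * (\<integral>x. ?g n x * sinc2 x \<partial>lborel)) \<longlonglongrightarrow>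
      a * (\<integral>x. ?f x \<partial>lborel) + b * (\<integral>x. ?f x * sinc2 x \<partial>lborel)"
    by (intro tendsto_intros l1 l2)
  then show ?thesis
    by (rule LIMSEQ_le_const) (use PW_integrable_form[OF GPW D G1 pos] in auto)
qed

section \<open>Norm ratios as Rayleigh quotients\<close>

lemma PW_norm_pos:
  assumes F: "F \<in> PW D" and nz: "F \<noteq> (\<lambda>_. 0)"
  shows "(\<integral>x. (norm (F (of_real x)))\<^sup>2 \<partial>lborel) > 0"
proof (rule ccontr)
  assume "\<not> ?thesis"
  moreover have "(\<integral>x. (norm (F (of_real x)))\<^sup>2 \<partial>lborel) \<ge> 0" by (intro integral_nonneg_AE) auto
  ultimately have "(\<integral>x. (norm (F (of_real x)))\<^sup>2 \<partial>lborel) = 0" by simp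
  then have ae: "AE x in lborel. (norm (F (complex_of_real x)))\<^sup>2 = 0"
    by (subst (asm) integral_nonneg_eq_0_iff_AE[OF PW_D(3)[OF F]]) auto
  have zero: "F (of_real x) = 0" for x :: real
  proof -
    have "closed {x::real. F (of_real x) = 0}"
      using continuous_closed_preimage_constant[OF PW_continuous[OF F] closed_UNIV, of 0] by simp
    moreover have "AE x in lborel. x \<in> {x::real. F (of_real x) = 0}" using ae by simp
    ultimately have "{x::real. F (of_real x) = 0} = UNIV"
      using mem_closed_if_AE_lebesgue[of "{x::real. F (of_real x) = 0}"] AE_completion by blast
    then show ?thesis by blast
  qed
  have "F z = 0" for z
  proof (rule analytic_continuation[OF PW_D(1)[OF F], of "range complex_of_real" 0])
    have "(0::real) islimpt UNIV" by (simp add: islimpt_UNIV_iff)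
    then show "(0::complex) islimpt range complex_of_real"
      using islimpt_isCont_image[of 0 UNIV complex_of_real] by (auto simp: eventually_at intro: zero_less_one)
  qed (use zero in auto)
  then show False using nz by auto
qed

lemma PW_ratio:
  assumes F: "F \<in> PW D" and nz: "F \<noteq> (\<lambda>_. 0)"
  shows "L2Wnorm F / L2norm F = sqrt (1 - (\<integral>x. (norm (F (of_real x)))\<^sup>2 * sinc2 x \<partial>lborel) / (\<integral>x. (norm (F (of_real x)))\<^sup>2 \<partial>lborel))"
proof -
  note p = PW_norm_pos[OF F nz] and i = PW_D(3)[OF F]
  have "(\<integral>x. (norm (F (of_real x)))\<^sup>2 * W x \<partial>lborel)
      = (\<integral>x. (norm (F (of_real x)))\<^sup>2 - (norm (F (of_real x)))\<^sup>2 * sinc2 x \<partial>lborel)"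
    by (intro Bochner_Integration.integral_cong refl) (simp add: W_def sinc2_def algebra_simps)
  also have "\<dots> = (\<integral>x. (norm (F (of_real x)))\<^sup>2 \<partial>lborel) - (\<integral>x. (norm (F (of_real x)))\<^sup>2 * sinc2 x \<partial>lborel)"
    by (rule Bochner_Integration.integral_diff[OF i integrable_mult_sinc2[OF i]])
  finally show ?thesis
    using p by (simp add: L2Wnorm_def L2norm_def real_sqrt_divide[symmetric] diff_divide_distrib)
qed

lemma ratio_attained:
  assumes g: "cpt_fun (D/2) g" and D: "D > 0" and nz: "sqnorm g \<noteq> 0" and e: "box_form g = m * sqnorm g"
  shows "sqrt (1 - m) \<in> ratios D"
proof -
  define h where "h x = complex_of_real (g x)" for x
  have h: "cpt_fun (D/2) h" unfolding h_def by (rule cpt_fun_of_real[OF g])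
  define F where "F = fourier_ext h"
  have F: "F \<in> PW D" using fourier_ext_PW[OF h] D by (simp add: F_def)
  have z: "sqnorm (\<lambda>x. 0) = 0" "box_form (\<lambda>x. 0) = 0" by (auto simp: sqnorm_def box_form_def)
  have 1: "(\<integral>x. (norm (F (of_real x)))\<^sup>2 \<partial>lborel) = sqnorm g"
    using integral_norm2_fourier[OF h] by (simp add: F_def fourier_ext_of_real h_def z)
  have 2: "(\<integral>x. (norm (F (of_real x)))\<^sup>2 * sinc2 x \<partial>lborel) = m * sqnorm g"
    using integral_sinc2_norm2_fourier[OF h] by (simp add: F_def fourier_ext_of_real h_def z e)
  have nzF: "F \<noteq> (\<lambda>_. 0)" using 1 nz by auto
  have "L2Wnorm F / L2norm F = sqrt (1 - m)"
    unfolding PW_ratio[OF F nzF] 1 2 using nz by simp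
  then show ?thesis unfolding ratios_def using F nzF by (metis (mono_tags, lifting) mem_Collect_eq)
qed

text \<open>The squared ratio is 1 minus the Rayleigh quotient, so the order is reversed: the
  maximum of the form gives the infimum of the ratios.\<close>

lemma Cminus_eq:
  assumes D: "D > 0" and g: "cpt_fun (D/2) g" "sqnorm g \<noteq> 0" "box_form g = m * sqnorm g"
    and max: "\<And>h. cpt_fun (D/2) h \<Longrightarrow> box_form h \<le> m * sqnorm h"
  shows "Cminus D = sqrt (1 - m)"
  unfolding Cminus_def
proof (rule cInf_eq_minimum)
  show "sqrt (1 - m) \<in> ratios D" by (rule ratio_attained[OF g(1) D g(2,3)])
  fix r assume "r \<in> ratios D"
  then obtain F where F: "F \<in> PW D" "F \<noteq> (\<lambda>_. 0)" and r: "r = L2Wnorm F / L2norm F"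
    unfolding ratios_def by blast
  have "0 \<le> m * (\<integral>x. (norm (F (of_real x)))\<^sup>2 \<partial>lborel) + (-1) * (\<integral>x. (norm (F (of_real x)))\<^sup>2 * sinc2 x \<partial>lborel)"
    by (rule PW_form[OF F(1) D]) (use max in auto)
  then show "sqrt (1 - m) \<le> r"
    unfolding r PW_ratio[OF F] using PW_norm_pos[OF F] by (simp add: pos_divide_le_eq)
qed

lemma Cplus_eq:
  assumes D: "D > 0" and g: "cpt_fun (D/2) g" "sqnorm g \<noteq> 0" "box_form g = m * sqnorm g"
    and min: "\<And>h. cpt_fun (D/2) h \<Longrightarrow> m * sqnorm h \<le> box_form h"
  shows "Cplus D = sqrt (1 - m)"
  unfolding Cplus_def
proof (rule cSup_eq_maximum)
  show "sqrt (1 - m) \<in> ratios D" by (rule ratio_attained[OF g(1) D g(2,3)])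
  fix r assume "r \<in> ratios D"
  then obtain F where F: "F \<in> PW D" "F \<noteq> (\<lambda>_. 0)" and r: "r = L2Wnorm F / L2norm F"
    unfolding ratios_def by blast
  have "0 \<le> (- m) * (\<integral>x. (norm (F (of_real x)))\<^sup>2 \<partial>lborel) + 1 * (\<integral>x. (norm (F (of_real x)))\<^sup>2 * sinc2 x \<partial>lborel)"
    by (rule PW_form[OF F(1) D]) (use min in auto)
  then show "r \<le> sqrt (1 - m)"
    unfolding r PW_ratio[OF F] using PW_norm_pos[OF F] by (simp add: pos_le_divide_eq)
qed

section \<open>Extremal eigenvalues of the box operator\<close>

lemma cpt_fun_lin:
  fixes f g :: "real \<Rightarrow> real"
  assumes "cpt_fun A f" "cpt_fun A g" shows "cpt_fun A (\<lambda>x. a * f x + b * g x)"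
  using assms by (auto simp: cpt_fun_def intro!: continuous_intros)

lemma box_op_lin:
  assumes f: "cpt_fun A f" and g: "cpt_fun A g"
  shows "box_op (\<lambda>x. a * f x + b * g x) s = a * box_op f s + b * box_op g s"
proof -
  note i = integrable_indicator_mult[OF cpt_fun_integrable[OF f], of "s-1" "s+1"]
    integrable_indicator_mult[OF cpt_fun_integrable[OF g], of "s-1" "s+1"]
  have "(\<integral>t. indicator {s-1..s+1} t * (a * f t + b * g t) \<partial>lborel)
     = (\<integral>t. a * (indicator {s-1..s+1} t * f t) + b * (indicator {s-1..s+1} t * g t) \<partial>lborel)"
    by (intro Bochner_Integration.integral_cong refl) (simp add: algebra_simps)
  also have "\<dots> = a * (\<integral>t. indicator {s-1..s+1} t * f t \<partial>lborel) + b * (\<integral>t. indicator {s-1..s+1} t * g t \<partial>lborel)"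
    using i by (subst Bochner_Integration.integral_add) auto
  finally show ?thesis by (simp add: box_op_def add_divide_distrib)
qed

lemma box_op_product_integrable:
  assumes f: "cpt_fun A f" and g: "cpt_fun A g"
  shows "integrable lborel (\<lambda>s. f s * box_op g s)"
  by (rule cpt_fun_integrable_mult_bounded[OF f box_op_measurable[OF g] box_op_bounded[OF g]])

lemma box_op_symmetric:
  assumes f: "cpt_fun A f" and g: "cpt_fun A g"
  shows "(\<integral>s. f s * box_op g s \<partial>lborel) = (\<integral>s. g s * box_op f s \<partial>lborel)"
proof -
  have [measurable]: "f \<in> borel_measurable borel" "g \<in> borel_measurable borel"
    using cpt_fun_borel f g by auto
  note fi = cpt_fun_integrable[OF f] and gi = cpt_fun_integrable[OF g]
  let ?k = "\<lambda>s t. f s * (indicator {s-1..s+1} t * g t / 2)"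
  have int: "integrable (lborel \<Otimes>\<^sub>M lborel) (case_prod ?k)"
  proof (rule lborel_pair.Fubini_integrable)
    have "(\<lambda>(s, t). f s * ((if s - 1 \<le> t \<and> t \<le> s + 1 then g t else 0) / 2)) \<in> borel_measurable (lborel \<Otimes>\<^sub>M lborel)"
      by measurable
    also have "(\<lambda>(s, t). f s * ((if s - 1 \<le> t \<and> t \<le> s + 1 then g t else 0) / 2)) = case_prod ?k"
      by (auto simp: indicator_def fun_eq_iff)
    finally show m[measurable]: "case_prod ?k \<in> borel_measurable (lborel \<Otimes>\<^sub>M lborel)" .
    have i: "integrable lborel (\<lambda>t. case_prod ?k (s, t))" for s
      using integrable_indicator_mult[OF gi] by simp
    then show "AE s in lborel. integrable lborel (\<lambda>t. case_prod ?k (s, t))" by auto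
    show "integrable lborel (\<lambda>s. \<integral>t. norm (case_prod ?k (s, t)) \<partial>lborel)"
    proof (rule Bochner_Integration.integrable_bound)
      let ?c = "(\<integral>t. \<bar>g t\<bar> \<partial>lborel)"
      show "integrable lborel (\<lambda>s. f s * ?c)" using fi by auto
      show "(\<lambda>s. \<integral>t. norm (case_prod ?k (s, t)) \<partial>lborel) \<in> borel_measurable lborel" by measurable
      show "AE s in lborel. norm (\<integral>t. norm (case_prod ?k (s, t)) \<partial>lborel) \<le> norm (f s * ?c)"
      proof (rule AE_I2)
        fix s
        have "(\<integral>t. norm (case_prod ?k (s, t)) \<partial>lborel) \<le> (\<integral>t. \<bar>f s\<bar> * \<bar>g t\<bar> \<partial>lborel)"
        proof (rule integral_mono[OF integrable_norm[OF i]])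
          fix t
          have "0 \<le> \<bar>f s\<bar> * \<bar>g t\<bar>" by simp
          then show "norm (case_prod ?k (s, t)) \<le> \<bar>f s\<bar> * \<bar>g t\<bar>"
            by (auto simp: abs_mult indicator_def)
        qed (use gi in auto)
        then show "norm (\<integral>t. norm (case_prod ?k (s, t)) \<partial>lborel) \<le> norm (f s * ?c)"
          by (simp add: abs_mult abs_of_nonneg integral_nonneg_AE)
      qed
    qed
  qed
  have "(\<integral>s. f s * box_op g s \<partial>lborel) = (\<integral>s. (\<integral>t. ?k s t \<partial>lborel) \<partial>lborel)"
    by (simp add: box_op_def)
  also have "\<dots> = (\<integral>t. (\<integral>s. ?k s t \<partial>lborel) \<partial>lborel)"
    by (rule lborel_pair.Fubini_integral[OF int, symmetric])
  also have "\<dots> = (\<integral>t. (\<integral>s. g t / 2 * (indicator {t-1..t+1} s * f s) \<partial>lborel) \<partial>lborel)"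
    by (intro Bochner_Integration.integral_cong refl) (auto simp: indicator_def)
  also have "\<dots> = (\<integral>s. g s * box_op f s \<partial>lborel)"
    by (simp add: box_op_def)
  finally show ?thesis .
qed

lemma sqnorm_eq: "sqnorm g = (\<integral>s. g s * g s \<partial>lborel)"
  by (simp add: sqnorm_def power2_eq_square)

lemma sqnorm_nonneg: "sqnorm g \<ge> 0"
  unfolding sqnorm_def by (intro integral_nonneg_AE) auto

lemma sqnorm_lin:
  assumes f: "cpt_fun A f" and g: "cpt_fun A g"
  shows "sqnorm (\<lambda>x. a * f x + b * g x) = a\<^sup>2 * sqnorm f + 2 * a * b * (\<integral>s. f s * g s \<partial>lborel) + b\<^sup>2 * sqnorm g"
proof -
  note i = cpt_fun_square_integrable[OF f f] cpt_fun_square_integrable[OF f g] cpt_fun_square_integrable[OF g g]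
  have "sqnorm (\<lambda>x. a * f x + b * g x) = (\<integral>s. a\<^sup>2 * (f s * f s) + 2 * a * b * (f s * g s) + b\<^sup>2 * (g s * g s) \<partial>lborel)"
    unfolding sqnorm_def by (intro Bochner_Integration.integral_cong refl) (simp add: power2_eq_square algebra_simps)
  also have "\<dots> = a\<^sup>2 * (\<integral>s. f s * f s \<partial>lborel) + 2 * a * b * (\<integral>s. f s * g s \<partial>lborel) + b\<^sup>2 * (\<integral>s. g s * g s \<partial>lborel)"
    using i by (subst Bochner_Integration.integral_add; simp)+
  finally show ?thesis by (simp add: sqnorm_eq)
qed

text \<open>From the parallelogram identity; it does the work of a triangle inequality.\<close>

lemma sqnorm_add_le:
  assumes f: "cpt_fun A f" and g: "cpt_fun A g"
  shows "sqnorm (\<lambda>x. f x + g x) \<le> 2 * sqnorm f + 2 * sqnorm g"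
proof -
  have "sqnorm (\<lambda>x. 1 * f x + 1 * g x) + sqnorm (\<lambda>x. 1 * f x + (-1) * g x) = 2 * sqnorm f + 2 * sqnorm g"
    unfolding sqnorm_lin[OF f g] by simp
  then show ?thesis using sqnorm_nonneg[of "\<lambda>x. 1 * f x + (-1) * g x"] by simp
qed

lemma box_form_lin:
  assumes f: "cpt_fun A f" and g: "cpt_fun A g"
  shows "box_form (\<lambda>x. a * f x + b * g x) = a\<^sup>2 * box_form f + 2 * a * b * (\<integral>s. g s * box_op f s \<partial>lborel) + b\<^sup>2 * box_form g"
proof -
  note i = box_op_product_integrable[OF f f] box_op_product_integrable[OF f g] box_op_product_integrable[OF g f] box_op_product_integrable[OF g g]
  have "box_form (\<lambda>x. a * f x + b * g x) = (\<integral>s. a\<^sup>2 * (f s * box_op f s) + a * b * (f s * box_op g s) + a * b * (g s * box_op f s) + b\<^sup>2 * (g s * box_op g s) \<partial>lborel)"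
    unfolding box_form_def box_op_lin[OF f g]
    by (intro Bochner_Integration.integral_cong refl) (simp add: power2_eq_square algebra_simps)
  also have "\<dots> = a\<^sup>2 * box_form f + a * b * (\<integral>s. f s * box_op g s \<partial>lborel) + a * b * (\<integral>s. g s * box_op f s \<partial>lborel) + b\<^sup>2 * box_form g"
    using i unfolding box_form_def by (subst Bochner_Integration.integral_add; simp)+
  finally show ?thesis by (simp add: box_op_symmetric[OF f g])
qed

text \<open>The inequality \<open>2 \<bar>g\<bar> \<le> e + g\<^sup>2 / e\<close> with a free parameter \<open>e\<close> replaces the Cauchy--Schwarz inequality.\<close>

lemma integral_interval_abs_le:
  assumes g: "cpt_fun A g" and e: "e > 0" and ab: "a \<le> b"
  shows "(\<integral>t. indicator {a..b} t * \<bar>g t\<bar> \<partial>lborel) \<le> (e * (b - a) + sqnorm g / e) / 2"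
proof -
  have i: "integrable lborel (\<lambda>t. (g t)\<^sup>2)"
    using cpt_fun_square_integrable[OF g g] by (simp add: power2_eq_square)
  have i1: "integrable lborel (\<lambda>t. e / 2 * indicator {a..b} t)"
    using ab by (intro integrable_mult_right integrable_real_indicator) auto
  have i2: "integrable lborel (\<lambda>t. (g t)\<^sup>2 / (2 * e))" using i by simp
  have "(\<integral>t. indicator {a..b} t * \<bar>g t\<bar> \<partial>lborel) \<le> (\<integral>t. e / 2 * indicator {a..b} t + (g t)\<^sup>2 / (2 * e) \<partial>lborel)"
  proof (rule integral_mono)
    show "integrable lborel (\<lambda>t. indicator {a..b} t * \<bar>g t\<bar>)"
      using cpt_fun_integrable[OF g] by (intro integrable_indicator_mult) auto
    show "integrable lborel (\<lambda>t. e / 2 * indicator {a..b} t + (g t)\<^sup>2 / (2 * e))"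
      by (rule Bochner_Integration.integrable_add[OF i1 i2])
    fix t
    have "0 \<le> (e - \<bar>g t\<bar>)\<^sup>2 / (2 * e)" using e by simp
    also have "\<dots> = e / 2 - \<bar>g t\<bar> + (g t)\<^sup>2 / (2 * e)"
      using e by (simp add: power2_diff field_simps power2_eq_square)
    finally have "\<bar>g t\<bar> \<le> e / 2 + (g t)\<^sup>2 / (2 * e)" by simp
    then show "indicator {a..b} t * \<bar>g t\<bar> \<le> e / 2 * indicator {a..b} t + (g t)\<^sup>2 / (2 * e)"
      using e by (auto simp: indicator_def)
  qed
  also have "\<dots> = e / 2 * (b - a) + sqnorm g / (2 * e)"
    using ab by (subst Bochner_Integration.integral_add[OF i1 i2]) (simp add: sqnorm_def)
  finally show ?thesis by (simp add: field_simps)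
qed

lemma box_op_abs_le:
  assumes g: "cpt_fun A g" and e: "e > 0"
  shows "\<bar>box_op g s\<bar> \<le> (2 * e + sqnorm g / e) / 4"
proof -
  note gi = cpt_fun_integrable[OF g]
  have "norm (\<integral>t. indicator {s-1..s+1} t * g t \<partial>lborel) \<le> (\<integral>t. indicator {s-1..s+1} t * \<bar>g t\<bar> \<partial>lborel)"
    by (rule Bochner_Integration.integral_norm_bound_integral)
       (use gi in \<open>auto intro!: integrable_indicator_mult simp: abs_mult\<close>)
  also have "\<dots> \<le> (e * ((s+1) - (s-1)) + sqnorm g / e) / 2"
    by (rule integral_interval_abs_le[OF g e]) simp
  finally show ?thesis by (simp add: box_op_def)
qed

text \<open>Two windows differ only near their endpoints, within intervals of radius
  \<open>\<bar>s - s'\<bar>\<close>. Choosing \<open>e\<close> large and then the points close makes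
  the bound small in terms of \<open>sqnorm g\<close> alone: this is the equicontinuity behind
  compactness.\<close>

lemma box_op_diff_le:
  assumes g: "cpt_fun A g" and e: "e > 0"
  shows "\<bar>box_op g s - box_op g s'\<bar> \<le> e * \<bar>s - s'\<bar> + sqnorm g / (2 * e)"
proof -
  define d where "d = \<bar>s - s'\<bar>"
  note gi = cpt_fun_integrable[OF g]
  note i = integrable_indicator_mult[OF gi, of "s-1" "s+1"] integrable_indicator_mult[OF gi, of "s'-1" "s'+1"]
  have gi': "integrable lborel (\<lambda>t. \<bar>g t\<bar>)" using gi by auto
  note j = integrable_indicator_mult[OF gi', of "s-1-d" "s-1+d"] integrable_indicator_mult[OF gi', of "s+1-d" "s+1+d"]
  have "2 * \<bar>box_op g s - box_op g s'\<bar> = norm ((\<integral>t. indicator {s-1..s+1} t * g t \<partial>lborel) - (\<integral>t. indicator {s'-1..s'+1} t * g t \<partial>lborel))"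
    by (simp add: box_op_def diff_divide_distrib[symmetric])
  also have "\<dots> = norm (\<integral>t. indicator {s-1..s+1} t * g t - indicator {s'-1..s'+1} t * g t \<partial>lborel)"
    by (subst Bochner_Integration.integral_diff[OF i]) simp
  also have "\<dots> \<le> (\<integral>t. indicator {s-1-d..s-1+d} t * \<bar>g t\<bar> + indicator {s+1-d..s+1+d} t * \<bar>g t\<bar> \<partial>lborel)"
  proof (rule Bochner_Integration.integral_norm_bound_integral)
    fix t
    have "\<bar>indicator {s-1..s+1} t - indicator {s'-1..s'+1} t\<bar> \<le> (indicator {s-1-d..s-1+d} t + indicator {s+1-d..s+1+d} t :: real)"
      unfolding d_def indicator_def by auto
    from mult_right_mono[OF this, of "\<bar>g t\<bar>"]
    show "norm (indicator {s-1..s+1} t * g t - indicator {s'-1..s'+1} t * g t) \<le> indicator {s-1-d..s-1+d} t * \<bar>g t\<bar> + indicator {s+1-d..s+1+d} t * \<bar>g t\<bar>"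
      by (simp add: left_diff_distrib[symmetric] abs_mult distrib_right)
  qed (use i j in auto)
  also have "\<dots> = (\<integral>t. indicator {s-1-d..s-1+d} t * \<bar>g t\<bar> \<partial>lborel) + (\<integral>t. indicator {s+1-d..s+1+d} t * \<bar>g t\<bar> \<partial>lborel)"
    by (rule Bochner_Integration.integral_add[OF j])
  also have "\<dots> \<le> (e * ((s-1+d) - (s-1-d)) + sqnorm g / e) / 2 + (e * ((s+1+d) - (s+1-d)) + sqnorm g / e) / 2"
    by (intro add_mono integral_interval_abs_le[OF g e]) (auto simp: d_def)
  also have "\<dots> = 2 * (e * d + sqnorm g / (2 * e))" using e by (simp add: field_simps)
  finally show ?thesis by (simp add: d_def)
qed

lemma box_op_continuous:
  assumes g: "cpt_fun A g" shows "continuous_on S (box_op g)"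
  unfolding continuous_on_iff
proof (intro ballI allI impI)
  fix s e :: real assume e: "e > 0"
  \<comment> \<open>Makes the second term of \<open>box_op_diff_le\<close> less than
    \<open>e / 2\<close>; the added 1 keeps \<open>k\<close> positive and the bound strict when
    \<open>sqnorm g\<close> is 0.\<close>
  define k where "k = (sqnorm g + 1) / e"
  have k: "k > 0" "sqnorm g / (2 * k) < e / 2" "k > 0"
    using e sqnorm_nonneg[of g] by (auto simp: k_def field_simps add_nonneg_pos)
  show "\<exists>d>0. \<forall>s'\<in>S. dist s' s < d \<longrightarrow> dist (box_op g s') (box_op g s) < e"
  proof (intro exI[of _ "e / (2 * k)"] conjI ballI impI)
    show "e / (2 * k) > 0" using k e by simp
    fix s' assume "dist s' s < e / (2 * k)"
    then have "k * \<bar>s' - s\<bar> < e / 2" using k by (simp add: dist_real_def field_simps)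
    then show "dist (box_op g s') (box_op g s) < e"
      using box_op_diff_le[OF g k(1), of s' s] k by (simp add: dist_real_def)
  qed
qed

text \<open>\<open>box_op g\<close> may be nonzero up to distance 1 outside the interval and so
  leaves the function class; T on the interval is its restriction. Inner products with functions
  supported in the interval do not see the difference.\<close>

definition box_res :: "real \<Rightarrow> (real \<Rightarrow> real) \<Rightarrow> real \<Rightarrow> real" where
  "box_res A g s = (if s \<in> {-A..A} then box_op g s else 0)"

lemma cpt_fun_restrict:
  assumes "continuous_on {-A..A} h"
  shows "cpt_fun A (\<lambda>s. if s \<in> {-A..A} then h s else 0)"
proof -
  have "continuous_on {-A..A} (\<lambda>s. if s \<in> {-A..A} then h s else 0) \<longleftrightarrow> continuous_on {-A..A} h"
    by (rule continuous_on_cong) auto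
  then show ?thesis using assms by (auto simp: cpt_fun_def)
qed

lemma cpt_fun_box_res:
  assumes "cpt_fun A g" shows "cpt_fun A (box_res A g)"
  unfolding box_res_def by (rule cpt_fun_restrict[OF box_op_continuous[OF assms]])

lemma integral_box_res:
  assumes "cpt_fun A f"
  shows "(\<integral>s. f s * box_res A g s \<partial>lborel) = (\<integral>s. f s * box_op g s \<partial>lborel)"
  using assms by (intro Bochner_Integration.integral_cong refl) (auto simp: box_res_def cpt_fun_def)

text \<open>A crude bound: it makes the supremum of the form finite and bounds \<open>M\<close>
  minus T from above.\<close>

lemma box_form_abs_le:
  assumes g: "cpt_fun A g" and A: "A \<ge> 0"
  shows "\<bar>box_form g\<bar> \<le> (2 * A + 1)\<^sup>2 * sqnorm g"
proof -
  note gi = cpt_fun_integrable[OF g]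
  define N where "N = (\<integral>t. \<bar>g t\<bar> \<partial>lborel)"
  have N0: "N \<ge> 0" unfolding N_def by (intro integral_nonneg_AE) auto
  have "N = (\<integral>t. indicator {-A..A} t * \<bar>g t\<bar> \<partial>lborel)"
    unfolding N_def using g by (intro Bochner_Integration.integral_cong refl) (auto simp: indicator_def cpt_fun_def)
  then have Ne: "N \<le> (e * (2 * A) + sqnorm g / e) / 2" if "e > 0" for e
    using integral_interval_abs_le[OF g that, of "-A" A] A by simp
  have "N\<^sup>2 \<le> (2 * A + 1)\<^sup>2 * sqnorm g"
  proof (cases "N = 0")
    case False
    define L where "L = 2 * A + 1"
    have L: "L > 0" using A by (simp add: L_def)
    \<comment> \<open>With this parameter in \<open>Ne\<close>, the term from the length of the
      interval is absorbed by one of the two copies of \<open>N\<close> on the left.\<close>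
    have e: "N / L > 0" using False N0 L by simp
    have "N * 2 \<le> N / L * (2 * A) + sqnorm g / (N / L)" using Ne[OF e] by simp
    moreover have "N / L * (2 * A) \<le> N" using N0 L A by (simp add: field_simps L_def mult_left_mono)
    ultimately have "N \<le> sqnorm g * L / N" by simp
    then have "N\<^sup>2 \<le> L * sqnorm g"
      using False N0 by (simp add: field_simps power2_eq_square)
    also have "L * sqnorm g \<le> L\<^sup>2 * sqnorm g"
      using sqnorm_nonneg A by (intro mult_right_mono) (auto simp: L_def power2_eq_square)
    finally show ?thesis by (simp add: L_def)
  qed (use sqnorm_nonneg in auto)
  moreover have "\<bar>box_form g\<bar> \<le> N\<^sup>2"
  proof -
    have "norm (box_form g) \<le> (\<integral>s. \<bar>g s\<bar> * N \<partial>lborel)"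
      unfolding box_form_def
    proof (rule Bochner_Integration.integral_norm_bound_integral[OF box_op_product_integrable[OF g g]])
      fix s
      have "\<bar>box_op g s\<bar> \<le> N" using box_op_bounded[OF g, of s] N0 unfolding N_def by linarith
      then show "norm (g s * box_op g s) \<le> \<bar>g s\<bar> * N" by (auto simp: abs_mult intro: mult_left_mono)
    qed (use gi in auto)
    then show ?thesis by (simp add: N_def power2_eq_square)
  qed
  ultimately show ?thesis by simp
qed

text \<open>The supremum \<open>M\<close> of the quadratic form is attained: for a maximising sequence \<open>g\<^sub>n\<close> the residual
  \<open>M g\<^sub>n - T g\<^sub>n\<close> tends to 0 because \<open>M - T\<close> is positive semidefinite, while \<open>T g\<^sub>n\<close> is equicontinuous.\<close>

lemma box_form_max_attained:
  fixes sg :: real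
  assumes A: "A > 0" and sg: "sg = 1 \<or> sg = -1"
    and g0: "cpt_fun A g0" "sg * box_form g0 > 0"
  obtains M \<phi> where "M > 0" "cpt_fun A \<phi>" "sqnorm \<phi> \<noteq> 0"
    "\<And>s. s \<in> {-A..A} \<Longrightarrow> sg * box_op \<phi> s = M * \<phi> s"
    "\<And>g. cpt_fun A g \<Longrightarrow> sg * box_form g \<le> M * sqnorm g"
proof -
  define K where "K = (2 * A + 1)\<^sup>2"
  \<comment> \<open>The sign lets one argument, applied to T and to -T, produce the maximum and the
    minimum.\<close>
  have sg2: "sg * sg = 1" "\<bar>sg\<bar> = 1" using sg by auto
  have K: "sg * box_form g \<le> K * sqnorm g" "- sg * box_form g \<le> K * sqnorm g" if "cpt_fun A g" for g
    using box_form_abs_le[OF that] A sg by (auto simp: K_def abs_le_iff)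
  have K0: "K > 0" using A by (simp add: K_def)
  define X where "X = {sg * box_form g | g. cpt_fun A g \<and> sqnorm g = 1}"
  define M where "M = Sup X"
  have bdd: "bdd_above X" unfolding X_def by (rule bdd_aboveI[of _ K]) (use K(1) in fastforce)
  have scale: "sg * box_form g / sqnorm g \<in> X" if g: "cpt_fun A g" "sqnorm g > 0" for g
  proof -
    define c where "c = 1 / sqrt (sqnorm g)"
    have c2: "c\<^sup>2 = 1 / sqnorm g" using g(2) by (simp add: c_def power_divide)
    have "cpt_fun A (\<lambda>x. c * g x + 0 * g x)" by (rule cpt_fun_lin[OF g(1) g(1)])
    moreover have "sqnorm (\<lambda>x. c * g x + 0 * g x) = 1"
      unfolding sqnorm_lin[OF g(1) g(1)] using g(2) by (simp add: c2)
    moreover have "sg * box_form (\<lambda>x. c * g x + 0 * g x) = sg * box_form g / sqnorm g"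
      unfolding box_form_lin[OF g(1) g(1)] by (simp add: c2)
    ultimately show ?thesis unfolding X_def mem_Collect_eq by metis
  qed
  have le: "sg * box_form g \<le> M * sqnorm g" if g: "cpt_fun A g" for g
  proof (cases "sqnorm g = 0")
    case True then show ?thesis using K(1)[OF g] by simp
  next
    case False
    then have p: "sqnorm g > 0" using sqnorm_nonneg[of g] by simp
    have "sg * box_form g / sqnorm g \<le> M" unfolding M_def by (rule cSup_upper[OF scale[OF g p] bdd])
    then show ?thesis using p by (simp add: pos_divide_le_eq)
  qed
  have "sqnorm g0 \<noteq> 0"
  proof
    assume "sqnorm g0 = 0"
    then show False using K(1)[OF g0(1)] g0(2) by simp
  qed
  then have n0: "sqnorm g0 > 0" using sqnorm_nonneg[of g0] by linarith
  have "sg * box_form g0 / sqnorm g0 \<le> M" unfolding M_def by (rule cSup_upper[OF scale[OF g0(1) n0] bdd])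
  moreover have "sg * box_form g0 / sqnorm g0 > 0" by (rule divide_pos_pos[OF g0(2) n0])
  ultimately have M: "M > 0" by linarith
  have "\<exists>g. cpt_fun A g \<and> sqnorm g = 1 \<and> M - inverse (real (Suc n)) < sg * box_form g" for n
  proof -
    have "M - inverse (real (Suc n)) < Sup X" by (simp add: M_def)
    moreover have "X \<noteq> {}" using scale[OF g0(1) n0] by auto
    ultimately obtain x where "x \<in> X" "M - inverse (real (Suc n)) < x"
      using less_cSup_iff[OF _ bdd] by blast
    then show ?thesis by (auto simp: X_def)
  qed
  then obtain G where G: "\<And>n. cpt_fun A (G n)" "\<And>n. sqnorm (G n) = 1" "\<And>n. M - inverse (real (Suc n)) < sg * box_form (G n)"
    by metis
  define R where "R n = (\<lambda>x. M * G n x + (- sg) * box_res A (G n) x)" for n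
  have R: "cpt_fun A (R n)" for n
    unfolding R_def by (rule cpt_fun_lin[OF G(1) cpt_fun_box_res[OF G(1)]])
  define L where "L = M + K"
  have L: "L > 0" using M K0 by (simp add: L_def)
  have Rn: "sqnorm (R n) \<le> L * inverse (real (Suc n))" for n
  proof -
    \<comment> \<open>Put B = M - sg T on the interval, so that R = B G and B lies between 0 and L
      as a form. Testing positivity of B on G - t R gives 2 t |R|^2 \<le> <B G, G> + t^2 L |R|^2;
      with t = 1/L this is |R|^2 \<le> L <B G, G>.\<close>
    define t where "t = 1 / L"
    have t: "t > 0" using L by (simp add: t_def)
    have ip: "(\<integral>s. G n s * R n s \<partial>lborel) * M - sg * (\<integral>s. R n s * box_op (G n) s \<partial>lborel) = sqnorm (R n)"
    proof -
      have "sqnorm (R n) = (\<integral>s. M * (R n s * G n s) + (- sg) * (R n s * box_res A (G n) s) \<partial>lborel)"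
        unfolding sqnorm_eq by (intro Bochner_Integration.integral_cong refl) (simp add: R_def algebra_simps)
      also have "\<dots> = M * (\<integral>s. R n s * G n s \<partial>lborel) + (- sg) * (\<integral>s. R n s * box_res A (G n) s \<partial>lborel)"
        using cpt_fun_square_integrable[OF R[of n] G(1)[of n]] cpt_fun_square_integrable[OF R[of n] cpt_fun_box_res[OF G(1)[of n]]]
        by (subst Bochner_Integration.integral_add) auto
      finally show ?thesis by (simp add: integral_box_res[OF R] mult.commute)
    qed
    have h: "cpt_fun A (\<lambda>x. 1 * G n x + (- t) * R n x)" by (rule cpt_fun_lin[OF G(1) R])
    have "sg * (box_form (G n) - 2 * t * (\<integral>s. R n s * box_op (G n) s \<partial>lborel) + t\<^sup>2 * box_form (R n))
      \<le> M * (1 - 2 * t * (\<integral>s. G n s * R n s \<partial>lborel) + t\<^sup>2 * sqnorm (R n))"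
      using le[OF h] unfolding box_form_lin[OF G(1) R] sqnorm_lin[OF G(1) R] by (simp add: G(2))
    then have "2 * t * ((\<integral>s. G n s * R n s \<partial>lborel) * M - sg * (\<integral>s. R n s * box_op (G n) s \<partial>lborel))
       \<le> (M - sg * box_form (G n)) + t\<^sup>2 * (M * sqnorm (R n) - sg * box_form (R n))"
      by (simp add: algebra_simps)
    also have "t\<^sup>2 * (M * sqnorm (R n) - sg * box_form (R n)) \<le> t\<^sup>2 * (L * sqnorm (R n))"
      using K(2)[OF R[of n]] by (intro mult_left_mono) (auto simp: L_def algebra_simps)
    also have "t\<^sup>2 * (L * sqnorm (R n)) = t * sqnorm (R n)"
      using L by (simp add: t_def power2_eq_square)
    finally have "t * sqnorm (R n) \<le> M - sg * box_form (G n)" unfolding ip by simp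
    also have "\<dots> \<le> inverse (real (Suc n))" using G(3)[of n] by simp
    finally have "sqnorm (R n) / L \<le> inverse (real (Suc n))" by (simp add: t_def)
    then have "sqnorm (R n) \<le> inverse (real (Suc n)) * L" using L by (subst (asm) pos_divide_le_eq) auto
    then show ?thesis by (simp only: mult.commute)
  qed
  obtain h k where h: "continuous_on {-A..A} h" and k: "strict_mono (k :: nat \<Rightarrow> nat)"
    and conv: "\<And>e. 0 < e \<Longrightarrow> \<exists>N. \<forall>n x. n \<ge> N \<and> x \<in> {-A..A} \<longrightarrow> norm (box_op (G (k n)) x - h x) < e"
  \<comment> \<open>The bound 3/4 is \<open>box_op_abs_le\<close> at parameter 1 for functions of
    unit norm.\<close>
  proof (rule Arzela_Ascoli[of "{-A..A}" "\<lambda>n. box_op (G n)" "3 / 4"])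
    show "norm (box_op (G n) x) \<le> 3 / 4" for n x
      using box_op_abs_le[OF G(1), of 1 n x] by (simp add: G(2))
    show "\<exists>d>0. \<forall>n y. y \<in> {-A..A} \<and> norm (x - y) < d \<longrightarrow> norm (box_op (G n) x - box_op (G n) y) < e" if e: "e > 0" for x e
    \<comment> \<open>\<open>box_op_diff_le\<close> at parameter \<open>1 / e\<close> costs
      \<open>e / 2\<close> for the norm term, and this radius keeps the other term below
      \<open>e / 2\<close>.\<close>
    proof (intro exI[of _ "e\<^sup>2 / 2"] conjI allI impI)
      show "e\<^sup>2 / 2 > 0" using e by simp
      fix n y assume "y \<in> {-A..A} \<and> norm (x - y) < e\<^sup>2 / 2"
      then have "(1 / e) * \<bar>x - y\<bar> < (1 / e) * (e\<^sup>2 / 2)" using e by (intro mult_strict_left_mono) auto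
      moreover have "(1 / e) * (e\<^sup>2 / 2) = e / 2" using e by (simp add: power2_eq_square)
      ultimately show "norm (box_op (G n) x - box_op (G n) y) < e"
        using box_op_diff_le[OF G(1), of "1 / e" n x y] e by (simp add: G(2))
    qed
  qed auto
  \<comment> \<open>The residual of \<open>G n\<close> tends to 0, so \<open>M\<close> times
    \<open>G (k n)\<close> is close to \<open>sg\<close> times its image, whose uniform limit is
    \<open>h\<close>.\<close>
  define \<phi> where "\<phi> = (\<lambda>s. if s \<in> {-A..A} then sg * h s / M else 0)"
  have \<phi>: "cpt_fun A \<phi>"
    unfolding \<phi>_def by (rule cpt_fun_restrict) (intro continuous_intros h, use M in auto)
  define E where "E n = (\<lambda>x. 1 * G (k n) x + (-1) * \<phi> x)" for n
  have E: "cpt_fun A (E n)" for n unfolding E_def by (rule cpt_fun_lin[OF G(1) \<phi>])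
  have small: "\<exists>N. \<forall>n\<ge>N. sqnorm (E n) < e" if e: "e > 0" for e
  proof -
    \<comment> \<open>Solves 2 A (d/M)^2 = e/8, where 2 A is the length of the interval.\<close>
    define d where "d = sqrt (e * M\<^sup>2 / (16 * A))"
    have d: "d > 0" "d\<^sup>2 = e * M\<^sup>2 / (16 * A)" using e A M by (auto simp: d_def)
    obtain N1 where N1: "\<And>n x. n \<ge> N1 \<Longrightarrow> x \<in> {-A..A} \<Longrightarrow> \<bar>box_op (G (k n)) x - h x\<bar> < d"
      using conv[OF d(1)] by (auto simp: real_norm_def)
    obtain N2 where N2: "8 * L / (e * M\<^sup>2) < real N2" using reals_Archimedean2 by blast
    have "sqnorm (E n) < e" if n: "n \<ge> max N1 N2" for n
    proof -
      \<comment> \<open>The error splits into the residual divided by \<open>M\<close>, small in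
        norm, and the deviation of the image from \<open>h\<close>, small uniformly.\<close>
      define U where "U = (\<lambda>x. (1 / M) * R (k n) x + 0 * R (k n) x)"
      define V where "V = (\<lambda>x. if x \<in> {-A..A} then (sg / M) * (box_op (G (k n)) x - h x) else 0)"
      have U: "cpt_fun A U" unfolding U_def by (rule cpt_fun_lin[OF R R])
      have V: "cpt_fun A V" unfolding V_def by (rule cpt_fun_restrict) (intro continuous_intros h box_op_continuous[OF G(1)])
      have EUV: "E n = (\<lambda>x. U x + V x)"
      proof
        fix x
        show "E n x = U x + V x"
          using M G(1)[of "k n"] by (auto simp: E_def U_def V_def \<phi>_def R_def box_res_def cpt_fun_def field_simps)
      qed
      have "k n \<ge> n" using k by (rule seq_suble)
      have "sqnorm U = sqnorm (R (k n)) / M\<^sup>2"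
        unfolding U_def sqnorm_lin[OF R R] by (simp add: power_divide)
      also have "\<dots> \<le> L * inverse (real (Suc (k n))) / M\<^sup>2"
        by (intro divide_right_mono Rn) auto
      also have "\<dots> < e / 8"
      proof -
        have "8 * L / (e * M\<^sup>2) < real (Suc (k n))" using N2 n \<open>k n \<ge> n\<close> by linarith
        then have "8 * L < real (Suc (k n)) * (e * M\<^sup>2)" using e M by (subst (asm) pos_divide_less_eq) auto
        then have "L < e / 8 * (real (Suc (k n)) * M\<^sup>2)" by (simp add: mult_ac del: of_nat_Suc)
        then have "L / (real (Suc (k n)) * M\<^sup>2) < e / 8" using M by (subst pos_divide_less_eq) auto
        then show ?thesis by (simp only: divide_inverse inverse_mult_distrib mult.assoc)
      qed
      finally have Un: "sqnorm U < e / 8" .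
      have "sqnorm V \<le> (\<integral>x. indicator {-A..A} x * (d / M)\<^sup>2 \<partial>lborel)"
        unfolding sqnorm_def
      proof (rule integral_mono)
        show "integrable lborel (\<lambda>x. (V x)\<^sup>2)" using cpt_fun_square_integrable[OF V V] by (simp add: power2_eq_square)
        show "integrable lborel (\<lambda>x. indicator {-A..A} x * (d / M)\<^sup>2)" 
          using A by (intro integrable_mult_left integrable_real_indicator) auto
        show "(V x)\<^sup>2 \<le> indicator {-A..A} x * (d / M)\<^sup>2" for x
        proof (cases "x \<in> {-A..A}")
          case True
          have "\<bar>V x\<bar> = \<bar>box_op (G (k n)) x - h x\<bar> / M"
            using True M sg2(2) by (simp add: V_def abs_mult abs_divide)
          also have "\<dots> \<le> d / M" using N1[of n x] True n M by (intro divide_right_mono) auto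
          finally have "\<bar>V x\<bar>\<^sup>2 \<le> (d / M)\<^sup>2" by (rule power_mono) simp
          then show ?thesis using True by simp
        next
          case False
          then have "V x = 0" unfolding V_def by (rule if_not_P)
          then show ?thesis by simp
        qed
      qed
      also have "\<dots> = e / 8" using A M by (simp add: power_divide d(2) field_simps)
      finally have "sqnorm V \<le> e / 8" .
      then show ?thesis using Un sqnorm_add_le[OF U V] e unfolding EUV by simp
    qed
    then show ?thesis by blast
  qed
  have eig: "sg * box_op \<phi> s = M * \<phi> s" if s: "s \<in> {-A..A}" for s
  proof -
    have "\<bar>box_op \<phi> s - h s\<bar> \<le> 0 + e" if e: "e > 0" for e
    proof -
      obtain N1 where N1: "\<And>n x. n \<ge> N1 \<Longrightarrow> x \<in> {-A..A} \<Longrightarrow> \<bar>box_op (G (k n)) x - h x\<bar> < e / 4"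
        using conv[of "e / 4"] e by (auto simp: real_norm_def)
      \<comment> \<open>Then \<open>box_op_abs_le\<close> at parameter \<open>e\<close> contributes
        at most \<open>3 / 4\<close> of \<open>e\<close>; the uniform limit above has
        \<open>e / 4\<close> left.\<close>
      obtain N2 where N2: "\<And>n. n \<ge> N2 \<Longrightarrow> sqnorm (E n) < e\<^sup>2" using small[of "e\<^sup>2"] e by auto
      define n where "n = max N1 N2"
      have "box_op (E n) s = box_op (G (k n)) s - box_op \<phi> s"
        unfolding E_def box_op_lin[OF G(1) \<phi>] by simp
      moreover have "\<bar>box_op (E n) s\<bar> \<le> (2 * e + sqnorm (E n) / e) / 4"
        by (rule box_op_abs_le[OF E e])
      moreover have "sqnorm (E n) / e \<le> e"
      proof -
        have "sqnorm (E n) \<le> e * e" using N2[of n] by (simp add: n_def power2_eq_square)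
        then show ?thesis using e by (simp add: pos_divide_le_eq)
      qed
      moreover have "\<bar>box_op (G (k n)) s - h s\<bar> < e / 4" using N1[of n s] s by (simp add: n_def)
      moreover have "\<bar>x - z\<bar> \<le> \<bar>y - x\<bar> + \<bar>y - z\<bar>" for x y z :: real by arith
      from this[of "box_op \<phi> s" "h s" "box_op (G (k n)) s"]
      have "\<bar>box_op \<phi> s - h s\<bar> \<le> \<bar>box_op (G (k n)) s - box_op \<phi> s\<bar> + \<bar>box_op (G (k n)) s - h s\<bar>" .
      ultimately show ?thesis by simp
    qed
    then have "\<bar>box_op \<phi> s - h s\<bar> \<le> 0" by (rule field_le_epsilon)
    then show ?thesis using s M by (simp add: \<phi>_def)
  qed
  have "sqnorm \<phi> \<noteq> 0"
  proof
    assume z: "sqnorm \<phi> = 0"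
    obtain N where N: "\<And>n. n \<ge> N \<Longrightarrow> sqnorm (E n) < 1 / 4" using small[of "1/4"] by auto
    have "G (k N) = (\<lambda>x. E N x + \<phi> x)" by (auto simp: E_def)
    then have "sqnorm (G (k N)) \<le> 2 * sqnorm (E N) + 2 * sqnorm \<phi>" using sqnorm_add_le[OF E[of N] \<phi>] by simp
    then show False using N[of N] z G(2) by simp
  qed
  then show thesis using that[OF M \<phi> _ eig le] by blast
qed

section \<open>The eigenvalue equation\<close>

lemma sqnorm_eq_0D:
  assumes g: "cpt_fun A g" and z: "sqnorm g = 0" and s: "s \<in> {-A..A}" and A: "A > 0"
  shows "g s = 0"
proof -
  have cg: "continuous_on {-A..A} g" using g by (simp add: cpt_fun_def)
  have c: "continuous_on (cbox (-A) A) (\<lambda>x. (g x)\<^sup>2)" using cg by (auto intro!: continuous_intros)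
  have si: "set_integrable lborel {-A..A} (\<lambda>x. (g x)\<^sup>2)"
    using c by (intro borel_integrable_atLeastAtMost') simp
  have "sqnorm g = (LBINT x:{-A..A}. (g x)\<^sup>2)"
    unfolding sqnorm_def set_lebesgue_integral_def using g
    by (intro Bochner_Integration.integral_cong refl) (auto simp: indicator_def cpt_fun_def)
  then have "((\<lambda>x. (g x)\<^sup>2) has_integral 0) (cbox (-A) A)"
    using set_borel_integral_eq_integral[OF si] z integrable_integral by fastforce
  from has_integral_0_cbox_imp_0[OF c _ this] have "(g s)\<^sup>2 = 0" using s A by simp
  then show ?thesis by simp
qed

lemma box_op_eq_integral:
  assumes g: "cpt_fun A g" and J: "{s-1..s+1} \<inter> {-A..A} = {u..v}"
  shows "box_op g s = integral {u..v} g / 2"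
proof -
  have cg: "continuous_on {u..v} g"
    using g J unfolding cpt_fun_def by (metis continuous_on_subset inf_le2)
  have "(\<integral>t. indicator {s-1..s+1} t * g t \<partial>lborel) = (LBINT t:{u..v}. g t)"
    unfolding set_lebesgue_integral_def
  proof (intro Bochner_Integration.integral_cong refl)
    fix t
    show "indicator {s-1..s+1} t * g t = indicator {u..v} t *\<^sub>R g t"
      unfolding J[symmetric] using g by (auto simp: indicator_def cpt_fun_def)
  qed
  also have "\<dots> = integral {u..v} g"
    by (rule set_borel_integral_eq_integral(2)[OF borel_integrable_atLeastAtMost'[OF cg]])
  finally show ?thesis by (simp add: box_op_def)
qed

lemma box_form_eigen:
  assumes g: "cpt_fun A g" and e: "\<And>s. s \<in> {-A..A} \<Longrightarrow> box_op g s = \<eta> * g s"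
  shows "box_form g = \<eta> * sqnorm g"
proof -
  have "box_form g = (\<integral>s. \<eta> * (g s)\<^sup>2 \<partial>lborel)"
    unfolding box_form_def
  proof (intro Bochner_Integration.integral_cong refl)
    fix s
    show "g s * box_op g s = \<eta> * (g s)\<^sup>2"
      using e[of s] g by (cases "s \<in> {-A..A}") (auto simp: cpt_fun_def power2_eq_square)
  qed
  then show ?thesis by (simp add: sqnorm_def)
qed

text \<open>The shape in which elimination from the matching conditions yields the equation, with
  \<lambda> = 1/(2\<eta>).\<close>

lemma eta_eq_iff:
  assumes "\<eta> \<noteq> 0"
  shows "eta_eq D \<eta> \<longleftrightarrow> (1 + 1 / (2 * \<eta>) * (2 - D)) * cos (1 / (2 * \<eta>) * (D - 1)) = 2 - 2 * sin (1 / (2 * \<eta>) * (D - 1))"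
proof -
  have e: "1/2 + (2 - D) / (4 * \<eta>) = (1 + 1 / (2 * \<eta>) * (2 - D)) / 2" using assms by (simp add: field_simps)
  have t: "(D - 1) / (2 * \<eta>) = 1 / (2 * \<eta>) * (D - 1)" by simp
  have "K / 2 * C + S = 1 \<longleftrightarrow> K * C = 2 - 2 * S" for K C S :: real by (auto simp: field_simps)
  then show ?thesis unfolding eta_eq_def e t using assms by blast
qed

text \<open>A window centred in the first piece is cut off on the left, so moving its centre changes
  the integral only at the right end, which is the point one unit ahead, in the last piece; in the
  last piece the roles are reversed. In the middle the window covers the whole interval, hence the
  constant. For \<open>D = 2\<close> the middle is a single point.\<close>

lemma eigenvalue_imp_eta_eq:
  assumes D: "1 < D" "D \<le> 2" and g: "cpt_fun (D/2) g" and nz: "sqnorm g \<noteq> 0" and \<eta>: "\<eta> \<noteq> 0"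
    and eig: "\<And>s. s \<in> {-(D/2)..D/2} \<Longrightarrow> box_op g s = \<eta> * g s"
  shows "eta_eq D \<eta>"
proof -
  define A where "A = D / 2"
  define a where "a = - A"
  define d where "d = D - 1"
  define l where "l = 1 / (2 * \<eta>)"
  have d: "0 < d" "d \<le> 1" and aA: "a + 1 + d = A" and a0: "a < A" "a = - A" using D by (auto simp: d_def a_def A_def)
  have cg: "continuous_on {a..A} g" using g by (simp add: cpt_fun_def a_def A_def)
  have gi: "g integrable_on {u..v}" if "a \<le> u" "v \<le> A" for u v
    by (intro integrable_continuous_real continuous_on_subset[OF cg]) (use that in auto)
  have gs: "g s = l * integral {u..v} g" if "s \<in> {a..A}" "{s-1..s+1} \<inter> {a..A} = {u..v}" for s u v
    using eig[of s] box_op_eq_integral[OF g, of s u v] that \<eta> by (simp add: a_def A_def l_def field_simps)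
  define P where "P x = l * integral {a..a + 1 + x} g" for x
  define Q where "Q x = l * integral {a + x..A} g" for x
  define c where "c = l * integral {a..A} g"
  have gP: "g (a + x) = P x" if "x \<in> {0..d}" for x
    unfolding P_def by (rule gs) (use that d aA in auto)
  have gQ: "g (a + 1 + x) = Q x" if "x \<in> {0..d}" for x
    unfolding Q_def by (rule gs) (use that d aA in auto)
  have gc: "g (a + x) = c" if "x \<in> {d..1}" for x
    unfolding c_def by (rule gs) (use that d aA in auto)
  have dP: "(P has_real_derivative l * Q x) (at x within {0..d})" if x: "x \<in> {0..d}" for x
  proof -
    have "((\<lambda>y. integral {a..y} g) has_real_derivative g (a + 1 + x)) (at (a + 1 + x) within {a..A})"
      by (rule integral_has_real_derivative[OF cg]) (use x d aA in auto)
    then have "((\<lambda>y. integral {a..y} g) has_real_derivative g (a + 1 + x)) (at (a + 1 + x) within (\<lambda>x. a + 1 + x) ` {0..d})"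
      by (rule has_field_derivative_subset) (use d aA in auto)
    moreover have "((\<lambda>x. a + 1 + x) has_real_derivative 1) (at x within {0..d})"
      by (auto intro!: derivative_eq_intros)
    ultimately have "((\<lambda>x. integral {a..a + 1 + x} g) has_real_derivative g (a + 1 + x)) (at x within {0..d})"
      using DERIV_image_chain by (fastforce simp: o_def)
    from DERIV_cmult[OF this, of l] show ?thesis by (simp add: P_def[abs_def] gQ[OF x])
  qed
  have dQ: "(Q has_real_derivative - (l * P x)) (at x within {0..d})" if x: "x \<in> {0..d}" for x
  proof -
    have "((\<lambda>y. integral {y..A} g) has_real_derivative - g (a + x)) (at (a + x) within {a..A})"
      by (rule integral_has_real_derivative'[OF cg]) (use x d aA in auto)
    then have "((\<lambda>y. integral {y..A} g) has_real_derivative - g (a + x)) (at (a + x) within (\<lambda>x. a + x) ` {0..d})"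
      by (rule has_field_derivative_subset) (use d aA in auto)
    moreover have "((\<lambda>x. a + x) has_real_derivative 1) (at x within {0..d})"
      by (auto intro!: derivative_eq_intros)
    ultimately have "((\<lambda>x. integral {a + x..A} g) has_real_derivative - g (a + x)) (at x within {0..d})"
      using DERIV_image_chain by (fastforce simp: o_def)
    from DERIV_cmult[OF this, of l] show ?thesis by (simp add: Q_def[abs_def] gP[OF x])
  qed
  \<comment> \<open>The system for \<open>P\<close> and \<open>Q\<close> generates a rotation;
    rotating back by the angle \<open>l * x\<close> gives two conserved quantities, which solves
    it.\<close>
  have "\<exists>k. \<forall>x\<in>{0..d}. P x * cos (l * x) - Q x * sin (l * x) = k"
  proof (rule has_field_derivative_zero_constant)
    show "((\<lambda>x. P x * cos (l * x) - Q x * sin (l * x)) has_field_derivative 0) (at x within {0..d})" if "x \<in> {0..d}" for x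
      by (rule derivative_eq_intros dP[OF that] dQ[OF that] refl)+ (simp add: algebra_simps)
  qed auto
  then have u: "P x * cos (l * x) - Q x * sin (l * x) = P 0" if "x \<in> {0..d}" for x
  proof -
    assume "\<exists>k. \<forall>x\<in>{0..d}. P x * cos (l * x) - Q x * sin (l * x) = k"
    then obtain k where k: "\<And>x. x \<in> {0..d} \<Longrightarrow> P x * cos (l * x) - Q x * sin (l * x) = k" by blast
    show ?thesis using k[OF that] k[of 0] d by simp
  qed
  have "\<exists>k. \<forall>x\<in>{0..d}. P x * sin (l * x) + Q x * cos (l * x) = k"
  proof (rule has_field_derivative_zero_constant)
    show "((\<lambda>x. P x * sin (l * x) + Q x * cos (l * x)) has_field_derivative 0) (at x within {0..d})" if "x \<in> {0..d}" for x
      by (rule derivative_eq_intros dP[OF that] dQ[OF that] refl)+ (simp add: algebra_simps)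
  qed auto
  then have v: "P x * sin (l * x) + Q x * cos (l * x) = Q 0" if "x \<in> {0..d}" for x
  proof -
    assume "\<exists>k. \<forall>x\<in>{0..d}. P x * sin (l * x) + Q x * cos (l * x) = k"
    then obtain k where k: "\<And>x. x \<in> {0..d} \<Longrightarrow> P x * sin (l * x) + Q x * cos (l * x) = k" by blast
    show ?thesis using k[OF that] k[of 0] d by simp
  qed
  have Pd: "P d = c" and Q0: "Q 0 = c" by (auto simp: P_def Q_def c_def aA)
  \<comment> \<open>The domain of \<open>Q d\<close> is the whole interval without the first piece.
    The first piece is the window of \<open>P 0\<close> without the middle, on which
    \<open>g\<close> is \<open>c\<close>.\<close>
  have Qd: "Q d = c + l * (1 - d) * c - P 0"
  proof -
    have "integral {a + d..a + 1} g = integral {a + d..a + 1} (\<lambda>_. c)"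
      by (rule integral_cong) (use gc[of "_ - a"] in auto)
    also have "\<dots> = (1 - d) * c" using d by simp
    finally have m: "integral {a + d..a + 1} g = (1 - d) * c" .
    have "integral {a..a + d} g + integral {a + d..A} g = integral {a..A} g"
      by (rule Henstock_Kurzweil_Integration.integral_combine) (use d aA gi in auto)
    moreover have "integral {a..a + d} g + integral {a + d..a + 1} g = integral {a..a + 1} g"
      by (rule Henstock_Kurzweil_Integration.integral_combine) (use d aA gi in auto)
    ultimately have "integral {a + d..A} g = integral {a..A} g + (1 - d) * c - integral {a..a + 1} g" using m by simp
    then have "Q d = l * (integral {a..A} g + (1 - d) * c - integral {a..a + 1} g)" by (simp add: Q_def)
    also have "\<dots> = l * integral {a..A} g + l * (1 - d) * c - P 0" by (simp add: P_def algebra_simps)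
    finally show ?thesis by (simp only: c_def)
  qed
  define C S where "C = cos (l * d)" and "S = sin (l * d)"
  have CS: "C * C + S * S = 1" unfolding C_def S_def using sin_cos_squared_add[of "l * d"] by (simp add: power2_eq_square)
  have e1: "c * C - Q d * S = P 0" and e2: "c * S + Q d * C = c"
    using u[of d] v[of d] d by (auto simp: Pd Q0 C_def S_def)
  have "P 0 * C + c * S = c * (C * C + S * S)"
    unfolding e1[symmetric] using arg_cong[OF e2, of "\<lambda>x. x * S"] by (simp add: algebra_simps)
  then have X: "P 0 * C = c * (1 - S)" unfolding CS by (simp add: algebra_simps)
  have "c * C - P 0 * S = Q d * (C * C + S * S)"
    unfolding e1[symmetric] using arg_cong[OF e2, of "\<lambda>x. x * C"] by (simp add: algebra_simps)
  then have Y: "P 0 * (1 - S) = c * (1 + l * (1 - d) - C)" unfolding CS Qd by (simp add: algebra_simps)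
  \<comment> \<open>\<open>X\<close> and \<open>Y\<close> are the homogeneous system in
    \<open>P 0\<close> and \<open>c\<close>. Its determinant condition reads (1 - S)^2 = (1 + l (1 -
    d) - C) C, which becomes the goal on using C^2 + S^2 = 1.\<close>
  have "(1 + l * (1 - d)) * C = 2 - 2 * S"
  proof (cases "c = 0")
    case False
    have "c * (1 - S) * (1 - S) = c * (1 + l * (1 - d) - C) * C"
      unfolding X[symmetric] Y[symmetric] by (simp add: mult_ac)
    then have "(1 - S) * (1 - S) = (1 + l * (1 - d) - C) * C" using False by simp
    then show ?thesis using CS by (simp add: algebra_simps)
  next
    case True
    \<comment> \<open>Division by \<open>c\<close> is impossible here. But \<open>P 0\<close> and
      \<open>c\<close> determine \<open>g\<close>, so \<open>P 0\<close> is nonzero; then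
      \<open>X\<close> and \<open>Y\<close> give \<open>C = 0\<close> and \<open>S = 1\<close>,
      where both sides are 0.\<close>
    have "P 0 \<noteq> 0"
    proof
      assume P0: "P 0 = 0"
      have PQ: "P x = 0 \<and> Q x = 0" if x: "x \<in> {0..d}" for x
      proof -
        let ?C = "cos (l * x)" and ?S = "sin (l * x)"
        have 1: "?C * ?C + ?S * ?S = 1" using sin_cos_squared_add[of "l * x"] by (simp add: power2_eq_square)
        have 2: "P x * ?C = Q x * ?S" "P x * ?S = - (Q x * ?C)" using u[OF x] v[OF x] P0 Q0 True by auto
        have "P x * (?C * ?C + ?S * ?S) = (P x * ?C) * ?C + (P x * ?S) * ?S" by (simp only: distrib_left mult.assoc)
        then have "P x = 0" unfolding 1 2 by simp
        moreover from this have "Q x * ?S = 0" "Q x * ?C = 0" using 2 by auto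
        then have "Q x * (?C * ?C + ?S * ?S) = 0" by (simp only: distrib_left mult.assoc[symmetric] mult_zero_left add_0)
        ultimately show ?thesis unfolding 1 by simp
      qed
      have "g s = 0" for s
      proof (cases "s \<in> {a..A}")
        case False
        then show ?thesis using g by (auto simp: cpt_fun_def a_def A_def)
      next
        case s: True
        consider "s \<le> a + d" | "a + d \<le> s" "s \<le> a + 1" | "a + 1 \<le> s" by linarith
        then show ?thesis
        proof cases
          case 1 then show ?thesis using gP[of "s - a"] PQ[of "s - a"] s by simp
        next
          case 2 then show ?thesis using gc[of "s - a"] True by simp
        next
          case 3 then show ?thesis using gQ[of "s - a - 1"] PQ[of "s - a - 1"] s aA by simp
        qed
      qed
      then have "sqnorm g = 0" by (simp add: sqnorm_def)
      then show False using nz by simp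
    qed
    then have "C = 0" "S = 1" using X Y True by auto
    then show ?thesis by simp
  qed
  then show ?thesis unfolding eta_eq_iff[OF \<eta>] C_def S_def l_def d_def by simp
qed

text \<open>Converse construction: a null vector of the singular system gives the initial values of
  the rotation, and the two equations of the system are what makes the pieces fit.\<close>

lemma eta_eq_imp_eigenvalue:
  assumes D: "1 < D" "D \<le> 2" and eq: "eta_eq D \<eta>"
  obtains g where "cpt_fun (D/2) g" "sqnorm g \<noteq> 0" "\<And>s. s \<in> {-(D/2)..D/2} \<Longrightarrow> box_op g s = \<eta> * g s"
proof -
  define A where "A = D / 2"
  define a where "a = - A"
  define d where "d = D - 1"
  define l where "l = 1 / (2 * \<eta>)"
  have d: "0 < d" "d \<le> 1" and aA: "a + 1 + d = A" and a0: "a < A" "a = - A" using D by (auto simp: d_def a_def A_def)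
  have \<eta>: "\<eta> \<noteq> 0" using eq by (simp add: eta_eq_def)
  then have l: "l \<noteq> 0" by (simp add: l_def)
  define C S where "C = cos (l * d)" and "S = sin (l * d)"
  have CS: "C * C + S * S = 1" unfolding C_def S_def using sin_cos_squared_add[of "l * d"] by (simp add: power2_eq_square)
  have det: "(1 + l * (1 - d)) * C = 2 - 2 * S"
    using eq unfolding eta_eq_iff[OF \<eta>] C_def S_def l_def d_def by simp
  \<comment> \<open>The null vector is \<open>(1, 0)\<close> if \<open>C = 0\<close>, which forces
    \<open>S = 1\<close>, and \<open>(1 - S, C)\<close> otherwise.\<close>
  obtain p c where pc: "p \<noteq> 0 \<or> c \<noteq> 0" and X: "p * C = c * (1 - S)" and Y: "p * (1 - S) = c * (1 + l * (1 - d) - C)"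
  proof (cases "C = 0")
    case True
    then have "S = 1" using det by simp
    show thesis by (rule that[of 1 0]) (use True \<open>S = 1\<close> in auto)
  next
    case False
    have "(1 - S) * (1 - S) = (1 + l * (1 - d) - C) * C" using det CS by (simp add: algebra_simps)
    then show thesis by (intro that[of "1 - S" C]) (use False in \<open>auto simp: mult_ac\<close>)
  qed
  define P where "P x = p * cos (l * x) + c * sin (l * x)" for x
  define Q where "Q x = - p * sin (l * x) + c * cos (l * x)" for x
  have P0: "P 0 = p" and Q0: "Q 0 = c" by (auto simp: P_def Q_def)
  have Pd: "P d = c" using X by (simp add: P_def C_def S_def algebra_simps)
  have Qd: "Q d = c + l * (1 - d) * c - p" using Y by (simp add: Q_def C_def S_def algebra_simps)
  \<comment> \<open>Clamping the arguments puts the three pieces into one visibly continuous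
    formula: on each piece the inactive terms take the value \<open>c\<close>, by \<open>Pd\<close>
    and \<open>Q0\<close>, and the subtraction removes the excess.\<close>
  define h where "h s = P (min (s - a) d) + Q (max (s - a - 1) 0) - c" for s
  define g where "g = (\<lambda>s. if s \<in> {-A..A} then h s else 0)"
  have "continuous_on {-A..A} h"
    unfolding h_def P_def Q_def by (intro continuous_intros)
  then have g: "cpt_fun A g" unfolding g_def by (rule cpt_fun_restrict)
  have gP: "g s = P (s - a)" if "s \<in> {a..a + d}" for s
    using that d aA a0 by (auto simp: g_def h_def min_def max_def Q0)
  have gc: "g s = c" if "s \<in> {a + d..a + 1}" for s
  proof -
    have "min (s - a) d = d" "max (s - a - 1) 0 = 0" "s \<in> {-A..A}" using that d aA a0 by auto
    then show ?thesis by (simp add: g_def h_def Pd Q0)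
  qed
  have gQ: "g s = Q (s - a - 1)" if "s \<in> {a + 1..A}" for s
  proof -
    have "min (s - a) d = d" "max (s - a - 1) 0 = s - a - 1" "s \<in> {-A..A}" using that d aA a0 by auto
    then show ?thesis by (simp add: g_def h_def Pd)
  qed
  have I1: "(g has_integral (Q u - Q v) / l) {a + u..a + v}" if "0 \<le> u" "u \<le> v" "v \<le> d" for u v
  proof -
    have "((\<lambda>s. P (s - a)) has_integral (- Q (a + v - a) / l) - (- Q (a + u - a) / l)) {a + u..a + v}"
    proof (rule fundamental_theorem_of_calculus)
      show "((\<lambda>s. - Q (s - a) / l) has_vector_derivative P (s - a)) (at s within {a + u..a + v})" for s
        unfolding has_real_derivative_iff_has_vector_derivative[symmetric] P_def Q_def
        using l by (auto intro!: derivative_eq_intros simp: field_simps)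
    qed (use that in auto)
    then have "((\<lambda>s. P (s - a)) has_integral (Q u - Q v) / l) {a + u..a + v}" by (simp add: diff_divide_distrib)
    then show ?thesis by (rule has_integral_eq[rotated]) (use that gP in auto)
  qed
  have I2: "(g has_integral (1 - d) * c) {a + d..a + 1}"
  proof -
    have "((\<lambda>_. c) has_integral (1 - d) * c) {a + d..a + 1}"
      using has_integral_const_real[of c "a + d" "a + 1"] d by simp
    then show ?thesis by (rule has_integral_eq[rotated]) (use gc in auto)
  qed
  have I3: "(g has_integral (P v - p) / l) {a + 1..a + 1 + v}" if "0 \<le> v" "v \<le> d" for v
  proof -
    have "((\<lambda>s. Q (s - a - 1)) has_integral (P (a + 1 + v - a - 1) / l) - (P (a + 1 - a - 1) / l)) {a + 1..a + 1 + v}"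
    proof (rule fundamental_theorem_of_calculus)
      show "((\<lambda>s. P (s - a - 1) / l) has_vector_derivative Q (s - a - 1)) (at s within {a + 1..a + 1 + v})" for s
        unfolding has_real_derivative_iff_has_vector_derivative[symmetric] P_def Q_def
        using l by (auto intro!: derivative_eq_intros simp: field_simps)
    qed (use that in auto)
    then have "((\<lambda>s. Q (s - a - 1)) has_integral (P v - p) / l) {a + 1..a + 1 + v}" by (simp add: diff_divide_distrib P0)
    then show ?thesis by (rule has_integral_eq[rotated]) (use that gQ aA in auto)
  qed
  \<comment> \<open>Covers the windows of all three pieces: \<open>u = 0\<close> for the first,
    \<open>v = d\<close> for the last, both for the middle. The value of \<open>Qd\<close> cancels
    the contribution of the middle piece.\<close>
  have I: "integral {a + u..a + 1 + v} g = (Q u + P v - c) / l" if "0 \<le> u" "u \<le> d" "0 \<le> v" "v \<le> d" for u v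
  proof -
    have "(g has_integral (Q u - Q d) / l + (1 - d) * c) {a + u..a + 1}"
      by (rule has_integral_combine[OF _ _ I1 I2]) (use that d in auto)
    then have "(g has_integral ((Q u - Q d) / l + (1 - d) * c) + (P v - p) / l) {a + u..a + 1 + v}"
      by (rule has_integral_combine[rotated 2, OF _ I3]) (use that d in auto)
    moreover have "((Q u - Q d) / l + (1 - d) * c) + (P v - p) / l = (Q u + P v - c) / l"
      using l by (simp add: Qd field_simps)
    ultimately show ?thesis using integral_unique by metis
  qed
  have eig: "box_op g s = \<eta> * g s" if s: "s \<in> {-A..A}" for s
  proof -
    have \<eta>l: "x / l / 2 = \<eta> * x" for x using \<eta> by (simp add: l_def)
    consider "s \<le> a + d" | "a + d \<le> s" "s \<le> a + 1" | "a + 1 \<le> s" by linarith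
    then show ?thesis
    proof cases
      case 1
      have "box_op g s = integral {a + 0..a + 1 + (s - a)} g / 2"
        by (rule box_op_eq_integral[OF g]) (use 1 s aA a0 d in auto)
      also have "\<dots> = P (s - a) / l / 2" using 1 s a0 d by (subst I) (auto simp: Q0)
      also have "\<dots> = \<eta> * g s" unfolding \<eta>l using 1 s a0 by (subst gP) auto
      finally show ?thesis .
    next
      case 2
      have "box_op g s = integral {a + 0..a + 1 + d} g / 2"
        by (rule box_op_eq_integral[OF g]) (use 2 s aA a0 d in auto)
      also have "\<dots> = c / l / 2" using d by (subst I) (auto simp: Q0 Pd)
      also have "\<dots> = \<eta> * g s" unfolding \<eta>l using 2 by (subst gc) auto
      finally show ?thesis .
    next
      case 3
      have "box_op g s = integral {a + (s - a - 1)..a + 1 + d} g / 2"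
        by (rule box_op_eq_integral[OF g]) (use 3 s aA a0 d in auto)
      also have "\<dots> = Q (s - a - 1) / l / 2" using 3 s aA d by (subst I) (auto simp: Pd)
      also have "\<dots> = \<eta> * g s" unfolding \<eta>l using 3 s by (subst gQ) auto
      finally show ?thesis .
    qed
  qed
  have "sqnorm g \<noteq> 0"
  proof
    assume z: "sqnorm g = 0"
    have "g a = p" "g (a + 1) = c" using gP[of a] gc[of "a + 1"] d P0 by auto
    moreover have "g a = 0" "g (a + 1) = 0"
      by (rule sqnorm_eq_0D[OF g z]; use a0 aA d in auto)+
    ultimately show False using pc by simp
  qed
  then show thesis using that[of g] g eig by (simp add: A_def)
qed

section \<open>The extremal constants\<close>

text \<open>The interval is no longer than 1, so every window centred in it covers it and the image
  of \<open>g\<close> is constant there.\<close>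

lemma box_form_short:
  assumes D: "0 < D" "D \<le> 1" and g: "cpt_fun (D/2) g"
  shows "box_form g = (\<integral>t. g t \<partial>lborel)\<^sup>2 / 2"
proof -
  let ?I = "\<integral>t. g t \<partial>lborel"
  have zero: "g s = 0" if "s \<notin> {-(D/2)..D/2}" for s
    using g that by (auto simp: cpt_fun_def)
  have "box_op g s = ?I / 2" if "s \<in> {-(D/2)..D/2}" for s
  proof -
    have "indicator {s-1..s+1} t * g t = g t" for t
      using zero[of t] that D by (cases "t \<in> {-(D/2)..D/2}") (auto simp: indicator_def)
    then have "(\<lambda>t. indicator {s-1..s+1} t * g t) = g" by (rule ext)
    then show ?thesis unfolding box_op_def by (simp only:)
  qed
  then have "g s * box_op g s = g s * (?I / 2)" for s
    using zero[of s] by (cases "s \<in> {-(D/2)..D/2}") auto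
  then have "box_form g = (\<integral>s. g s * (?I / 2) \<partial>lborel)" unfolding box_form_def by (simp only:)
  then show ?thesis by (simp add: power2_eq_square)
qed

text \<open>The extremal functions are the constant, with value \<open>D / 2\<close>, and any
  function of mean zero, with value 0.\<close>

lemma constants_short:
  assumes D: "0 < D" "D \<le> 1"
  shows "Cminus D = sqrt (1 - D / 2)" "Cplus D = 1"
proof -
  let ?I = "{-(D/2)..D/2}"
  define one where "one = (\<lambda>s::real. if s \<in> ?I then 1 else (0::real))"
  have one: "cpt_fun (D/2) one" unfolding one_def by (rule cpt_fun_restrict) auto
  have one_ind: "one = indicator ?I" by (auto simp: one_def indicator_def)
  have int1: "(\<integral>t. one t \<partial>lborel) = D" unfolding one_ind using D by simp
  have sq1: "sqnorm one = D"
  proof -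
    have "(\<lambda>s. (one s)\<^sup>2) = one" by (auto simp: one_def)
    then show ?thesis using int1 by (simp add: sqnorm_def)
  qed
  show "Cminus D = sqrt (1 - D / 2)"
  proof (rule Cminus_eq[OF D(1) one])
    show "sqnorm one \<noteq> 0" using sq1 D by simp
    show "box_form one = D / 2 * sqnorm one"
      unfolding box_form_short[OF D one] sq1 int1 by (simp add: power2_eq_square)
    fix h :: "real \<Rightarrow> real" assume h: "cpt_fun (D/2) h"
    have ip: "(\<integral>t. h t * one t \<partial>lborel) = (\<integral>t. h t \<partial>lborel)"
      using h by (intro Bochner_Integration.integral_cong refl) (auto simp: one_def cpt_fun_def)
    define c where "c = (\<integral>t. h t \<partial>lborel) / D"
    have c: "(\<integral>t. h t \<partial>lborel) = c * D" using D by (simp add: c_def)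
    \<comment> \<open>Subtracting the mean of \<open>h\<close> gives Cauchy-Schwarz against the
      constant.\<close>
    have "0 \<le> sqnorm (\<lambda>x. 1 * h x + (- c) * one x)" by (rule sqnorm_nonneg)
    then have "c\<^sup>2 * D \<le> sqnorm h"
      unfolding sqnorm_lin[OF h one] ip sq1 c by (simp add: power2_eq_square algebra_simps)
    then have "D * (c\<^sup>2 * D) \<le> D * sqnorm h" using D by (intro mult_left_mono) auto
    then show "box_form h \<le> D / 2 * sqnorm h"
      unfolding box_form_short[OF D h] c by (simp add: power2_eq_square mult_ac)
  qed
  \<comment> \<open>An odd function has integral 0; being nonzero at an endpoint, it is not the zero
    function.\<close>
  define x where "x = (\<lambda>s::real. if s \<in> ?I then s else 0)"
  have x: "cpt_fun (D/2) x" unfolding x_def by (rule cpt_fun_restrict) auto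
  have intx: "(\<integral>t. x t \<partial>lborel) = 0"
  proof -
    have "(\<integral>t. x t \<partial>lborel) = (\<integral>t. x (- t) \<partial>lborel)"
      by (subst lborel_integral_real_affine[where c = "-1" and t = 0]) auto
    also have "(\<lambda>t. x (- t)) = (\<lambda>t. - x t)" by (auto simp: x_def)
    finally show ?thesis by simp
  qed
  have "Cplus D = sqrt (1 - 0)"
  proof (rule Cplus_eq[OF D(1) x])
    show "sqnorm x \<noteq> 0"
    proof
      assume "sqnorm x = 0"
      then have "x (D/2) = 0" by (rule sqnorm_eq_0D[OF x]) (use D in auto)
      then show False using D by (simp add: x_def)
    qed
    show "box_form x = 0 * sqnorm x" unfolding box_form_short[OF D x] intx by simp
    show "0 * sqnorm h \<le> box_form h" if "cpt_fun (D/2) h" for h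
      unfolding box_form_short[OF D that] by simp
  qed
  then show "Cplus D = 1" by simp
qed

text \<open>The extreme values \<open>M\<close> and \<open>- N\<close> of the form are eigenvalues,
  hence solutions. Any other solution is the Rayleigh quotient of its own eigenfunction and
  therefore lies between them.\<close>

lemma constants_long:
  assumes D: "1 < D" "D \<le> 2"
  shows "\<exists>eta_p eta_m. is_arg_max id (eta_eq D) eta_p \<and> is_arg_min id (eta_eq D) eta_m
      \<and> Cminus D = sqrt (1 - eta_p) \<and> Cplus D = sqrt (1 - eta_m)"
proof -
  have D0: "D > 0" "D / 2 > 0" using D by auto
  have form: "\<exists>g. cpt_fun (D/2) g \<and> sqnorm g > 0 \<and> box_form g = \<eta> * sqnorm g" if \<eta>: "eta_eq D \<eta>" for \<eta>
  proof -
    obtain g where g: "cpt_fun (D/2) g" "sqnorm g \<noteq> 0" "\<And>s. s \<in> {-(D/2)..D/2} \<Longrightarrow> box_op g s = \<eta> * g s"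
      using eta_eq_imp_eigenvalue[OF D \<eta>] by blast
    moreover have "sqnorm g > 0" using g(2) sqnorm_nonneg[of g] by simp
    ultimately show ?thesis using box_form_eigen[OF g(1,3)] by blast
  qed
  \<comment> \<open>Chosen so that the angle is pi/2: the cosine kills the rational factor and the
    sine is 1. This solution shows that the form takes positive values.\<close>
  have pos: "eta_eq D ((D - 1) / pi)"
  proof -
    have "x / (2 * (x / pi)) = pi / 2" if "x \<noteq> 0" for x using that by simp
    from this[of "D - 1"] have t: "(D - 1) / (2 * ((D - 1) / pi)) = pi / 2" using D by simp
    show ?thesis unfolding eta_eq_def t using D by simp
  qed
  \<comment> \<open>The angle is now -3 pi/2, the negative angle closest to 0 whose sine is 1; this
    shows that the form takes negative values.\<close>
  have neg: "eta_eq D (- (D - 1) / (3 * pi))"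
  proof -
    have "x / (2 * (- x / (3 * pi))) = - (3 / 2 * pi)" if "x \<noteq> 0" for x using that by simp
    from this[of "D - 1"] have t: "(D - 1) / (2 * (- (D - 1) / (3 * pi))) = - (3 / 2 * pi)" using D by simp
    show ?thesis
      unfolding eta_eq_def t cos_minus sin_minus cos_3over2_pi sin_3over2_pi using D by simp
  qed
  obtain g where g: "cpt_fun (D/2) g" "sqnorm g > 0" "box_form g = (D - 1) / pi * sqnorm g" using form[OF pos] by blast
  have "1 * box_form g > 0" unfolding g(3) using D g(2) by simp
  then obtain M \<phi> where M: "M > 0" "cpt_fun (D/2) \<phi>" "sqnorm \<phi> \<noteq> 0"
      "\<And>s. s \<in> {-(D/2)..D/2} \<Longrightarrow> 1 * box_op \<phi> s = M * \<phi> s"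
      "\<And>g. cpt_fun (D/2) g \<Longrightarrow> 1 * box_form g \<le> M * sqnorm g"
    using box_form_max_attained[OF D0(2) _ g(1), of 1] by blast
  have eM: "eta_eq D M"
    by (rule eigenvalue_imp_eta_eq[OF D M(2,3)]) (use M in auto)
  have maxM: "\<eta> \<le> M" if \<eta>: "eta_eq D \<eta>" for \<eta>
  proof -
    obtain g where g: "cpt_fun (D/2) g" "sqnorm g > 0" "box_form g = \<eta> * sqnorm g" using form[OF \<eta>] by blast
    then show ?thesis using M(5)[OF g(1)] by simp
  qed
  obtain g' where g': "cpt_fun (D/2) g'" "sqnorm g' > 0" "box_form g' = - (D - 1) / (3 * pi) * sqnorm g'" using form[OF neg] by blast
  have "(D - 1) / (3 * pi) * sqnorm g' > 0" using D g'(2) by simp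
  moreover have "box_form g' = - ((D - 1) / (3 * pi) * sqnorm g')"
    unfolding g'(3) by (simp only: minus_divide_left[symmetric] mult_minus_left)
  ultimately have "-1 * box_form g' > 0" by simp
  then obtain N \<psi> where N: "N > 0" "cpt_fun (D/2) \<psi>" "sqnorm \<psi> \<noteq> 0"
      "\<And>s. s \<in> {-(D/2)..D/2} \<Longrightarrow> -1 * box_op \<psi> s = N * \<psi> s"
      "\<And>g. cpt_fun (D/2) g \<Longrightarrow> -1 * box_form g \<le> N * sqnorm g"
    using box_form_max_attained[OF D0(2) _ g'(1), of "-1"] by blast
  have eN': "box_op \<psi> s = - N * \<psi> s" if "s \<in> {-(D/2)..D/2}" for s using N(4)[OF that] by simp
  have eN: "eta_eq D (- N)"
    by (rule eigenvalue_imp_eta_eq[OF D N(2,3) _ eN']) (use N in auto)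
  have minN: "- N \<le> \<eta>" if \<eta>: "eta_eq D \<eta>" for \<eta>
  proof -
    obtain g where g: "cpt_fun (D/2) g" "sqnorm g > 0" "box_form g = \<eta> * sqnorm g" using form[OF \<eta>] by blast
    then have "(- \<eta>) * sqnorm g \<le> N * sqnorm g" using N(5)[OF g(1)] by simp
    then have "- \<eta> \<le> N" using g(2) by (simp only: mult_le_cancel_right_pos)
    then show ?thesis by simp
  qed
  have "box_form \<phi> = M * sqnorm \<phi>" by (rule box_form_eigen[OF M(2)]) (use M(4) in auto)
  then have "Cminus D = sqrt (1 - M)"
    by (rule Cminus_eq[OF D0(1) M(2,3)]) (use M(5) in auto)
  moreover have "box_form \<psi> = - N * sqnorm \<psi>" by (rule box_form_eigen[OF N(2) eN'])
  then have "Cplus D = sqrt (1 - (- N))"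
    by (rule Cplus_eq[OF D0(1) N(2,3)]) (use N(5) in \<open>force simp: minus_le_iff\<close>)
  moreover have "is_arg_max id (eta_eq D) M" "is_arg_min id (eta_eq D) (- N)"
    unfolding is_arg_max_def is_arg_min_def using eM eN maxM minN by (auto simp: not_less)
  ultimately show ?thesis by blast
qed

theorem theorem17:
  shows "(\<forall>Delta. 0 < Delta \<and> Delta \<le> 1 \<longrightarrow>
            Cminus Delta = sqrt (1 - Delta / 2) \<and> Cplus Delta = 1)
       \<and> (\<forall>Delta. 1 < Delta \<and> Delta \<le> 2 \<longrightarrow>
            (\<exists>eta_p eta_m. is_arg_max id (eta_eq Delta) eta_p \<and> is_arg_min id (eta_eq Delta) eta_m
               \<and> Cminus Delta = sqrt (1 - eta_p) \<and> Cplus Delta = sqrt (1 - eta_m)))"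
  using constants_short constants_long by blast

end
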